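(* Let $p,q>1$ be relatively prime integers and let $\alpha$ be the unique positive solution of $p^{-\alpha}+q^{-\alpha}-(pq)^{-\alpha}=\tfrac12$. Then there is a computable positive constant $C_{p,q}$ such that, as $x\to\infty$, $$S(x)=C_{p,q}\,x^\alpha(1+o(1)),$$ and $$C_{p,q}<2\left(\frac{\ln p^\alpha}{p^\alpha-1}+\frac{\ln q^\alpha}{q^\alpha-1}\right)^{-1}.$$
   Context: A strictly chained $(p,q)$-ary partition of $U$ is a finite sequence of distinct positive integers of the form $p^aq^b$ ($a,b\ge0$) summing to $U$, in decreasing order, each part a multiple of the next. $W(U)$ is the number of such partitions of $U$, and $S(x)=\sum_{1\le U\le\lfloor x\rfloor}W(U)$ for $x\in\mathbb{R}_+$. *)

theory Defs
  imports "HOL-Library.Landau_Symbols"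
begin

definition strictly_chained_partitions :: "nat \<Rightarrow> nat \<Rightarrow> nat \<Rightarrow> nat list set" where
  "strictly_chained_partitions p q U =
     {us. (\<forall>u \<in> set us. \<exists>a b. u = p ^ a * q ^ b) \<and>
          sorted_wrt (>) us \<and>
          successively (\<lambda>u v. v dvd u) us \<and>
          sum_list us = U}"

definition W :: "nat \<Rightarrow> nat \<Rightarrow> nat \<Rightarrow> nat" where
  "W p q U = card (strictly_chained_partitions p q U)"

definition S :: "nat \<Rightarrow> nat \<Rightarrow> real \<Rightarrow> nat" where
  "S p q x = (\<Sum>U = 1..nat \<lfloor>x\<rfloor>. W p q U)"

(* Kleene's total (general) recursive functions of k arguments, the arguments being passed as a
   list of length k; values on lists of any other length are irrelevant. Minimisation is
   restricted to regular functions, so no partial functions are needed; by Kleene's normal form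
   theorem this still yields all total recursive functions. *)
inductive recursive_fn :: "nat \<Rightarrow> (nat list \<Rightarrow> nat) \<Rightarrow> bool" where
  zero: "recursive_fn k (\<lambda>xs. 0)"
| suc: "recursive_fn 1 (\<lambda>xs. Suc (hd xs))"
| proj: "i < k \<Longrightarrow> recursive_fn k (\<lambda>xs. xs ! i)"
| comp: "recursive_fn (length gs) f \<Longrightarrow> (\<forall>g \<in> set gs. recursive_fn k g) \<Longrightarrow>
    recursive_fn k (\<lambda>xs. f (map (\<lambda>g. g xs) gs))"
| prim_rec: "recursive_fn k f \<Longrightarrow> recursive_fn (Suc (Suc k)) g \<Longrightarrow>
    recursive_fn (Suc k)
      (\<lambda>xs. rec_nat (f (tl xs)) (\<lambda>y r. g (y # r # tl xs)) (hd xs))"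
| minim: "recursive_fn (Suc k) g \<Longrightarrow> (\<forall>xs. length xs = k \<longrightarrow> (\<exists>y. g (y # xs) = 0)) \<Longrightarrow>
    recursive_fn k (\<lambda>xs. LEAST y. g (y # xs) = 0)"

definition computable_seq :: "(nat \<Rightarrow> nat) \<Rightarrow> bool" where
  "computable_seq f \<longleftrightarrow> (\<exists>F. recursive_fn 1 F \<and> (\<forall>n. f n = F [n]))"

(* The usual notion from computable analysis: some algorithm produces, for each n, a rational
   number within 2^(-n) of c. The rational is (a n - b n) / (d n + 1), so that its sign and its
   nonzero denominator are encoded by natural numbers. *)
definition computable_real :: "real \<Rightarrow> bool" where
  "computable_real c \<longleftrightarrow>
     (\<exists>a b d. computable_seq a \<and> computable_seq b \<and> computable_seq d \<and>
        (\<forall>n. \<bar>c - (real (a n) - real (b n)) / (real (d n) + 1)\<bar> \<le> 1 / 2 ^ n))"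

definition is_exponent :: "nat \<Rightarrow> nat \<Rightarrow> real \<Rightarrow> bool" where
  "is_exponent p q \<alpha> \<longleftrightarrow>
     \<alpha> > 0 \<and>
     real p powr (- \<alpha>) + real q powr (- \<alpha>) - real (p * q) powr (- \<alpha>) = 1 / 2"

end

(* Let T(x) = S(x) + 1 count all partitions of numbers up to x, and let w(n) be the number of partitions
of n without the part 1. Splitting according to the part 1 and to divisibility of all parts by p or q
gives T(x) = 2 T(x/p) + 2 T(x/q) - 2 T(x/(pq)) - w(x). With D(x) = T(x) - T(x/q) this becomes a recursion with
positive coefficients for the pair (D, T), which after division by x^alpha expresses both functions at x,
up to o(1), as convex combinations of D at x/p and T at x/q. Hence if T(x)/x^alpha is near its limsup (or
liminf) at x, then it is so at x/(p^i q^j) for bounded i and j; as log p / log q is irrational, these points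
become dense, and by monotonicity T(x)/x^alpha is near its limsup (or liminf) on arbitrarily long intervals.
On such an interval near L, the quantity J(x) = Phi(x) - 2 P Phi(x/p) - 2 Q Phi(x/q) + 2 P Q Phi(x/(pq)),
where P = p^-alpha, Q = q^-alpha and Phi(x) is alpha times the integral of S(u)/u^(alpha+1) up to x, is close to
L K, where K = ln(p^alpha)/(p^alpha - 1) + ln(q^alpha)/(q^alpha - 1). On the other hand, summation by parts shows
that J(n) tends to 1 - sum_V w(V) (V^-alpha - (V+1)^-alpha) as n runs through the integers. So limsup and
liminf agree, and C = (1 - sum_V w(V) (V^-alpha - (V+1)^-alpha)) / K. This is at most 1/K, and
it is computable because w(V) = O(V^beta) for some beta < alpha bounds the tails of the series. *)

theory Submission
  imports Defs "HOL-Library.Nat_Bijection" "HOL-Real_Asymp.Real_Asymp"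
    "HOL-Analysis.Kronecker_Approximation_Theorem"
begin

text \<open>The recursion for T has a negative coefficient at x/(pq), so a value near the limsup at
  x says nothing about the points below. Passing to D removes the sign: D(x) = 2 D(x/p) + S(x/q) + 1
  - w(x) and S(x) = 2 D(x/p) + 2 S(x/q) + 1 - w(x). If S behaves like L x^alpha, then D behaves like
  (1-Q) L x^alpha. Hence S is rescaled by 1-Q, after which the weights in both equations sum to 1,
  by the exponent equation (1-P)(1-Q) = 1/2. Averaging alone cannot identify the limit. J can: as 2P
  + 2Q - 2PQ = 1, it is a combination of differences of Phi, which involve S only on [x/(pq), x].
  The term w is negligible because P + Q < 1 leaves room for an exponent beta < alpha. Positivity of
  C is not visible in its series and comes from a separate lower bound of order x^alpha.
  Computability of powers, logarithms and inverses is obtained without error estimates: these reals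
  are given by semidecidable cuts against rationals, and an unbounded search turns cuts into
  approximations.\<close>

section \<open>Combinatorial recursions\<close>

text \<open>Divisibility is transitive, so the condition on neighbours extends to all pairs; merged
  with the order it becomes one relation that behaves well under appending and scaling.\<close>

lemma scp_sorted_wrt:
  "strictly_chained_partitions p q U =
     {us. (\<forall>u \<in> set us. \<exists>a b. u = p ^ a * q ^ b) \<and> sorted_wrt (\<lambda>u v. v < u \<and> v dvd u) us \<and>
       sum_list us = U}"
proof -
  have "successively (\<lambda>u v. v dvd u) us \<longleftrightarrow> sorted_wrt (\<lambda>u v. v dvd u) us" for us :: "nat list"
    by (rule successively_conv_sorted_wrt) (auto intro: transpI dvd_trans)
  moreover have "sorted_wrt (>) us \<and> sorted_wrt (\<lambda>u v. v dvd u) us \<longleftrightarrow>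
      sorted_wrt (\<lambda>u v. v < u \<and> v dvd u) us" for us :: "nat list"
    by (induction us) auto
  ultimately show ?thesis
    unfolding strictly_chained_partitions_def by blast
qed

lemma member_le_sum_list_nat: "u \<in> set us \<Longrightarrow> u \<le> sum_list us" for us :: "nat list"
  by (rule member_le_sum_list) auto

text \<open>Without finiteness \<open>card\<close> would default to 0. Strict decrease makes the
  entries distinct, and the sum bounds each of them.\<close>

lemma finite_scp: "finite (strictly_chained_partitions p q U)"
proof (rule finite_subset)
  show "strictly_chained_partitions p q U \<subseteq> {us. set us \<subseteq> {0..U} \<and> distinct us}"
  proof safe
    fix us assume us: "us \<in> strictly_chained_partitions p q U"
    have "sorted_wrt (\<lambda>u v. v \<noteq> u) us"
      using us unfolding scp_sorted_wrt by (auto elim: sorted_wrt_mono_rel[rotated])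
    then show "distinct us" by (induction us) auto
    fix u assume "u \<in> set us"
    then show "u \<in> {0..U}"
      using us member_le_sum_list_nat[of u us] unfolding scp_sorted_wrt by auto
  qed
  show "finite {us. set us \<subseteq> {0..U} \<and> distinct us}"
    by (rule finite_subset_distinct) auto
qed

definition W0 :: "nat \<Rightarrow> nat \<Rightarrow> nat \<Rightarrow> nat" where
  "W0 p q U = card {us \<in> strictly_chained_partitions p q U. 1 \<notin> set us}"

lemma W0_le_W: "W0 p q U \<le> W p q U"
  unfolding W0_def W_def by (rule card_mono) (auto simp: finite_scp)

locale coprime_bases =
  fixes p q :: nat
  assumes p_gt_1: "p > 1" and q_gt_1: "q > 1" and coprime: "coprime p q"
begin

lemma swap: "coprime_bases q p"
  using p_gt_1 q_gt_1 coprime by unfold_locales (auto simp: coprime_commute)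

abbreviation "scp \<equiv> strictly_chained_partitions p q"

lemma scp_0: "scp 0 = {[]}"
proof -
  have "us = []" if us: "us \<in> scp 0" for us
  proof (rule ccontr)
    assume "us \<noteq> []"
    then obtain u where u: "u \<in> set us" by (meson last_in_set)
    then have "u = 0" using us member_le_sum_list_nat[of u us] unfolding scp_sorted_wrt by auto
    moreover obtain a b where "u = p ^ a * q ^ b" using u us unfolding scp_sorted_wrt by blast
    ultimately show False using p_gt_1 q_gt_1 by simp
  qed
  moreover have "[] \<in> scp 0" unfolding scp_sorted_wrt by simp
  ultimately show ?thesis by blast
qed

text \<open>The empty list is the only partition of 0; \<open>W0 p q 0 = 1\<close> is the source of
  the constant 1 in \<open>Sr_rec\<close>.\<close>

lemma W_0: "W p q 0 = 1" and W0_0: "W0 p q 0 = 1"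
proof -
  show "W p q 0 = 1" unfolding W_def scp_0 by simp
  have "{us \<in> {[]}. 1 \<notin> set us} = {[] :: nat list}" by auto
  then show "W0 p q 0 = 1" unfolding W0_def scp_0 by simp
qed

text \<open>Parts are positive and decrease strictly, so a part 1 must come last. Deleting it leaves
  a partition of U without part 1, and any such partition can be extended again since 1 divides
  everything.\<close>

lemma W_Suc: "W p q (Suc U) = W0 p q (Suc U) + W0 p q U"
proof -
  let ?R = "\<lambda>u v :: nat. v < u \<and> v dvd u"
  have "{us \<in> scp (Suc U). 1 \<in> set us} = (\<lambda>us. us @ [1]) ` {us \<in> scp U. 1 \<notin> set us}"
  proof (intro set_eqI iffI)
    fix us assume "us \<in> {us \<in> scp (Suc U). 1 \<in> set us}"
    then have us: "us \<in> scp (Suc U)" and one: "1 \<in> set us" by auto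
    from one obtain xs ys where xy: "us = xs @ 1 # ys" by (meson split_list)
    have pos: "u > 0" if "u \<in> set us" for u
      using that us p_gt_1 q_gt_1 unfolding scp_sorted_wrt by fastforce
    have "ys = []"
    proof (rule ccontr)
      assume "ys \<noteq> []"
      then have "hd ys \<in> set ys" by simp
      then have "hd ys < 1" "hd ys > 0"
        using us pos unfolding xy scp_sorted_wrt by (auto simp: sorted_wrt_append)
      then show False by simp
    qed
    moreover have "xs \<in> scp U" "1 \<notin> set xs"
      using us unfolding xy scp_sorted_wrt \<open>ys = []\<close> by (auto simp: sorted_wrt_append)
    ultimately show "us \<in> (\<lambda>us. us @ [1]) ` {us \<in> scp U. 1 \<notin> set us}"
      unfolding xy by blast
  next
    fix us assume "us \<in> (\<lambda>us. us @ [1]) ` {us \<in> scp U. 1 \<notin> set us}"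
    then obtain xs where xs: "us = xs @ [1]" "xs \<in> scp U" "1 \<notin> set xs" by auto
    have "x > 1" if "x \<in> set xs" for x
    proof -
      have "x > 0" using that xs p_gt_1 q_gt_1 unfolding scp_sorted_wrt by fastforce
      with that xs(3) show ?thesis by (metis One_nat_def Suc_lessI)
    qed
    moreover have "\<exists>a b. 1 = p ^ a * q ^ b" by (rule exI[of _ 0], rule exI[of _ 0]) simp
    ultimately show "us \<in> {us \<in> scp (Suc U). 1 \<in> set us}"
      using xs unfolding scp_sorted_wrt by (auto simp: sorted_wrt_append)
  qed
  then have "card {us \<in> scp (Suc U). 1 \<in> set us} = W0 p q U"
    unfolding W0_def by (simp add: card_image inj_on_def)
  moreover have "scp (Suc U) = {us \<in> scp (Suc U). 1 \<notin> set us} \<union> {us \<in> scp (Suc U). 1 \<in> set us}"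
    by auto
  then have "card (scp (Suc U)) = card {us \<in> scp (Suc U). 1 \<notin> set us} + card {us \<in> scp (Suc U). 1 \<in> set us}"
    by (metis (no_types, lifting) card_Un_disjoint finite_scp finite_Un disjoint_iff mem_Collect_eq)
  ultimately show ?thesis unfolding W_def W0_def by simp
qed


text \<open>The bases need not be prime: with a = 0, p would divide q ^ b, to which it is coprime.
  This keeps quotients by p of the required form.\<close>

lemma p_dvd_part:
  assumes "p dvd p ^ a * q ^ b" shows "a > 0"
proof (rule ccontr)
  assume "\<not> a > 0"
  then have "p dvd q ^ b" using assms by simp
  moreover have "coprime p (q ^ b)" using coprime by simp
  ultimately have "p dvd 1" using coprime_absorb_left by blast
  then show False using p_gt_1 by simp
qed

text \<open>The predicate \<open>Q\<close> lets a second divisibility condition ride along, so that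
  the same bijection also handles the partitions divisible by both bases in
  \<open>W0_rec\<close>.\<close>

lemma scp_mult_p:
  "{us \<in> scp U. (\<forall>u\<in>set us. p dvd u) \<and> Q us} =
     (if p dvd U then map ((*) p) ` {us \<in> scp (U div p). Q (map ((*) p) us)} else {})"
proof (intro set_eqI iffI)
  fix us assume "us \<in> {us \<in> scp U. (\<forall>u\<in>set us. p dvd u) \<and> Q us}"
  then have us: "us \<in> scp U" and d: "\<And>u. u \<in> set us \<Longrightarrow> p dvd u" and Q: "Q us" by auto
  define vs where "vs = map (\<lambda>u. u div p) us"
  have usvs: "us = map ((*) p) vs"
    unfolding vs_def by (simp add: map_idI d)
  have sum: "U = p * sum_list vs"
    using us unfolding scp_sorted_wrt usvs by (simp add: sum_list_const_mult)
  have "\<exists>a b. v = p ^ a * q ^ b" if "v \<in> set vs" for v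
  proof -
    from that have "p * v \<in> set us" unfolding usvs by auto
    then obtain a b where ab: "p * v = p ^ a * q ^ b" using us unfolding scp_sorted_wrt by blast
    then have "a > 0" using p_dvd_part[of a b] by (metis dvd_triv_left)
    then have "p * v = p * (p ^ (a - 1) * q ^ b)" using ab by (cases a) auto
    then show ?thesis using p_gt_1 by auto
  qed
  moreover have "sorted_wrt (\<lambda>u v. v < u \<and> v dvd u) vs"
    using us p_gt_1 unfolding scp_sorted_wrt usvs by (simp add: sorted_wrt_map)
  ultimately have "vs \<in> scp (U div p)"
    unfolding scp_sorted_wrt sum using p_gt_1 by simp
  then show "us \<in> (if p dvd U then map ((*) p) ` {us \<in> scp (U div p). Q (map ((*) p) us)} else {})"
    using Q usvs sum by auto
next
  fix us assume "us \<in> (if p dvd U then map ((*) p) ` {us \<in> scp (U div p). Q (map ((*) p) us)} else {})"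
  then have "p dvd U" and "us \<in> map ((*) p) ` {us \<in> scp (U div p). Q (map ((*) p) us)}"
    by (auto split: if_splits)
  then obtain vs where vs: "us = map ((*) p) vs" "vs \<in> scp (U div p)" "Q us" by auto
  have "\<exists>a b. u = p ^ a * q ^ b" if "u \<in> set us" for u
  proof -
    from that obtain v where "v \<in> set vs" "u = p * v" using vs by auto
    moreover then obtain a b where "v = p ^ a * q ^ b" using vs unfolding scp_sorted_wrt by blast
    ultimately have "u = p ^ Suc a * q ^ b" by simp
    then show ?thesis by blast
  qed
  then show "us \<in> {us \<in> scp U. (\<forall>u\<in>set us. p dvd u) \<and> Q us}"
    using vs \<open>p dvd U\<close> p_gt_1 unfolding scp_sorted_wrt by (auto simp: sorted_wrt_map sum_list_const_mult)
qed

lemma card_scp_p_dvd: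
  "card {us \<in> scp U. (\<forall>u\<in>set us. p dvd u) \<and> Q us} =
     (if p dvd U then card {us \<in> scp (U div p). Q (map ((*) p) us)} else 0)"
proof -
  have "inj_on (map ((*) p)) A" for A
    using p_gt_1 by (intro inj_onI) (auto elim!: map_injective intro!: injI)
  then show ?thesis unfolding scp_mult_p by (simp add: card_image)
qed

lemma scp_swap: "strictly_chained_partitions q p U = scp U"
proof -
  have "(\<exists>a b. u = q ^ a * p ^ b) \<longleftrightarrow> (\<exists>a b. u = p ^ a * q ^ b)" for u
    by (metis mult.commute)
  then show ?thesis unfolding strictly_chained_partitions_def by simp
qed

lemma card_scp_q_dvd:
  "card {us \<in> scp U. (\<forall>u\<in>set us. q dvd u) \<and> Q us} =
     (if q dvd U then card {us \<in> scp (U div q). Q (map ((*) q) us)} else 0)"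
  using coprime_bases.card_scp_p_dvd[OF swap, of U Q] unfolding scp_swap .

text \<open>The last part divides all others. If it is not 1, one of its exponents is positive, and
  that base divides every part. For the empty list both sides hold.\<close>

lemma no_one_iff:
  assumes "us \<in> scp U"
  shows "1 \<notin> set us \<longleftrightarrow> (\<forall>u\<in>set us. p dvd u) \<or> (\<forall>u\<in>set us. q dvd u)"
proof
  assume no1: "1 \<notin> set us"
  show "(\<forall>u\<in>set us. p dvd u) \<or> (\<forall>u\<in>set us. q dvd u)"
  proof (cases us rule: rev_cases)
    case (snoc xs l)
    then obtain a b where ab: "l = p ^ a * q ^ b" using assms unfolding scp_sorted_wrt by auto
    have "l \<noteq> 1" using no1 snoc by auto
    then have "a > 0 \<or> b > 0" using ab by (metis mult_1 neq0_conv power_0)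
    then have "p dvd l \<or> q dvd l" unfolding ab by (auto intro: dvd_mult dvd_mult2 dvd_power)
    moreover have "\<forall>u\<in>set us. l dvd u" using assms unfolding scp_sorted_wrt snoc
      by (auto simp: sorted_wrt_append)
    ultimately show ?thesis using dvd_trans by blast
  qed simp
next
  assume "(\<forall>u\<in>set us. p dvd u) \<or> (\<forall>u\<in>set us. q dvd u)"
  then show "1 \<notin> set us" using p_gt_1 q_gt_1 by auto
qed

text \<open>Inclusion-exclusion over the two classes of \<open>no_one_iff\<close>; coprimality lets
  the condition on q pass through the factor p. The intersection is added on the left to avoid
  truncated subtraction.\<close>

lemma W0_rec:
  "W0 p q U + (if p * q dvd U then W p q (U div (p * q)) else 0) =
     (if p dvd U then W p q (U div p) else 0) + (if q dvd U then W p q (U div q) else 0)"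
proof -
  let ?A = "{us \<in> scp U. \<forall>u\<in>set us. p dvd u}" and ?B = "{us \<in> scp U. \<forall>u\<in>set us. q dvd u}"
  have A: "card ?A = (if p dvd U then W p q (U div p) else 0)"
    using card_scp_p_dvd[of U "\<lambda>_. True"] by (simp add: W_def)
  have B: "card ?B = (if q dvd U then W p q (U div q) else 0)"
    using card_scp_q_dvd[of U "\<lambda>_. True"] by (simp add: W_def)
  have "?A \<inter> ?B = {us \<in> scp U. (\<forall>u\<in>set us. p dvd u) \<and> (\<forall>u\<in>set us. q dvd u)}" by auto
  then have "card (?A \<inter> ?B) = (if p dvd U then card {us \<in> scp (U div p). \<forall>u\<in>set us. q dvd p * u} else 0)"
    using card_scp_p_dvd[of U "\<lambda>us. \<forall>u\<in>set us. q dvd u"] by simp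
  also have "{us \<in> scp (U div p). \<forall>u\<in>set us. q dvd p * u} = {us \<in> scp (U div p). \<forall>u\<in>set us. q dvd u}"
    using coprime by (simp add: coprime_dvd_mult_right_iff coprime_commute)
  also have "card \<dots> = (if q dvd U div p then W p q (U div p div q) else 0)"
    using card_scp_q_dvd[of "U div p" "\<lambda>_. True"] by (simp add: W_def)
  also have "(if p dvd U then \<dots> else 0) = (if p * q dvd U then W p q (U div (p * q)) else 0)"
    using p_gt_1 by (auto simp: div_mult2_eq dvd_mult_left dvd_div_iff_mult mult.commute)
  finally have AB: "card (?A \<inter> ?B) = (if p * q dvd U then W p q (U div (p * q)) else 0)" .
  have "{us \<in> scp U. 1 \<notin> set us} = ?A \<union> ?B"
  proof (rule set_eqI)
    show "us \<in> {us \<in> scp U. 1 \<notin> set us} \<longleftrightarrow> us \<in> ?A \<union> ?B" for us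
      using no_one_iff[of us U] by (cases "us \<in> scp U") simp_all
  qed
  then have "W0 p q U + card (?A \<inter> ?B) = card ?A + card ?B"
    unfolding W0_def using card_Un_Int[of ?A ?B] by (simp add: finite_scp)
  then show ?thesis unfolding A B AB .
qed

text \<open>This makes the summands of \<open>D\<close> nonnegative, hence \<open>D\<close>
  monotone.\<close>

lemma W0_ge: "q dvd U \<Longrightarrow> W p q (U div q) \<le> W0 p q U"
proof -
  assume q: "q dvd U"
  have "card {us \<in> scp U. \<forall>u\<in>set us. q dvd u} \<le> W0 p q U"
    unfolding W0_def
  proof (rule card_mono)
    show "{us \<in> scp U. \<forall>u\<in>set us. q dvd u} \<subseteq> {us \<in> scp U. 1 \<notin> set us}"
      using no_one_iff[of _ U] by blast
  qed (simp add: finite_scp)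
  then show ?thesis using q card_scp_q_dvd[of U "\<lambda>_. True"] by (simp add: W_def)
qed

end

section \<open>Computable functions of one argument\<close>

text \<open>Prescribing values only on lists of length k allows formulas with \<open>hd\<close> and
  \<open>!\<close>, whatever they give on other lists.\<close>

definition recursive_on :: "nat \<Rightarrow> (nat list \<Rightarrow> nat) \<Rightarrow> bool" where
  "recursive_on k f \<longleftrightarrow> (\<exists>F. recursive_fn k F \<and> (\<forall>xs. length xs = k \<longrightarrow> F xs = f xs))"

lemma recursive_on_fn: "recursive_fn k f \<Longrightarrow> recursive_on k f"
  unfolding recursive_on_def by blast

lemma recursive_on_cong:
  "recursive_on k f \<Longrightarrow> (\<And>xs. length xs = k \<Longrightarrow> f xs = g xs) \<Longrightarrow> recursive_on k g"
  unfolding recursive_on_def by auto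

lemma recursive_on_comp1:
  assumes "recursive_on 1 g" "recursive_on k f"
  shows "recursive_on k (\<lambda>xs. g [f xs])"
proof -
  from assms obtain G F where G: "recursive_fn 1 G" "\<And>xs. length xs = 1 \<Longrightarrow> G xs = g xs"
    and F: "recursive_fn k F" "\<And>xs. length xs = k \<Longrightarrow> F xs = f xs"
    unfolding recursive_on_def by blast
  have "recursive_fn k (\<lambda>xs. G (map (\<lambda>g. g xs) [F]))"
    by (rule recursive_fn.comp) (use G F in auto)
  then show ?thesis unfolding recursive_on_def using G F by (intro exI[of _ "\<lambda>xs. G [F xs]"]) auto
qed

lemma recursive_on_comp2:
  assumes "recursive_on 2 g" "recursive_on k f" "recursive_on k h"
  shows "recursive_on k (\<lambda>xs. g [f xs, h xs])"
proof -
  from assms obtain G F H where G: "recursive_fn 2 G" "\<And>xs. length xs = 2 \<Longrightarrow> G xs = g xs"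
    and F: "recursive_fn k F" "\<And>xs. length xs = k \<Longrightarrow> F xs = f xs"
    and H: "recursive_fn k H" "\<And>xs. length xs = k \<Longrightarrow> H xs = h xs"
    unfolding recursive_on_def by metis
  have "recursive_fn k (\<lambda>xs. G (map (\<lambda>g. g xs) [F, H]))"
    by (rule recursive_fn.comp) (use G F H in \<open>auto simp: numeral_2_eq_2\<close>)
  then show ?thesis unfolding recursive_on_def
    using G F H by (intro exI[of _ "\<lambda>xs. G [F xs, H xs]"]) auto
qed

lemma recursive_on_prim_rec:
  assumes "recursive_on k f" "recursive_on (Suc (Suc k)) g"
  shows "recursive_on (Suc k) (\<lambda>xs. rec_nat (f (tl xs)) (\<lambda>y r. g (y # r # tl xs)) (hd xs))"
proof -
  from assms obtain F G where F: "recursive_fn k F" "\<And>xs. length xs = k \<Longrightarrow> F xs = f xs"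
    and G: "recursive_fn (Suc (Suc k)) G" "\<And>xs. length xs = Suc (Suc k) \<Longrightarrow> G xs = g xs"
    unfolding recursive_on_def by metis
  show ?thesis
    by (rule recursive_on_cong[OF recursive_on_fn[OF recursive_fn.prim_rec[OF F(1) G(1)]]])
       (simp add: F G)
qed

lemma recursive_on_Least:
  assumes "recursive_on (Suc k) g" "\<And>xs. length xs = k \<Longrightarrow> \<exists>y. g (y # xs) = 0"
  shows "recursive_on k (\<lambda>xs. LEAST y. g (y # xs) = 0)"
proof -
  from assms obtain G where G: "recursive_fn (Suc k) G" "\<And>xs. length xs = Suc k \<Longrightarrow> G xs = g xs"
    unfolding recursive_on_def by metis
  have "recursive_fn k (\<lambda>xs. LEAST y. G (y # xs) = 0)"
    by (rule recursive_fn.minim[OF G(1)]) (use assms(2) G(2) in auto)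
  then show ?thesis
    by (rule recursive_on_cong[OF recursive_on_fn]) (simp add: G)
qed

lemma recursive_on_nth: "i < k \<Longrightarrow> recursive_on k (\<lambda>xs. xs ! i)"
  by (intro recursive_on_fn recursive_fn.proj)

lemma recursive_on_Suc: "recursive_on k f \<Longrightarrow> recursive_on k (\<lambda>xs. Suc (f xs))"
  using recursive_on_comp1[OF recursive_on_fn[OF recursive_fn.suc]] by simp

lemma length_1_hd: "length xs = 1 \<Longrightarrow> xs = [hd xs]"
  by (cases xs) auto

lemma computable_seq_iff: "computable_seq f \<longleftrightarrow> recursive_on 1 (\<lambda>xs. f (hd xs))"
proof
  assume "computable_seq f"
  then obtain F where F: "recursive_fn 1 F" "\<And>n. f n = F [n]" unfolding computable_seq_def by blast
  show "recursive_on 1 (\<lambda>xs. f (hd xs))"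
    by (rule recursive_on_cong[OF recursive_on_fn[OF F(1)]]) (metis F(2) length_1_hd)
next
  assume "recursive_on 1 (\<lambda>xs. f (hd xs))"
  then obtain F where "recursive_fn 1 F" "\<And>xs. length xs = 1 \<Longrightarrow> F xs = f (hd xs)"
    unfolding recursive_on_def by blast
  then show "computable_seq f" unfolding computable_seq_def by (intro exI[of _ F]) auto
qed

definition computable2 :: "(nat \<Rightarrow> nat \<Rightarrow> nat) \<Rightarrow> bool" where
  "computable2 f \<longleftrightarrow> recursive_on 2 (\<lambda>xs. f (xs ! 0) (xs ! 1))"

lemma recursive_on_apply1:
  assumes "computable_seq f" "recursive_on k g"
  shows "recursive_on k (\<lambda>xs. f (g xs))"
  using recursive_on_comp1[OF assms(1)[unfolded computable_seq_iff] assms(2)] by simp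

lemma recursive_on_apply2:
  assumes "computable2 f" "recursive_on k g" "recursive_on k h"
  shows "recursive_on k (\<lambda>xs. f (g xs) (h xs))"
  using recursive_on_comp2[OF assms(1)[unfolded computable2_def] assms(2,3)] by simp

lemma computable_apply: "computable_seq f \<Longrightarrow> computable_seq g \<Longrightarrow> computable_seq (\<lambda>n. f (g n))"
  unfolding computable_seq_iff[of g] computable_seq_iff[of "\<lambda>n. f (g n)"]
  by (rule recursive_on_apply1)

lemma computable_apply2:
  "computable2 h \<Longrightarrow> computable_seq f \<Longrightarrow> computable_seq g \<Longrightarrow> computable_seq (\<lambda>n. h (f n) (g n))"
  unfolding computable_seq_iff by (rule recursive_on_apply2)

section \<open>Arithmetic functions by primitive recursion\<close>

lemma computable_cong: "computable_seq f \<Longrightarrow> (\<And>n. f n = g n) \<Longrightarrow> computable_seq g"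
  by (metis ext)

lemma computable_id: "computable_seq (\<lambda>n. n)"
  unfolding computable_seq_iff
  by (rule recursive_on_cong[OF recursive_on_nth[of 0 1]]) (simp_all add: hd_conv_nth flip: length_greater_0_conv)

lemma computable_Suc: "computable_seq f \<Longrightarrow> computable_seq (\<lambda>n. Suc (f n))"
  unfolding computable_seq_iff by (rule recursive_on_Suc)

lemma computable_const: "computable_seq (\<lambda>n. c)"
proof (induction c)
  case 0
  show ?case unfolding computable_seq_iff by (rule recursive_on_fn[OF recursive_fn.zero])
qed (rule computable_Suc)

lemma computable2_rec:
  assumes b: "computable_seq b" and g: "recursive_on 3 (\<lambda>xs. g (xs ! 0) (xs ! 1) (xs ! 2))"
  shows "computable2 (\<lambda>x y. rec_nat (b y) (\<lambda>i r. g i r y) x)"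
proof -
  have "recursive_on (Suc 1) (\<lambda>xs. rec_nat (b (hd (tl xs)))
      (\<lambda>y r. (\<lambda>xs. g (xs ! 0) (xs ! 1) (xs ! 2)) (y # r # tl xs)) (hd xs))"
    by (rule recursive_on_prim_rec[OF b[unfolded computable_seq_iff]])
       (use g in \<open>simp add: numeral_3_eq_3\<close>)
  then show ?thesis unfolding computable2_def numeral_2_eq_2 One_nat_def
    by (rule recursive_on_cong) (auto simp: length_Suc_conv)
qed

lemma computable2_add: "computable2 (+)"
proof -
  have "computable2 (\<lambda>x y. rec_nat y (\<lambda>i r. Suc r) x)"
    by (rule computable2_rec[OF computable_id]) (auto intro!: recursive_on_Suc recursive_on_nth)
  moreover have "rec_nat y (\<lambda>i r. Suc r) x = x + y" for x y by (induction x) auto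
  ultimately show ?thesis by simp
qed

lemmas computable_add = computable_apply2[OF computable2_add]

lemma computable2_mult: "computable2 (*)"
proof -
  have "computable2 (\<lambda>x y. rec_nat 0 (\<lambda>i r. r + y) x)"
    by (rule computable2_rec[OF computable_const])
       (auto intro!: recursive_on_apply2[OF computable2_add] recursive_on_nth)
  moreover have "rec_nat 0 (\<lambda>i r. r + y) x = x * y" for x y :: nat by (induction x) auto
  ultimately show ?thesis by simp
qed

lemmas computable_mult = computable_apply2[OF computable2_mult]

lemma computable_rec0:
  assumes "computable2 g"
  shows "computable_seq (rec_nat c g)"
proof -
  have *: "recursive_on 3 (\<lambda>xs. g (xs ! 0) (xs ! 1))"
    by (rule recursive_on_apply2[OF assms]) (auto intro!: recursive_on_nth)
  have "computable2 (\<lambda>x y. rec_nat c g x)"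
    using computable2_rec[OF computable_const *] by simp
  then show ?thesis using computable_apply2 computable_id computable_const by fastforce
qed

lemma computable2_proj: "computable2 (\<lambda>x y. x)" "computable2 (\<lambda>x y. y)"
  unfolding computable2_def by (auto intro!: recursive_on_nth)

lemma computable_pred: "computable_seq (\<lambda>x. x - 1)"
proof -
  \<comment> \<open>The recursion step returns the counter and ignores the previous value.\<close>
  have "rec_nat 0 (\<lambda>x y. x) x = x - 1" for x :: nat by (cases x) auto
  then show ?thesis by (rule computable_cong[OF computable_rec0[OF computable2_proj(1), of 0]])
qed

text \<open>The arguments are swapped because the recursion runs over the subtrahend.\<close>

lemma computable2_diff: "computable2 (\<lambda>x y. y - x)"
proof -
  have "computable2 (\<lambda>x y. rec_nat y (\<lambda>i r. r - 1) x)"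
    by (rule computable2_rec[OF computable_id])
       (auto intro!: recursive_on_apply1[OF computable_pred, unfolded One_nat_def] recursive_on_nth)
  moreover have "rec_nat y (\<lambda>i r. r - 1) x = y - x" for x y :: nat by (induction x) auto
  ultimately show ?thesis by simp
qed

lemma computable_diff:
  "computable_seq f \<Longrightarrow> computable_seq g \<Longrightarrow> computable_seq (\<lambda>n. f n - g n)"
  using computable_apply2[OF computable2_diff] .

text \<open>With tuples coded by Cantor's pairing function, the closure rules below can be stated
  for functions of one argument.\<close>

abbreviation pair :: "nat \<Rightarrow> nat \<Rightarrow> nat" where "pair a b \<equiv> prod_encode (a, b)"
abbreviation pfst :: "nat \<Rightarrow> nat" where "pfst n \<equiv> fst (prod_decode n)"
abbreviation psnd :: "nat \<Rightarrow> nat" where "psnd n \<equiv> snd (prod_decode n)"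

lemma computable_triangle: "computable_seq triangle"
proof -
  have "computable2 (\<lambda>x r. Suc x + r)"
    unfolding computable2_def
    by (auto intro!: recursive_on_apply2[OF computable2_add] recursive_on_nth recursive_on_Suc
        simp flip: add_Suc)
  from computable_rec0[OF this, of 0] have "computable_seq (rec_nat 0 (\<lambda>x r. Suc x + r))" .
  moreover have "rec_nat 0 (\<lambda>x r. Suc x + r) n = triangle n" for n by (induction n) auto
  ultimately show ?thesis by (rule computable_cong)
qed

lemma triangle_mono: "m \<le> n \<Longrightarrow> triangle m \<le> triangle n"
  by (induction n) (auto simp: le_Suc_eq)

text \<open>The codes of pairs with sum s fill the interval from \<open>triangle s\<close> to just
  below \<open>triangle (Suc s)\<close>. So the sum is found by regular minimisation, and both
  coordinates follow by subtraction.\<close>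

lemma Least_triangle: "(LEAST t. Suc (pair a b) - triangle (Suc t) = 0) = a + b"
proof (rule Least_equality)
  fix t assume t: "Suc (pair a b) - triangle (Suc t) = 0"
  show "a + b \<le> t"
  proof (rule ccontr)
    assume "\<not> a + b \<le> t"
    then have "triangle (Suc t) \<le> triangle (a + b)" by (intro triangle_mono) auto
    then show False using t by (simp add: prod_encode_def)
  qed
qed (simp add: prod_encode_def)

lemma computable_Least_triangle: "computable_seq (\<lambda>n. LEAST t. Suc n - triangle (Suc t) = 0)"
proof -
  have g: "recursive_on (Suc 1) (\<lambda>xs. Suc (xs ! 1) - triangle (Suc (xs ! 0)))"
    by (rule recursive_on_apply2[OF computable2_diff])
       (intro recursive_on_apply1[OF computable_triangle] recursive_on_nth recursive_on_Suc; simp)+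
  have *: "\<exists>y. Suc n - triangle (Suc y) = 0" for n
    by (rule exI[of _ n]) simp
  show ?thesis unfolding computable_seq_iff
    by (rule recursive_on_cong[OF recursive_on_Least[OF g]]) (use * in \<open>auto simp: length_Suc_conv\<close>)
qed

lemma computable2_pair: "computable2 pair"
proof -
  have "computable2 (\<lambda>x y. triangle (x + y) + x)"
    unfolding computable2_def
    by (rule recursive_on_apply2[OF computable2_add
          recursive_on_apply1[OF computable_triangle
            recursive_on_apply2[OF computable2_add recursive_on_nth recursive_on_nth]]
          recursive_on_nth]) simp_all
  then show ?thesis by (simp add: prod_encode_def)
qed

lemmas computable_pair = computable_apply2[OF computable2_pair]

lemma computable_pfst: "computable_seq f \<Longrightarrow> computable_seq (\<lambda>n. pfst (f n))"
proof (rule computable_apply[of pfst])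
  have "n - triangle (LEAST t. Suc n - triangle (Suc t) = 0) = pfst n" for n
  proof -
    obtain a b where "n = pair a b" by (metis prod_decode_inverse prod.collapse)
    moreover have "pair a b - triangle (a + b) = a" by (simp add: prod_encode_def)
    ultimately show ?thesis by (simp only: Least_triangle) simp
  qed
  then show "computable_seq pfst"
    by (rule computable_cong[OF computable_diff[OF computable_id
          computable_apply[OF computable_triangle computable_Least_triangle]]])
qed

lemma computable_psnd: "computable_seq f \<Longrightarrow> computable_seq (\<lambda>n. psnd (f n))"
proof (rule computable_apply[of psnd])
  have "(LEAST t. Suc n - triangle (Suc t) = 0) - pfst n = psnd n" for n
  proof -
    obtain a b where "n = pair a b" by (metis prod_decode_inverse prod.collapse)
    then show ?thesis by (simp only: Least_triangle) simp
  qed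
  then show "computable_seq psnd"
    by (rule computable_cong[OF computable_diff[OF computable_Least_triangle
          computable_pfst[OF computable_id]]])
qed

lemma computable_rec:
  assumes b: "computable_seq b" and c: "computable_seq c"
    and g: "computable_seq (\<lambda>z. g (pfst z) (pfst (psnd z)) (psnd (psnd z)))"
  shows "computable_seq (\<lambda>n. rec_nat (b n) (\<lambda>i r. g i r n) (c n))"
proof -
  have "recursive_on 3 (\<lambda>xs. (\<lambda>z. g (pfst z) (pfst (psnd z)) (psnd (psnd z)))
      (pair (xs ! 0) (pair (xs ! 1) (xs ! 2))))"
    by (rule recursive_on_apply1[OF g]) (auto intro!: recursive_on_apply2[OF computable2_pair] recursive_on_nth)
  then have "recursive_on 3 (\<lambda>xs. g (xs ! 0) (xs ! 1) (xs ! 2))" by simp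
  from computable_apply2[OF computable2_rec[OF b this] c computable_id] show ?thesis .
qed

lemma computable_Least:
  assumes g: "computable_seq (\<lambda>z. g (pfst z) (psnd z))" and ex: "\<And>n. \<exists>y. g y n = (0::nat)"
  shows "computable_seq (\<lambda>n. LEAST y. g y n = 0)"
proof -
  have "recursive_on (Suc 1) (\<lambda>xs. (\<lambda>z. g (pfst z) (psnd z)) (pair (xs ! 0) (xs ! 1)))"
    by (rule recursive_on_apply1[OF g]) (auto intro!: recursive_on_apply2[OF computable2_pair] recursive_on_nth)
  then have g': "recursive_on (Suc 1) (\<lambda>xs. g (xs ! 0) (xs ! 1))" by simp
  show ?thesis unfolding computable_seq_iff
    by (rule recursive_on_cong[OF recursive_on_Least[OF g']]) (use ex in \<open>auto simp: length_Suc_conv\<close>)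
qed


section \<open>Decidable predicates\<close>

definition decidable :: "(nat \<Rightarrow> bool) \<Rightarrow> bool" where
  "decidable P \<longleftrightarrow> computable_seq (\<lambda>n. of_bool (P n))"

text \<open>Subtraction is truncated, so 1 - (f n - g n) is the indicator of the inequality.\<close>

lemma decidable_le:
  assumes "computable_seq f" "computable_seq g" shows "decidable (\<lambda>n. f n \<le> g n)"
  unfolding decidable_def
  by (rule computable_cong[OF computable_diff[OF computable_const[of 1] computable_diff[OF assms]]]) auto

lemma decidable_conj: "decidable P \<Longrightarrow> decidable Q \<Longrightarrow> decidable (\<lambda>n. P n \<and> Q n)"
  unfolding decidable_def of_bool_conj by (rule computable_mult)

lemma decidable_not: "decidable P \<Longrightarrow> decidable (\<lambda>n. \<not> P n)"
  unfolding decidable_def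
  by (rule computable_cong[OF computable_diff[OF computable_const[of 1]]]) auto

lemma decidable_disj: "decidable P \<Longrightarrow> decidable Q \<Longrightarrow> decidable (\<lambda>n. P n \<or> Q n)"
  using decidable_not[OF decidable_conj[OF decidable_not decidable_not]] by fastforce

lemma decidable_less:
  "computable_seq f \<Longrightarrow> computable_seq g \<Longrightarrow> decidable (\<lambda>n. f n < g n)"
  using decidable_not[OF decidable_le[of g f]] by (simp add: not_le)

lemma decidable_eq:
  "computable_seq f \<Longrightarrow> computable_seq g \<Longrightarrow> decidable (\<lambda>n. f n = g n)"
  using decidable_conj[OF decidable_le[of f g] decidable_le[of g f]] by (simp add: order_eq_iff)

lemma computable_if:
  assumes "decidable P" "computable_seq f" "computable_seq g"
  shows "computable_seq (\<lambda>n. if P n then f n else g n)"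
  using assms(1) unfolding decidable_def
  by (rule computable_cong[OF computable_add[OF computable_mult[OF _ assms(2)]
        computable_mult[OF decidable_not[OF assms(1), unfolded decidable_def] assms(3)]]]) auto

lemma computable_Least_pred:
  assumes "decidable (\<lambda>z. P (pfst z) (psnd z))" "\<And>n. \<exists>y. P y n"
  shows "computable_seq (\<lambda>n. LEAST y. P y n)"
proof -
  have "computable_seq (\<lambda>n. LEAST y. (of_bool (\<not> P y n) :: nat) = 0)"
    by (rule computable_Least) (use decidable_not[OF assms(1)] assms(2) in \<open>auto simp: decidable_def\<close>)
  then show ?thesis by simp
qed

lemmas computable_basic_intros =
  computable_id computable_const computable_Suc computable_add computable_mult computable_diff
  computable_pair computable_pfst computable_psnd computable_if
  decidable_le decidable_less decidable_eq decidable_conj decidable_disj decidable_not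

lemma computable_div:
  assumes "computable_seq f" "computable_seq g"
  shows "computable_seq (\<lambda>n. f n div g n)"
proof -
  \<comment> \<open>The second disjunct keeps the search regular for divisor 0 and yields 0 then,
    the value of \<open>div\<close> there.\<close>
  have "computable_seq (\<lambda>z. LEAST y. pfst z < psnd z * Suc y \<or> psnd z = 0)"
  proof (rule computable_Least_pred)
    fix z
    have "pfst z < psnd z * Suc (pfst z) \<or> psnd z = 0" by (cases "psnd z") auto
    then show "\<exists>y. pfst z < psnd z * Suc y \<or> psnd z = 0" by blast
  qed (intro computable_basic_intros)
  then have "computable_seq (\<lambda>n. LEAST y. f n < g n * Suc y \<or> g n = 0)"
    using computable_apply[OF _ computable_pair[OF assms]] by fastforce
  moreover have "(LEAST y. a < b * Suc y \<or> b = 0) = a div b" for a b :: nat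
  proof (cases "b = 0")
    case False
    show ?thesis
    proof (rule Least_equality)
      show "a < b * Suc (a div b) \<or> b = 0" using False dividend_less_times_div[of b a] by simp
    next
      fix y assume "a < b * Suc y \<or> b = 0"
      then have "a div b < Suc y" using False by (simp add: div_less_iff_less_mult mult.commute)
      then show "a div b \<le> y" by simp
    qed
  qed simp
  ultimately show ?thesis by simp
qed

lemma decidable_dvd:
  assumes "computable_seq f" "computable_seq g"
  shows "decidable (\<lambda>n. f n dvd g n)"
proof -
  have "decidable (\<lambda>n. f n * (g n div f n) = g n)"
    by (intro computable_basic_intros computable_div assms)
  moreover have "f n * (g n div f n) = g n \<longleftrightarrow> f n dvd g n" for n
    by (metis dvd_mult_div_cancel dvd_triv_left)
  ultimately show ?thesis by simp
qed

lemma computable_power: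
  assumes "computable_seq f" "computable_seq g"
  shows "computable_seq (\<lambda>n. f n ^ g n)"
proof -
  have "computable_seq (\<lambda>n. rec_nat 1 (\<lambda>i r. f n * r) (g n))"
    by (intro computable_rec computable_basic_intros assms computable_apply[OF assms(1)])
  moreover have "rec_nat 1 (\<lambda>i r. x * r) k = x ^ k" for x k :: nat by (induction k) auto
  ultimately show ?thesis by simp
qed

lemma computable_sum:
  assumes "computable_seq (\<lambda>z. f (pfst z) (psnd z))" "computable_seq c"
  shows "computable_seq (\<lambda>n. \<Sum>i<c n. f i n)"
proof -
  have "computable_seq (\<lambda>z. f (pfst z) (psnd (psnd z)))"
    using computable_apply[OF assms(1) computable_pair[OF computable_pfst[OF computable_id]
          computable_psnd[OF computable_psnd[OF computable_id]]]] by simp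
  then have "computable_seq (\<lambda>n. rec_nat 0 (\<lambda>i r. r + f i n) (c n))"
    by (intro computable_rec computable_basic_intros assms)
  moreover have "rec_nat 0 (\<lambda>i r. r + f i n) k = (\<Sum>i<k. f i n)" for n k by (induction k) auto
  ultimately show ?thesis by simp
qed

lemmas computable_intros = computable_basic_intros computable_div computable_power decidable_dvd

text \<open>Course-of-values recursion: the history of a function is passed as an iterated pair, most
  recent value first.\<close>

definition history :: "(nat \<Rightarrow> nat) \<Rightarrow> nat \<Rightarrow> nat" where
  "history f n = rec_nat 0 (\<lambda>i h. pair (f i) h) n"

definition history_nth :: "nat \<Rightarrow> nat \<Rightarrow> nat \<Rightarrow> nat" where
  "history_nth h n i = pfst (rec_nat h (\<lambda>_. psnd) (n - Suc i))"

text \<open>Removing n - Suc i entries from the front leaves the history of length i + 1, whose head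
  is f i.\<close>

lemma history_nth: "i < n \<Longrightarrow> history_nth (history f n) n i = f i"
proof -
  have rec: "rec_nat (pair a h) (\<lambda>_. psnd) (Suc k) = rec_nat h (\<lambda>_. psnd) k" for a h k
    by (induction k) auto
  have "rec_nat (history f n) (\<lambda>_. psnd) (n - Suc i) = history f (Suc i)" if "i < n"
    using that
  proof (induction n)
    case (Suc n)
    show ?case
    proof (cases "i = n")
      case False
      then have "Suc n - Suc i = Suc (n - Suc i)" using Suc.prems by simp
      then show ?thesis using Suc False rec[of "f n" "history f n"] by (simp add: history_def)
    qed simp
  qed simp
  then show "i < n \<Longrightarrow> ?thesis" by (simp add: history_nth_def) (simp add: history_def)
qed

lemma computable_history_nth:
  assumes "computable_seq h" "computable_seq n" "computable_seq i"
  shows "computable_seq (\<lambda>z. history_nth (h z) (n z) (i z))"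
  unfolding history_nth_def by (intro computable_intros computable_rec assms)

lemma computable_course_of_values:
  assumes g: "computable_seq (\<lambda>z. g (pfst z) (psnd z))" and f: "\<And>n. f n = g n (history f n)"
  shows "computable_seq f"
proof -
  have "computable_seq (\<lambda>z. g (pfst z) (pfst (psnd z)))"
    using computable_apply[OF g computable_pair[OF computable_pfst[OF computable_id]
          computable_pfst[OF computable_psnd[OF computable_id]]]] by simp
  then have "computable_seq (\<lambda>n. rec_nat 0 (\<lambda>i h. pair (g i h) h) n)"
    by (intro computable_intros computable_rec)
  moreover have "rec_nat 0 (\<lambda>i h. pair (g i h) h) n = history f n" for n
  proof (induction n)
    case (Suc n)
    have "history f (Suc n) = pair (f n) (history f n)" by (simp add: history_def)
    with Suc f[of n] show ?case by simp
  qed (simp add: history_def)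
  ultimately have "computable_seq (history f)" by simp
  from computable_apply[OF g computable_pair[OF computable_id this]] show ?thesis
    by (simp flip: f)
qed

section \<open>Computable reals\<close>

context coprime_bases
begin

lemma W0_eq:
  "W0 p q U = (if p dvd U then W p q (U div p) else 0) + (if q dvd U then W p q (U div q) else 0)
    - (if p * q dvd U then W p q (U div (p * q)) else 0)"
  using W0_rec[of U] by linarith

lemma computable_W: "computable_seq (W p q)"
proof (rule computable_course_of_values)
  \<comment> \<open>The index U and the history length n are separate because \<open>W_Suc\<close>
    needs \<open>W0\<close> at n and at n - 1 from the same history.\<close>
  define w where "w = (\<lambda>U n h. if U = 0 then 1 else
    (if p dvd U then history_nth h n (U div p) else 0) + (if q dvd U then history_nth h n (U div q) else 0)
    - (if p * q dvd U then history_nth h n (U div (p * q)) else 0))"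
  define g where "g = (\<lambda>n h. if n = 0 then 1 else w n n h + w (n - 1) n h)"
  show "computable_seq (\<lambda>z. g (pfst z) (psnd z))"
    unfolding g_def w_def by (intro computable_intros computable_history_nth)
  have w: "w U n (history (W p q) n) = W0 p q U" if "U \<le> n" "n > 0" for U n
  proof (cases "U = 0")
    case False
    then have "U div p < n" "U div q < n" "U div (p * q) < n"
      using that p_gt_1 q_gt_1 less_le_trans[OF div_less_dividend] by (metis gr0I less_1_mult)+
    with False show ?thesis unfolding w_def W0_eq by (simp add: history_nth)
  qed (simp add: w_def W0_0)
  show "W p q n = g n (history (W p q) n)" for n
    by (cases n) (simp_all add: g_def w W_0 W_Suc)
qed

lemma computable_W0: "computable_seq (W0 p q)"
  unfolding W0_eq[abs_def]
  by (intro computable_intros computable_apply[OF computable_W])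

end

text \<open>Strict comparison with a computable real is in general not decidable but has checkable
  witnesses t, such as a sufficient precision.\<close>

definition semidecidable :: "(nat \<Rightarrow> bool) \<Rightarrow> bool" where
  "semidecidable P \<longleftrightarrow> (\<exists>R. decidable (\<lambda>z. R (pfst z) (psnd z)) \<and> (\<forall>n. P n \<longleftrightarrow> (\<exists>t. R t n)))"

lemma decidable_apply: "decidable P \<Longrightarrow> computable_seq f \<Longrightarrow> decidable (\<lambda>n. P (f n))"
  unfolding decidable_def by (rule computable_apply)

lemma decidable_apply2:
  assumes "decidable (\<lambda>z. R (pfst z) (psnd z))" "computable_seq f" "computable_seq g"
  shows "decidable (\<lambda>n. R (f n) (g n))"
  using decidable_apply[OF assms(1) computable_pair[OF assms(2,3)]] by simp

lemma semidecidable_if_decidable: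
  assumes "decidable P" shows "semidecidable P"
  unfolding semidecidable_def
  by (rule exI[of _ "\<lambda>_. P"])
     (auto intro!: decidable_apply[OF assms] computable_intros)

lemma semidecidable_apply:
  assumes "semidecidable P" "computable_seq f" shows "semidecidable (\<lambda>n. P (f n))"
proof -
  obtain R where R: "decidable (\<lambda>z. R (pfst z) (psnd z))" "\<And>n. P n \<longleftrightarrow> (\<exists>t. R t n)"
    using assms(1) unfolding semidecidable_def by blast
  have "decidable (\<lambda>z. R (pfst z) (f (psnd z)))"
    by (intro decidable_apply2[OF R(1)] computable_intros computable_apply[OF assms(2)])
  then show ?thesis unfolding semidecidable_def R(2)
    by (intro exI[of _ "\<lambda>t n. R t (f n)"]) auto
qed

lemma semidecidable_conj:
  assumes "semidecidable P" "semidecidable Q" shows "semidecidable (\<lambda>n. P n \<and> Q n)"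
proof -
  obtain R where R: "decidable (\<lambda>z. R (pfst z) (psnd z))" "\<And>n. P n \<longleftrightarrow> (\<exists>t. R t n)"
    using assms(1) unfolding semidecidable_def by blast
  obtain R' where R': "decidable (\<lambda>z. R' (pfst z) (psnd z))" "\<And>n. Q n \<longleftrightarrow> (\<exists>t. R' t n)"
    using assms(2) unfolding semidecidable_def by blast
  have "decidable (\<lambda>z. R (pfst (pfst z)) (psnd z) \<and> R' (psnd (pfst z)) (psnd z))"
    by (intro decidable_apply2[OF R(1)] decidable_apply2[OF R'(1)] computable_intros)
  moreover have "P n \<and> Q n \<longleftrightarrow> (\<exists>t. R (pfst t) n \<and> R' (psnd t) n)" for n
  proof
    assume "P n \<and> Q n"
    then obtain t t' where "R t n" "R' t' n" using R(2) R'(2) by blast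
    then show "\<exists>t. R (pfst t) n \<and> R' (psnd t) n" by (intro exI[of _ "pair t t'"]) simp
  qed (use R(2) R'(2) in blast)
  ultimately show ?thesis unfolding semidecidable_def
    by (intro exI[of _ "\<lambda>t n. R (pfst t) n \<and> R' (psnd t) n"]) auto
qed

lemma semidecidable_ex:
  assumes "semidecidable (\<lambda>z. P (pfst z) (psnd z))" shows "semidecidable (\<lambda>n. \<exists>y. P y n)"
proof -
  obtain R where R: "decidable (\<lambda>z. R (pfst z) (psnd z))"
    "\<And>n. P (pfst n) (psnd n) \<longleftrightarrow> (\<exists>t. R t n)"
    using assms(1) unfolding semidecidable_def by blast
  have "decidable (\<lambda>z. R (pfst (pfst z)) (pair (psnd (pfst z)) (psnd z)))"
    by (intro decidable_apply2[OF R(1)] computable_intros)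
  moreover have "(\<exists>y. P y n) \<longleftrightarrow> (\<exists>t. R (pfst t) (pair (psnd t) n))" for n
  proof
    assume "\<exists>y. P y n"
    then obtain y where "P y n" by blast
    then obtain t where "R t (pair y n)" using R(2)[of "pair y n"] by auto
    then show "\<exists>t. R (pfst t) (pair (psnd t) n)" by (intro exI[of _ "pair t y"]) simp
  next
    assume "\<exists>t. R (pfst t) (pair (psnd t) n)"
    then obtain t where "R (pfst t) (pair (psnd t) n)" ..
    then show "\<exists>y. P y n" using R(2)[of "pair (psnd t) n"] by auto
  qed
  ultimately show ?thesis unfolding semidecidable_def
    by (intro exI[of _ "\<lambda>t n. R (pfst t) (pair (psnd t) n)"]) auto
qed

lemma semidecidable_disj_decidable:
  assumes "decidable P" "semidecidable Q" shows "semidecidable (\<lambda>n. P n \<or> Q n)"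
proof -
  obtain R where R: "decidable (\<lambda>z. R (pfst z) (psnd z))" "\<And>n. Q n \<longleftrightarrow> (\<exists>t. R t n)"
    using assms(2) unfolding semidecidable_def by blast
  have "decidable (\<lambda>z. P (psnd z) \<or> R (pfst z) (psnd z))"
    by (intro decidable_apply2[OF R(1)] decidable_apply[OF assms(1)] computable_intros)
  then show ?thesis unfolding semidecidable_def R(2)
    by (intro exI[of _ "\<lambda>t n. P n \<or> R t n"]) auto
qed

text \<open>A candidate alone cannot be tested, so the minimisation runs over coded pairs of a
  witness and a candidate; existence makes it regular.\<close>

lemma semidecidable_choice:
  assumes "semidecidable (\<lambda>z. P (pfst z) (psnd z))" "\<And>n. \<exists>y. P y n"
  obtains f where "computable_seq f" "\<And>n. P (f n) n"
proof -
  obtain R where R: "decidable (\<lambda>z. R (pfst z) (psnd z))"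
    "\<And>n. P (pfst n) (psnd n) \<longleftrightarrow> (\<exists>t. R t n)"
    using assms(1) unfolding semidecidable_def by blast
  let ?R = "\<lambda>t n. R (pfst t) (pair (psnd t) n)"
  have ex: "\<exists>t. ?R t n" for n
  proof -
    obtain y where "P y n" using assms(2) by blast
    then obtain t where "R t (pair y n)" using R(2)[of "pair y n"] by auto
    then show ?thesis by (intro exI[of _ "pair t y"]) simp
  qed
  define f where "f = (\<lambda>n. psnd (LEAST t. ?R t n))"
  have "computable_seq f" unfolding f_def
    by (intro computable_psnd computable_Least_pred decidable_apply2[OF R(1)] computable_intros ex)
  moreover have "P (f n) n" for n
  proof -
    have "?R (LEAST t. ?R t n) n" by (rule LeastI_ex[OF ex])
    then show ?thesis using R(2)[of "pair (f n) n"] unfolding f_def by auto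
  qed
  ultimately show thesis by (rule that)
qed

text \<open>Nonnegative reals only, so that approximations are single natural numbers.\<close>

definition computable_reals :: "(nat \<Rightarrow> real) \<Rightarrow> bool" where
  "computable_reals x \<longleftrightarrow> (\<forall>n. 0 \<le> x n) \<and>
     (\<exists>f. computable_seq f \<and> (\<forall>n k. \<bar>2 ^ k * x n - real (f (pair n k))\<bar> \<le> 1))"

text \<open>Evaluating with c n + 1 further bits shrinks the error to 1/2, and rounding to the
  nearest integer adds at most 1/2. So any computable error exponent will do.\<close>

lemma computable_realsI:
  assumes "\<And>n. 0 \<le> x n" "computable_seq (\<lambda>z. f (pfst z) (psnd z))" "computable_seq c"
    and f: "\<And>n k. \<bar>2 ^ k * x n - real (f n k)\<bar> \<le> 2 ^ c n"
  shows "computable_reals x"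
proof -
  define g where "g = (\<lambda>z. (f (pfst z) (psnd z + Suc (c (pfst z))) + 2 ^ c (pfst z)) div 2 ^ Suc (c (pfst z)))"
  have "computable_seq (\<lambda>z. f (pfst z) (psnd z + Suc (c (pfst z))))"
    using computable_apply[OF assms(2) computable_pair[OF computable_pfst[OF computable_id]
       computable_add[OF computable_psnd[OF computable_id]
         computable_Suc[OF computable_apply[OF assms(3) computable_pfst[OF computable_id]]]]]] by simp
  then have "computable_seq g"
    unfolding g_def by (intro computable_intros computable_apply[OF assms(3)])
  moreover have "\<bar>2 ^ k * x n - real (g (pair n k))\<bar> \<le> 1" for n k
  proof -
    define F e where "F = f n (k + Suc (c n))" and "e = (2::nat) ^ c n"
    have e: "e > 0" "real e = 2 ^ c n" by (simp_all add: e_def)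
    define G where "G = (F + e) div (2 * e)"
    have gG: "g (pair n k) = G" by (simp add: g_def G_def F_def e_def)
    have "G * (2 * e) \<le> F + e" "F + e < G * (2 * e) + 2 * e"
      unfolding G_def using e div_times_less_eq_dividend[of "F + e" "2 * e"]
        dividend_less_div_times[of "2 * e" "F + e"] by simp_all
    then have "real (G * (2 * e)) \<le> real (F + e)" "real (F + e) \<le> real (G * (2 * e) + 2 * e)"
      by (simp_all only: of_nat_le_iff)
    then have 1: "\<bar>real F - G * (2 * real e)\<bar> \<le> e" by simp
    have "\<bar>2 ^ (k + Suc (c n)) * x n - real F\<bar> \<le> e" using f[of "k + Suc (c n)" n] by (simp add: F_def e)
    then have 2: "\<bar>2 ^ k * x n * (2 * e) - real F\<bar> \<le> e" by (simp add: power_add e mult_ac)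
    have "\<bar>(2 ^ k * x n - real G) * (2 * e)\<bar> \<le> 1 * (2 * e)"
      using 1 2 by (simp add: left_diff_distrib)
    then show ?thesis unfolding gG abs_mult using e by (simp add: mult_le_cancel_right)
  qed
  ultimately show ?thesis unfolding computable_reals_def using assms(1) by blast
qed

lemma computable_realsE:
  assumes "computable_reals x"
  obtains f where "\<And>n. 0 \<le> x n" "computable_seq (\<lambda>z. f (pfst z) (psnd z))"
    "\<And>n k. \<bar>2 ^ k * x n - real (f n k)\<bar> \<le> 1"
proof -
  from assms obtain f where f: "\<And>n. 0 \<le> x n" "computable_seq f"
    "\<And>n k. \<bar>2 ^ k * x n - real (f (pair n k))\<bar> \<le> 1" unfolding computable_reals_def by blast
  then show thesis by (intro that[of "\<lambda>n k. f (pair n k)"]) simp_all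
qed

lemma computable_reals_apply:
  assumes "computable_reals x" "computable_seq g" shows "computable_reals (\<lambda>n. x (g n))"
proof -
  obtain f where f: "\<And>n. 0 \<le> x n" "computable_seq (\<lambda>z. f (pfst z) (psnd z))"
    "\<And>n k. \<bar>2 ^ k * x n - real (f n k)\<bar> \<le> 1" by (rule computable_realsE[OF assms(1)]) blast
  have "computable_seq (\<lambda>z. f (g (pfst z)) (psnd z))"
    using computable_apply[OF f(2) computable_pair[OF
      computable_apply[OF assms(2) computable_pfst[OF computable_id]] computable_psnd[OF computable_id]]]
    by simp
  then show ?thesis using f(1,3)
    by (intro computable_realsI[where c = "\<lambda>_. 0" and f = "\<lambda>n k. f (g n) k"] computable_intros) auto
qed

lemma computable_reals_add:
  assumes "computable_reals x" "computable_reals y" shows "computable_reals (\<lambda>n. x n + y n)"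
proof -
  obtain f where f: "\<And>n. 0 \<le> x n" "computable_seq (\<lambda>z. f (pfst z) (psnd z))"
    "\<And>n k. \<bar>2 ^ k * x n - real (f n k)\<bar> \<le> 1" by (rule computable_realsE[OF assms(1)]) blast
  obtain g where g: "\<And>n. 0 \<le> y n" "computable_seq (\<lambda>z. g (pfst z) (psnd z))"
    "\<And>n k. \<bar>2 ^ k * y n - real (g n k)\<bar> \<le> 1" by (rule computable_realsE[OF assms(2)]) blast
  show ?thesis
  proof (rule computable_realsI[where c = "\<lambda>_. 1" and f = "\<lambda>n k. f n k + g n k"])
    show "\<bar>2 ^ k * (x n + y n) - real (f n k + g n k)\<bar> \<le> 2 ^ 1" for n k
      using f(3)[of k n] g(3)[of k n]
      by (simp only: distrib_left of_nat_add power_one_right)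
  qed (use f g in \<open>auto intro!: computable_intros\<close>)
qed

lemma computable_reals_diff:
  assumes "computable_reals x" "computable_reals y" "\<And>n. y n \<le> x n"
  shows "computable_reals (\<lambda>n. x n - y n)"
proof -
  obtain f where f: "\<And>n. 0 \<le> x n" "computable_seq (\<lambda>z. f (pfst z) (psnd z))"
    "\<And>n k. \<bar>2 ^ k * x n - real (f n k)\<bar> \<le> 1" by (rule computable_realsE[OF assms(1)]) blast
  obtain g where g: "\<And>n. 0 \<le> y n" "computable_seq (\<lambda>z. g (pfst z) (psnd z))"
    "\<And>n k. \<bar>2 ^ k * y n - real (g n k)\<bar> \<le> 1" by (rule computable_realsE[OF assms(2)]) blast
  show ?thesis
  proof (rule computable_realsI[where c = "\<lambda>_. 1" and f = "\<lambda>n k. f n k - g n k"])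
    show "\<bar>2 ^ k * (x n - y n) - real (f n k - g n k)\<bar> \<le> 2 ^ 1" for n k
    proof -
      have "2 ^ k * y n \<le> 2 ^ k * x n" using assms(3) by simp
      moreover have "real (f n k - g n k) = max 0 (real (f n k) - real (g n k))" by auto
      ultimately show ?thesis using f(3)[of k n] g(3)[of k n]
        unfolding right_diff_distrib power_one_right by linarith
    qed
  qed (use f g assms(3) in \<open>auto intro!: computable_intros\<close>)
qed

lemma computable_reals_mult:
  assumes "computable_reals x" "computable_reals y" shows "computable_reals (\<lambda>n. x n * y n)"
proof -
  obtain f where f: "\<And>n. 0 \<le> x n" "computable_seq (\<lambda>z. f (pfst z) (psnd z))"
    "\<And>n k. \<bar>2 ^ k * x n - real (f n k)\<bar> \<le> 1" by (rule computable_realsE[OF assms(1)]) blast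
  obtain g where g: "\<And>n. 0 \<le> y n" "computable_seq (\<lambda>z. g (pfst z) (psnd z))"
    "\<And>n k. \<bar>2 ^ k * y n - real (g n k)\<bar> \<le> 1" by (rule computable_realsE[OF assms(2)]) blast
  have c: "computable_seq (\<lambda>n. f n 0)" "computable_seq (\<lambda>n. g n 0)"
    using computable_apply[OF f(2) computable_pair[OF computable_id computable_const]]
      computable_apply[OF g(2) computable_pair[OF computable_id computable_const]] by simp_all
  show ?thesis
  \<comment> \<open>Precision 0 gives x n <= f n 0 + 1 and y n <= g n 0 + 1. The error x n + y n + 2
    of the product is then at most f n 0 + g n 0 + 4, hence below 2 to that power.\<close>
  proof (rule computable_realsI[where c = "\<lambda>n. f n 0 + g n 0 + 4" and f = "\<lambda>n k. f n k * g n k div 2 ^ k"])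
    show "\<bar>2 ^ k * (x n * y n) - real (f n k * g n k div 2 ^ k)\<bar> \<le> 2 ^ (f n 0 + g n 0 + 4)" for n k
    proof -
      define X Y F G e where "X = 2 ^ k * x n" and "Y = 2 ^ k * y n" and "F = real (f n k)"
        and "G = real (g n k)" and "e = (2::real) ^ k"
      have e: "e \<ge> 1" by (simp add: e_def)
      have XY: "X = e * x n" "Y = e * y n" by (simp_all add: X_def Y_def e_def)
      have *: "\<bar>X - F\<bar> \<le> 1" "\<bar>Y - G\<bar> \<le> 1" "X \<ge> 0" "G \<ge> 0"
        using f g by (simp_all add: X_def Y_def F_def G_def)
      have "X * Y - F * G = X * (Y - G) + G * (X - F)" by algebra
      then have "\<bar>X * Y - F * G\<bar> \<le> X * \<bar>Y - G\<bar> + G * \<bar>X - F\<bar>"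
        using * abs_triangle_ineq[of "X * (Y - G)" "G * (X - F)"] by (simp add: abs_mult)
      also have "\<dots> \<le> X * 1 + G * 1"
        using * by (intro add_mono mult_left_mono)
      also have "\<dots> \<le> X + (Y + 1)" using * by linarith
      also have "\<dots> \<le> e * (x n + y n + 1)" using e by (simp add: XY algebra_simps)
      finally have "\<bar>X * Y - F * G\<bar> / e \<le> x n + y n + 1" using e by (simp add: divide_le_eq mult.commute)
      moreover have "\<bar>X * Y - F * G\<bar> / e = \<bar>(X * Y - F * G) / e\<bar>" using e by (simp add: abs_divide)
      moreover have "(X * Y - F * G) / e = e * (x n * y n) - F * G / e" using e by (simp add: XY field_simps)
      moreover have "\<bar>F * G / e - real (f n k * g n k div 2 ^ k)\<bar> \<le> 1"
      proof -
        have "F * G / e = real (f n k * g n k) / real (2 ^ k)" by (simp add: F_def G_def e_def)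
        then show ?thesis using floor_divide_of_nat_eq[of "f n k * g n k" "2 ^ k", where 'a = real]
          floor_correct[of "F * G / e"] by simp
      qed
      ultimately have "\<bar>e * (x n * y n) - real (f n k * g n k div 2 ^ k)\<bar> \<le> x n + y n + 2" by linarith
      also have "\<dots> \<le> real (f n 0 + g n 0 + 4)" using f(3)[of 0 n] g(3)[of 0 n] by simp
      also have "\<dots> \<le> real (2 ^ (f n 0 + g n 0 + 4))" unfolding of_nat_le_iff by (rule less_imp_le, rule less_exp)
      finally show ?thesis by (simp add: e_def)
    qed
  qed (use f(1) g(1) in \<open>auto intro!: computable_intros f(2) g(2) c\<close>)
qed

lemma computable_reals_of_nat:
  assumes "computable_seq g" shows "computable_reals (\<lambda>n. real (g n))"
  by (rule computable_realsI[where c = "\<lambda>_. 0" and f = "\<lambda>n k. 2 ^ k * g n"])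
     (auto intro!: computable_intros computable_apply[OF assms])

lemma computable_reals_sum:
  assumes "computable_reals (\<lambda>z. x (pfst z) (psnd z))" "computable_seq m"
  shows "computable_reals (\<lambda>n. \<Sum>i<m n. x i n)"
proof -
  obtain f where f: "\<And>z. 0 \<le> x (pfst z) (psnd z)" "computable_seq (\<lambda>z. f (pfst z) (psnd z))"
    "\<And>n k. \<bar>2 ^ k * x (pfst n) (psnd n) - real (f n k)\<bar> \<le> 1" by (rule computable_realsE[OF assms(1)]) blast
  have pos: "0 \<le> x i n" for i n using f(1)[of "pair i n"] by simp
  have err: "\<bar>2 ^ k * x i n - real (f (pair i n) k)\<bar> \<le> 1" for i n k using f(3)[of k "pair i n"] by simp
  have "computable_seq (\<lambda>z. f (pair (pfst z) (pfst (psnd z))) (psnd (psnd z)))"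
    using computable_apply[OF f(2), of "\<lambda>z. pair (pair (pfst z) (pfst (psnd z))) (psnd (psnd z))"]
    by (simp add: computable_intros)
  then have cs: "computable_seq (\<lambda>z. \<Sum>i<m (pfst z). f (pair i (pfst z)) (psnd z))"
    by (intro computable_sum computable_apply[OF assms(2)] computable_intros)
  show ?thesis
  proof (rule computable_realsI[where c = m and f = "\<lambda>n k. \<Sum>i<m n. f (pair i n) k"])
    show "\<bar>2 ^ k * (\<Sum>i<m n. x i n) - real (\<Sum>i<m n. f (pair i n) k)\<bar> \<le> 2 ^ m n" for n k
    proof -
      have "\<bar>2 ^ k * (\<Sum>i<m n. x i n) - real (\<Sum>i<m n. f (pair i n) k)\<bar>
          = \<bar>\<Sum>i<m n. 2 ^ k * x i n - real (f (pair i n) k)\<bar>"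
        by (simp add: sum_distrib_left sum_subtractf)
      also have "\<dots> \<le> (\<Sum>i<m n. \<bar>2 ^ k * x i n - real (f (pair i n) k)\<bar>)" by (rule sum_abs)
      also have "\<dots> \<le> (\<Sum>i<m n. 1)" by (intro sum_mono err)
      also have "\<dots> \<le> real (2 ^ m n)" by (simp add: less_imp_le)
      finally show ?thesis by simp
    qed
  qed (use pos assms cs in \<open>auto intro: sum_nonneg\<close>)
qed

lemma computable_reals_limit:
  assumes "computable_reals (\<lambda>z. y (pfst z) (psnd z))" "\<And>n k. \<bar>x n - y n k\<bar> \<le> 1 / 2 ^ k" "\<And>n. 0 \<le> x n"
  shows "computable_reals x"
proof -
  obtain f where f: "computable_seq (\<lambda>z. f (pfst z) (psnd z))"
    "\<And>n k. \<bar>2 ^ k * y (pfst n) (psnd n) - real (f n k)\<bar> \<le> 1" by (rule computable_realsE[OF assms(1)]) blast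
  have "computable_seq (\<lambda>z. f (pair (pfst z) (psnd z)) (psnd z))"
    using computable_apply[OF f(1), of "\<lambda>z. pair (pair (pfst z) (psnd z)) (psnd z)"]
    by (simp add: computable_intros)
  then show ?thesis
  proof (rule computable_realsI[where c = "\<lambda>_. 1" and f = "\<lambda>n k. f (pair n k) k", rotated])
    show "\<bar>2 ^ k * x n - real (f (pair n k) k)\<bar> \<le> 2 ^ 1" for n k
    proof -
      have "\<bar>2 ^ k * (x n - y n k)\<bar> \<le> 1" using assms(2)[of n k] by (simp add: abs_mult pos_le_divide_eq mult.commute)
      then show ?thesis using f(2)[of k "pair n k"] by (simp add: right_diff_distrib)
    qed
  qed (use assms(3) in \<open>auto intro!: computable_intros\<close>)
qed


text \<open>After scaling by 2 ^ k the gap grows without bound while the error stays within s n. A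
  margin of s n makes the integer test sound, and a large k makes it succeed whenever the strict
  inequality holds.\<close>

lemma semidecidable_less_computable_real:
  assumes "computable_reals x" "computable_seq r" "computable_seq s"
  shows "semidecidable (\<lambda>n. real (r n) < real (s n) * x n)"
    and "semidecidable (\<lambda>n. real (s n) * x n < real (r n))"
proof -
  obtain f where f: "\<And>n. 0 \<le> x n" "computable_seq (\<lambda>z. f (pfst z) (psnd z))"
    "\<And>n k. \<bar>2 ^ k * x n - real (f n k)\<bar> \<le> 1" by (rule computable_realsE[OF assms(1)]) blast
  have cf: "computable_seq (\<lambda>z. f (psnd z) (pfst z))"
    using computable_apply[OF f(2), of "\<lambda>z. pair (psnd z) (pfst z)"] by (simp add: computable_intros)
  note comp = computable_apply[OF assms(2)] computable_apply[OF assms(3)] cf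
  have big: "\<exists>k. c < 2 ^ k * d" if "d > 0" for c d :: real
  proof -
    obtain k where "c / d < 2 ^ k" using real_arch_pow[of 2 "c / d"] by auto
    then show ?thesis using that by (intro exI[of _ k]) (simp add: pos_divide_less_eq)
  qed
  have err: "\<bar>(real (s n) * x n) * 2 ^ k - real (s n) * real (f n k)\<bar> \<le> real (s n)" for n k
  proof -
    have "\<bar>real (s n) * (2 ^ k * x n - real (f n k))\<bar> \<le> real (s n) * 1"
      unfolding abs_mult abs_of_nat by (intro mult_left_mono f) simp
    then show ?thesis by (simp add: right_diff_distrib mult_ac)
  qed
  have "semidecidable (\<lambda>n. \<exists>k. r n * 2 ^ k + s n < s n * f n k)"
    by (intro semidecidable_ex semidecidable_if_decidable computable_intros comp)
  moreover have "(\<exists>k. r n * 2 ^ k + s n < s n * f n k) \<longleftrightarrow> real (r n) < real (s n) * x n" for n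
  proof
    assume "\<exists>k. r n * 2 ^ k + s n < s n * f n k"
    then obtain k where "r n * 2 ^ k + s n < s n * f n k" ..
    then have "real (r n * 2 ^ k + s n) < real (s n * f n k)" unfolding of_nat_less_iff .
    then have "real (r n) * 2 ^ k + real (s n) < real (s n) * real (f n k)" by simp
    then have "real (r n) * 2 ^ k < (real (s n) * x n) * 2 ^ k"
      using err[of n k] by linarith
    then show "real (r n) < real (s n) * x n" by simp
  next
    assume "real (r n) < real (s n) * x n"
    then obtain k where "2 * real (s n) < 2 ^ k * (real (s n) * x n - real (r n))"
      using big[of "real (s n) * x n - real (r n)" "2 * real (s n)"] by auto
    then have "2 * real (s n) < (real (s n) * x n) * 2 ^ k - real (r n) * 2 ^ k"
      by (simp add: algebra_simps)
    then have "real (r n) * 2 ^ k + real (s n) < real (s n) * real (f n k)"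
      using err[of n k] by linarith
    then have "real (r n * 2 ^ k + s n) < real (s n * f n k)" by simp
    then show "\<exists>k. r n * 2 ^ k + s n < s n * f n k" unfolding of_nat_less_iff ..
  qed
  ultimately show "semidecidable (\<lambda>n. real (r n) < real (s n) * x n)" by simp
  have "semidecidable (\<lambda>n. \<exists>k. s n * f n k + s n < r n * 2 ^ k)"
    by (intro semidecidable_ex semidecidable_if_decidable computable_intros comp)
  moreover have "(\<exists>k. s n * f n k + s n < r n * 2 ^ k) \<longleftrightarrow> real (s n) * x n < real (r n)" for n
  proof
    assume "\<exists>k. s n * f n k + s n < r n * 2 ^ k"
    then obtain k where "s n * f n k + s n < r n * 2 ^ k" ..
    then have "real (s n * f n k + s n) < real (r n * 2 ^ k)" unfolding of_nat_less_iff .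
    then have "real (s n) * real (f n k) + real (s n) < real (r n) * 2 ^ k" by simp
    then have "(real (s n) * x n) * 2 ^ k < real (r n) * 2 ^ k"
      using err[of n k] by linarith
    then show "real (s n) * x n < real (r n)" by simp
  next
    assume "real (s n) * x n < real (r n)"
    then obtain k where "2 * real (s n) < 2 ^ k * (real (r n) - real (s n) * x n)"
      using big[of "real (r n) - real (s n) * x n" "2 * real (s n)"] by auto
    then have "2 * real (s n) < real (r n) * 2 ^ k - (real (s n) * x n) * 2 ^ k"
      by (simp add: algebra_simps)
    then have "real (s n) * real (f n k) + real (s n) < real (r n) * 2 ^ k"
      using err[of n k] by linarith
    then have "real (s n * f n k + s n) < real (r n * 2 ^ k)" by simp
    then show "\<exists>k. s n * f n k + s n < r n * 2 ^ k" unfolding of_nat_less_iff ..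
  qed
  ultimately show "semidecidable (\<lambda>n. real (s n) * x n < real (r n))" by simp
qed

text \<open>In the premises, z encodes (r, s, n).\<close>

lemma computable_reals_cuts:
  assumes pos: "\<And>n. 0 \<le> x n"
    and lower: "semidecidable (\<lambda>z. real (pfst z) < real (pfst (psnd z)) * x (psnd (psnd z)))"
    and upper: "semidecidable (\<lambda>z. real (pfst (psnd z)) * x (psnd (psnd z)) < real (pfst z))"
  shows "computable_reals x"
proof -
  \<comment> \<open>The open intervals from g to g + 2 overlap, so the search also ends when the
    scaled value is an integer. The case g = 0 is separate because the value may be 0. The midpoint
    g + 1 is the approximation.\<close>
  define P where "P = (\<lambda>g z. (g = 0 \<or> real g < real (2 ^ psnd z) * x (pfst z)) \<and>
     real (2 ^ psnd z) * x (pfst z) < real (g + 2))"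
  have "semidecidable (\<lambda>z. real (pfst z) < real (2 ^ psnd (psnd z)) * x (pfst (psnd z)))"
    using semidecidable_apply[OF lower, of "\<lambda>z. pair (pfst z) (pair (2 ^ psnd (psnd z)) (pfst (psnd z)))"]
    by (simp add: computable_intros)
  moreover have "semidecidable (\<lambda>z. real (2 ^ psnd (psnd z)) * x (pfst (psnd z)) < real (pfst z + 2))"
    using semidecidable_apply[OF upper, of "\<lambda>z. pair (pfst z + 2) (pair (2 ^ psnd (psnd z)) (pfst (psnd z)))"]
    by (simp add: computable_intros del: of_nat_add)
  ultimately have "semidecidable (\<lambda>z. P (pfst z) (psnd z))"
    unfolding P_def by (intro semidecidable_conj semidecidable_disj_decidable computable_intros)
  moreover have "\<exists>g. P g z" for z
  proof -
    define y where "y = real (2 ^ psnd z) * x (pfst z)"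
    have y: "y \<ge> 0" using pos by (simp add: y_def)
    define g where "g = nat (\<lceil>y\<rceil> - 1)"
    have "(g = 0 \<or> real g < y) \<and> y < real (g + 2)"
      unfolding g_def using y by linarith
    then show ?thesis unfolding P_def y_def by blast
  qed
  ultimately obtain f where f: "computable_seq f" "\<And>z. P (f z) z"
    by (rule semidecidable_choice) blast
  show ?thesis
  proof (rule computable_realsI[where c = "\<lambda>_. 0" and f = "\<lambda>n k. f (pair n k) + 1"])
    show "computable_seq (\<lambda>z. f (pair (pfst z) (psnd z)) + 1)"
      by (intro computable_intros computable_apply[OF f(1)])
    show "\<bar>2 ^ k * x n - real (f (pair n k) + 1)\<bar> \<le> 2 ^ 0" for n k
    proof -
      have "0 \<le> 2 ^ k * x n" using pos by simp
      then show ?thesis using f(2)[of "pair n k"] unfolding P_def by (auto simp: abs_le_iff)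
    qed
  qed (use pos in \<open>auto intro: computable_intros\<close>)
qed

text \<open>Multiplying by x n swaps the two cuts, so positivity suffices and no bound away from 0
  has to be computed.\<close>

lemma computable_reals_inverse:
  assumes "computable_reals x" "\<And>n. 0 < x n" shows "computable_reals (\<lambda>n. inverse (x n))"
proof (rule computable_reals_cuts)
  note x = computable_reals_apply[OF assms(1)]
  have "semidecidable (\<lambda>z. real (pfst z) * x (psnd (psnd z)) < real (pfst (psnd z)))"
    by (intro semidecidable_less_computable_real(2) x computable_intros)
  moreover have "real (pfst z) * x (psnd (psnd z)) < real (pfst (psnd z)) \<longleftrightarrow>
      real (pfst z) < real (pfst (psnd z)) * inverse (x (psnd (psnd z)))" for z
    using assms(2)[of "psnd (psnd z)"] by (simp add: field_simps)
  ultimately show "semidecidable (\<lambda>z. real (pfst z) < real (pfst (psnd z)) * inverse (x (psnd (psnd z))))"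
    by simp
  have "semidecidable (\<lambda>z. real (pfst (psnd z)) < real (pfst z) * x (psnd (psnd z)))"
    by (intro semidecidable_less_computable_real(1) x computable_intros)
  moreover have "real (pfst (psnd z)) < real (pfst z) * x (psnd (psnd z)) \<longleftrightarrow>
      real (pfst (psnd z)) * inverse (x (psnd (psnd z))) < real (pfst z)" for z
    using assms(2)[of "psnd (psnd z)"] by (simp add: field_simps)
  ultimately show "semidecidable (\<lambda>z. real (pfst (psnd z)) * inverse (x (psnd (psnd z))) < real (pfst z))"
    by simp
qed (use assms(2) in \<open>simp add: less_imp_le\<close>)

text \<open>Raising to the power v clears the root and leaves a comparison of integers.\<close>

lemma powr_less_powr_nat_iff:
  fixes r s g u v :: nat
  assumes "g > 0" "v > 0"
  shows "real r < real s * real g powr (real u / real v) \<longleftrightarrow> r ^ v < s ^ v * g ^ u"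
    and "real s * real g powr (real u / real v) < real r \<longleftrightarrow> s ^ v * g ^ u < r ^ v"
proof -
  have lt: "a ^ v < b ^ v \<longleftrightarrow> a < b" if "a \<ge> 0" "b \<ge> 0" for a b :: real
    using power_mono_iff[of b a v] that assms(2) by linarith
  have "(real g powr (real u / real v)) ^ v = real g powr (real u)"
    using assms by (simp add: powr_powr flip: powr_realpow)
  then have *: "(real s * real g powr (real u / real v)) ^ v = real (s ^ v * g ^ u)"
    using assms by (simp add: power_mult_distrib powr_realpow)
  have "real r < real s * real g powr (real u / real v) \<longleftrightarrow>
      real r ^ v < (real s * real g powr (real u / real v)) ^ v"
    by (intro lt[symmetric]) simp_all
  also have "\<dots> \<longleftrightarrow> r ^ v < s ^ v * g ^ u" unfolding * of_nat_power[symmetric] of_nat_less_iff ..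
  finally show "real r < real s * real g powr (real u / real v) \<longleftrightarrow> r ^ v < s ^ v * g ^ u" .
  have "real s * real g powr (real u / real v) < real r \<longleftrightarrow>
      (real s * real g powr (real u / real v)) ^ v < real r ^ v"
    by (intro lt[symmetric]) simp_all
  also have "\<dots> \<longleftrightarrow> s ^ v * g ^ u < r ^ v" unfolding * of_nat_power[symmetric] of_nat_less_iff ..
  finally show "real s * real g powr (real u / real v) < real r \<longleftrightarrow> s ^ v * g ^ u < r ^ v" .
qed

text \<open>The exponents r / (s + 1), indexed by the pair (r, s), run through all nonnegative
  rationals and avoid division by 0.\<close>

lemma computable_reals_rational_powr:
  fixes p :: nat assumes "p > 0"
  shows "computable_reals (\<lambda>z. real p powr (real (pfst z) / real (Suc (psnd z))))"
proof (rule computable_reals_cuts)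
  let ?r = "\<lambda>z. pfst (psnd (psnd z))" and ?s = "\<lambda>z. Suc (psnd (psnd (psnd z)))"
  show "semidecidable (\<lambda>z. real (pfst z) < real (pfst (psnd z)) * real p powr (real (?r z) / real (?s z)))"
    unfolding powr_less_powr_nat_iff[OF assms zero_less_Suc]
    by (intro semidecidable_if_decidable computable_intros)
  show "semidecidable (\<lambda>z. real (pfst (psnd z)) * real p powr (real (?r z) / real (?s z)) < real (pfst z))"
    unfolding powr_less_powr_nat_iff[OF assms zero_less_Suc]
    by (intro semidecidable_if_decidable computable_intros)
qed simp

lemma rational_between_nat:
  fixes a b :: real assumes "0 \<le> a" "a < b"
  obtains u v :: nat where "v > 0" "a < real u / real v" "real u / real v < b"
proof -
  obtain r where r: "r \<in> \<rat>" "a < r" "r < b" using Rats_dense_in_real[OF assms(2)] by blast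
  then obtain m n where mn: "n \<noteq> 0" "\<bar>r\<bar> = real m / real n" using Rats_abs_nat_div_natE by metis
  then have "r = real m / real n" using r assms by simp
  with mn r show thesis by (intro that[of n m]) auto
qed

text \<open>For a positive integer g, g^t is continuous and nondecreasing in t. So a strict
  comparison at \<alpha> already holds at some rational u/v on the safe side of \<alpha>, where it
  is one between integers.\<close>

lemma computable_reals_powr:
  assumes g: "computable_seq g" "\<And>n. g n > 0" and \<alpha>: "computable_reals (\<lambda>_. \<alpha>)" "\<alpha> > 0"
  shows "computable_reals (\<lambda>n. real (g n) powr \<alpha>)"
proof (rule computable_reals_cuts)
  note g' = computable_apply[OF g(1)]
  let ?r = "\<lambda>z. pfst z" and ?s = "\<lambda>z. pfst (psnd z)" and ?n = "\<lambda>z. psnd (psnd z)"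
  have cont: "isCont (\<lambda>t. real s * real (g n) powr t) \<alpha>" for s n
    using g(2)[of n] by (auto intro!: continuous_intros)
  have "semidecidable (\<lambda>z. \<exists>v u. real u < real v * \<alpha> \<and> ?r z ^ v < ?s z ^ v * g (?n z) ^ u)"
    by (intro semidecidable_ex semidecidable_conj semidecidable_less_computable_real(1) \<alpha>
        semidecidable_if_decidable computable_intros g')
  moreover have "(\<exists>v u. real u < real v * \<alpha> \<and> r ^ v < s ^ v * g n ^ u) \<longleftrightarrow>
      real r < real s * real (g n) powr \<alpha>" for r s n
  proof
    assume "\<exists>v u. real u < real v * \<alpha> \<and> r ^ v < s ^ v * g n ^ u"
    then obtain u v where uv: "real u < real v * \<alpha>" "r ^ v < s ^ v * g n ^ u" by blast
    then have "v > 0" by (cases v) auto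
    then have "real r < real s * real (g n) powr (real u / real v)"
      using powr_less_powr_nat_iff(1) g(2) uv by blast
    also have "\<dots> \<le> real s * real (g n) powr \<alpha>"
      using uv(1) \<open>v > 0\<close> g(2)[of n] by (intro mult_left_mono powr_mono) (auto simp: divide_le_eq mult.commute)
    finally show "real r < real s * real (g n) powr \<alpha>" .
  next
    assume "real r < real s * real (g n) powr \<alpha>"
    then have "eventually (\<lambda>t. real r < real s * real (g n) powr t) (at \<alpha>)"
      using cont order_tendstoD(1) unfolding isCont_def by blast
    then obtain d where d: "d > 0" "\<And>t. t \<noteq> \<alpha> \<Longrightarrow> dist t \<alpha> < d \<Longrightarrow> real r < real s * real (g n) powr t"
      unfolding eventually_at by blast
    \<comment> \<open>The maximum keeps the rational exponent a quotient of natural numbers.\<close>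
    have "0 \<le> max 0 (\<alpha> - d)" "max 0 (\<alpha> - d) < \<alpha>" using d \<alpha>(2) by auto
    then obtain u v where uv: "v > 0" "max 0 (\<alpha> - d) < real u / real v" "real u / real v < \<alpha>"
      by (rule rational_between_nat)
    then have "real r < real s * real (g n) powr (real u / real v)"
      by (intro d) (auto simp: dist_real_def)
    then have "r ^ v < s ^ v * g n ^ u" using powr_less_powr_nat_iff(1) g(2) uv(1) by blast
    moreover have "real u < real v * \<alpha>" using uv by (simp add: divide_less_eq mult.commute)
    ultimately show "\<exists>v u. real u < real v * \<alpha> \<and> r ^ v < s ^ v * g n ^ u" by blast
  qed
  ultimately show "semidecidable (\<lambda>z. real (?r z) < real (?s z) * real (g (?n z)) powr \<alpha>)" by simp
  have "semidecidable (\<lambda>z. \<exists>v u. real v * \<alpha> < real u \<and> v > 0 \<and> ?s z ^ v * g (?n z) ^ u < ?r z ^ v)"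
    by (intro semidecidable_ex semidecidable_conj semidecidable_less_computable_real(2) \<alpha>
        semidecidable_if_decidable computable_intros g')
  moreover have "(\<exists>v u. real v * \<alpha> < real u \<and> v > 0 \<and> s ^ v * g n ^ u < r ^ v) \<longleftrightarrow>
      real s * real (g n) powr \<alpha> < real r" for r s n
  proof
    assume "\<exists>v u. real v * \<alpha> < real u \<and> v > 0 \<and> s ^ v * g n ^ u < r ^ v"
    then obtain u v where uv: "real v * \<alpha> < real u" "v > 0" "s ^ v * g n ^ u < r ^ v" by blast
    have "real s * real (g n) powr \<alpha> \<le> real s * real (g n) powr (real u / real v)"
      using uv(1,2) g(2)[of n] by (intro mult_left_mono powr_mono) (auto simp: le_divide_eq mult.commute)
    also have "\<dots> < real r"
      using powr_less_powr_nat_iff(2) g(2) uv by blast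
    finally show "real s * real (g n) powr \<alpha> < real r" .
  next
    assume "real s * real (g n) powr \<alpha> < real r"
    then have "eventually (\<lambda>t. real s * real (g n) powr t < real r) (at \<alpha>)"
      using cont order_tendstoD(2) unfolding isCont_def by blast
    then obtain d where d: "d > 0" "\<And>t. t \<noteq> \<alpha> \<Longrightarrow> dist t \<alpha> < d \<Longrightarrow> real s * real (g n) powr t < real r"
      unfolding eventually_at by blast
    have "0 \<le> \<alpha>" "\<alpha> < \<alpha> + d" using d \<alpha>(2) by auto
    then obtain u v where uv: "v > 0" "\<alpha> < real u / real v" "real u / real v < \<alpha> + d"
      by (rule rational_between_nat)
    then have "real s * real (g n) powr (real u / real v) < real r"
      by (intro d) (auto simp: dist_real_def)
    then have "s ^ v * g n ^ u < r ^ v" using powr_less_powr_nat_iff(2) g(2) uv(1) by blast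
    moreover have "real v * \<alpha> < real u" using uv by (simp add: less_divide_eq mult.commute)
    ultimately show "\<exists>v u. real v * \<alpha> < real u \<and> v > 0 \<and> s ^ v * g n ^ u < r ^ v" using uv(1) by blast
  qed
  ultimately show "semidecidable (\<lambda>z. real (?s z) * real (g (?n z)) powr \<alpha> < real (?r z))" by simp
qed simp

text \<open>The sequences (1 + 1/n)^n and (1 + 1/n)^(n+1) enclose e, so the cuts of ln p are decided
  by comparing integers.\<close>

lemma computable_reals_ln:
  fixes p :: nat assumes "p > 0"
  shows "computable_reals (\<lambda>_. ln (real p))"
proof (rule computable_reals_cuts)
  let ?r = "\<lambda>z. pfst z" and ?s = "\<lambda>z. pfst (psnd z)"
  have lim: "(\<lambda>n. r * (real (n + 1) * ln (1 + 1 / real n))) \<longlonglongrightarrow> r"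
    "(\<lambda>n. r * (real n * ln (1 + 1 / real n))) \<longlonglongrightarrow> r" for r :: real
    by real_asymp+
  have ln1: "ln (real (Suc n)) - ln (real n) = ln (1 + 1 / real n)" if "n > 0" for n
    using ln_divide_pos[of "real (Suc n)" "real n"] that by (simp add: add_divide_distrib add.commute)
  have lnb: "real n * ln (1 + 1 / real n) \<le> 1" "1 \<le> real (n + 1) * ln (1 + 1 / real n)" if "n > 0" for n
  proof -
    have "ln (1 + 1 / real n) \<le> 1 / real n" by (rule ln_add_one_self_le_self) simp
    then show "real n * ln (1 + 1 / real n) \<le> 1" using that by (simp add: field_simps)
    have "ln (real n / real (n + 1)) \<le> real n / real (n + 1) - 1"
      using that by (intro ln_le_minus_one) auto
    also have "ln (real n / real (n + 1)) = - ln (1 + 1 / real n)"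
      using that ln1[OF that] ln_divide_pos[of "real n" "real (n + 1)"] by simp
    finally have "1 / real (n + 1) \<le> ln (1 + 1 / real n)" by (simp add: field_simps)
    then show "1 \<le> real (n + 1) * ln (1 + 1 / real n)" by (simp add: field_simps)
  qed
  have iff1: "(n + 1) ^ ((n + 1) * r) < p ^ s * n ^ ((n + 1) * r) \<longleftrightarrow>
      real r * (real (n + 1) * ln (1 + 1 / real n)) < real s * ln (real p)" if "n > 0" for n r s
  proof -
    have "(n + 1) ^ ((n + 1) * r) < p ^ s * n ^ ((n + 1) * r) \<longleftrightarrow>
        ln (real ((n + 1) ^ ((n + 1) * r))) < ln (real (p ^ s * n ^ ((n + 1) * r)))"
      using that assms by (subst ln_less_cancel_iff) (simp_all only: of_nat_less_iff, simp_all)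
    also have "\<dots> \<longleftrightarrow> real ((n + 1) * r) * (ln (real (Suc n)) - ln (real n)) < real s * ln (real p)"
      using that assms by (simp add: ln_mult ln_realpow algebra_simps)
    finally show ?thesis unfolding ln1[OF that] by (simp add: algebra_simps)
  qed
  have iff2: "p ^ s * n ^ (n * r) < (n + 1) ^ (n * r) \<longleftrightarrow>
      real s * ln (real p) < real r * (real n * ln (1 + 1 / real n))" if "n > 0" for n r s
  proof -
    have "p ^ s * n ^ (n * r) < (n + 1) ^ (n * r) \<longleftrightarrow>
        ln (real (p ^ s * n ^ (n * r))) < ln (real ((n + 1) ^ (n * r)))"
      using that assms by (subst ln_less_cancel_iff) (simp_all only: of_nat_less_iff, simp_all)
    also have "\<dots> \<longleftrightarrow> real s * ln (real p) < real (n * r) * (ln (real (Suc n)) - ln (real n))"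
      using that assms by (simp add: ln_mult ln_realpow algebra_simps)
    finally show ?thesis unfolding ln1[OF that] by (simp add: algebra_simps)
  qed
  have "semidecidable (\<lambda>z. \<exists>n. n > 0 \<and> (n + 1) ^ ((n + 1) * ?r z) < p ^ ?s z * n ^ ((n + 1) * ?r z))"
    by (intro semidecidable_ex semidecidable_if_decidable computable_intros)
  moreover have "(\<exists>n. n > 0 \<and> (n + 1) ^ ((n + 1) * r) < p ^ s * n ^ ((n + 1) * r)) \<longleftrightarrow>
      real r < real s * ln (real p)" for r s
  proof
    assume "\<exists>n. n > 0 \<and> (n + 1) ^ ((n + 1) * r) < p ^ s * n ^ ((n + 1) * r)"
    then obtain n where n: "n > 0" "real r * (real (n + 1) * ln (1 + 1 / real n)) < real s * ln (real p)"
      using iff1 by blast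
    have "real r * 1 \<le> real r * (real (n + 1) * ln (1 + 1 / real n))"
      by (intro mult_left_mono lnb n) simp
    with n(2) show "real r < real s * ln (real p)" by simp
  next
    assume "real r < real s * ln (real p)"
    then have "eventually (\<lambda>n. real r * (real (n + 1) * ln (1 + 1 / real n)) < real s * ln (real p) \<and> n > 0) sequentially"
      using order_tendstoD(2)[OF lim(1)] by (intro eventually_conj eventually_gt_at_top) blast+
    then obtain n where "real r * (real (n + 1) * ln (1 + 1 / real n)) < real s * ln (real p)" "n > 0"
      using eventually_happens by force
    then show "\<exists>n. n > 0 \<and> (n + 1) ^ ((n + 1) * r) < p ^ s * n ^ ((n + 1) * r)" using iff1 by blast
  qed
  ultimately show "semidecidable (\<lambda>z. real (?r z) < real (?s z) * ln (real p))" by simp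
  have "semidecidable (\<lambda>z. \<exists>n. n > 0 \<and> p ^ ?s z * n ^ (n * ?r z) < (n + 1) ^ (n * ?r z))"
    by (intro semidecidable_ex semidecidable_if_decidable computable_intros)
  moreover have "(\<exists>n. n > 0 \<and> p ^ s * n ^ (n * r) < (n + 1) ^ (n * r)) \<longleftrightarrow>
      real s * ln (real p) < real r" for r s
  proof
    assume "\<exists>n. n > 0 \<and> p ^ s * n ^ (n * r) < (n + 1) ^ (n * r)"
    then obtain n where n: "n > 0" "real s * ln (real p) < real r * (real n * ln (1 + 1 / real n))"
      using iff2 by blast
    have "real r * (real n * ln (1 + 1 / real n)) \<le> real r * 1"
      by (intro mult_left_mono lnb n) simp
    with n(2) show "real s * ln (real p) < real r" by simp
  next
    assume "real s * ln (real p) < real r"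
    then have "eventually (\<lambda>n. real s * ln (real p) < real r * (real n * ln (1 + 1 / real n)) \<and> n > 0) sequentially"
      using order_tendstoD(1)[OF lim(2)] by (intro eventually_conj eventually_gt_at_top) blast+
    then obtain n where "real s * ln (real p) < real r * (real n * ln (1 + 1 / real n))" "n > 0"
      using eventually_happens by force
    then show "\<exists>n. n > 0 \<and> p ^ s * n ^ (n * r) < (n + 1) ^ (n * r)" using iff2 by blast
  qed
  ultimately show "semidecidable (\<lambda>z. real (?s z) * ln (real p) < real (?r z))" by simp
qed (use assms in simp)

lemma computable_real_if_computable_reals:
  assumes "computable_reals (\<lambda>_. x)" shows "computable_real x"
proof -
  obtain f where f: "computable_seq (\<lambda>z. f (pfst z) (psnd z))" "\<And>n k. \<bar>2 ^ k * x - real (f n k)\<bar> \<le> 1"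
    by (rule computable_realsE[OF assms]) blast
  have "computable_seq (\<lambda>k. f 0 k)"
    using computable_apply[OF f(1), of "\<lambda>k. pair 0 k"] by (simp add: computable_intros)
  moreover have "\<bar>x - (real (f 0 k) - real 0) / (real (2 ^ k - 1) + 1)\<bar> \<le> 1 / 2 ^ k" for k
  proof -
    have "real (2 ^ k - 1) + 1 = 2 ^ k" by (simp add: of_nat_diff)
    moreover have "x - real (f 0 k) / 2 ^ k = (2 ^ k * x - real (f 0 k)) / 2 ^ k" by (simp add: field_simps)
    ultimately show ?thesis using f(2)[of k 0] by (simp add: abs_divide divide_right_mono)
  qed
  ultimately show ?thesis unfolding computable_real_def
    by (intro exI[of _ "\<lambda>k. f 0 k"] exI[of _ "\<lambda>_. 0"] exI[of _ "\<lambda>k. 2 ^ k - 1"] conjI computable_intros) auto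
qed

section \<open>Recursions and growth bounds for S\<close>

lemma sum_multiples:
  fixes g h :: "nat \<Rightarrow> real" assumes "d > 0"
  shows "(\<Sum>U=1..n. (if d dvd U then g (U div d) else 0) * h U) = (\<Sum>V=1..n div d. g V * h (d * V))"
proof -
  have "(\<Sum>U=1..n. (if d dvd U then g (U div d) else 0) * h U) = (\<Sum>U | U \<in> {1..n} \<and> d dvd U. g (U div d) * h U)"
    unfolding if_distrib[of "\<lambda>t. t * _"] by (subst sum.inter_filter) (auto intro: sum.cong)
  also have "\<dots> = (\<Sum>V=1..n div d. g V * h (d * V))"
  proof (rule sum.reindex_bij_witness[where i = "\<lambda>V. d * V" and j = "\<lambda>U. U div d"])
    fix U assume U: "U \<in> {U. U \<in> {1..n} \<and> d dvd U}"
    then show "U div d \<in> {1..n div d}" using assms by (auto simp: div_le_mono Suc_le_eq div_greater_zero_iff dvd_imp_le)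
  next
    fix V assume V: "V \<in> {1..n div d}"
    then have "d * V \<le> d * (n div d)" by simp
    also have "\<dots> \<le> n" by simp
    finally show "d * V \<in> {U. U \<in> {1..n} \<and> d dvd U}" using V assms by simp
  qed (use assms in auto)
  finally show ?thesis .
qed

section \<open>Recursions for the summatory functions\<close>

context coprime_bases
begin

text \<open>The weight \<open>h\<close> is kept general: the constant 1 gives the counting
  recursion, and U^-alpha - N^-alpha later evaluates \<open>J\<close> at an integer N.\<close>

lemma sum_W0_mult:
  fixes h :: "nat \<Rightarrow> real"
  shows "(\<Sum>U=1..n. real (W0 p q U) * h U) = (\<Sum>V=1..n div p. real (W p q V) * h (p * V))
    + (\<Sum>V=1..n div q. real (W p q V) * h (q * V)) - (\<Sum>V=1..n div (p * q). real (W p q V) * h (p * q * V))"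
proof -
  have "real (W0 p q U) = (if p dvd U then real (W p q (U div p)) else 0)
      + (if q dvd U then real (W p q (U div q)) else 0)
      - (if p * q dvd U then real (W p q (U div (p * q))) else 0)" for U
  proof -
    have "real (W0 p q U) + real (if p * q dvd U then W p q (U div (p * q)) else 0) =
        real (if p dvd U then W p q (U div p) else 0) + real (if q dvd U then W p q (U div q) else 0)"
      using W0_rec[of U] by (metis of_nat_add)
    then show ?thesis by (simp split: if_splits)
  qed
  then have "(\<Sum>U=1..n. real (W0 p q U) * h U) =
      (\<Sum>U=1..n. (if p dvd U then real (W p q (U div p)) else 0) * h U)
      + (\<Sum>U=1..n. (if q dvd U then real (W p q (U div q)) else 0) * h U)
      - (\<Sum>U=1..n. (if p * q dvd U then real (W p q (U div (p * q))) else 0) * h U)"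
    by (simp only: distrib_right left_diff_distrib sum.distrib sum_subtractf)
  also have "\<dots> = (\<Sum>V=1..n div p. real (W p q V) * h (p * V))
      + (\<Sum>V=1..n div q. real (W p q V) * h (q * V)) - (\<Sum>V=1..n div (p * q). real (W p q V) * h (p * q * V))"
    using p_gt_1 q_gt_1 by (intro arg_cong2[where f = "(-)"] arg_cong2[where f = "(+)"] sum_multiples) auto
  finally show ?thesis .
qed

lemma nat_floor_divide: "0 \<le> x \<Longrightarrow> nat \<lfloor>x / real d\<rfloor> = nat \<lfloor>x\<rfloor> div d"
  using floor_divide_real_eq_div[of "int d" x] by (simp add: nat_div_distrib)

abbreviation Sr :: "real \<Rightarrow> real" where "Sr x \<equiv> real (S p q x)"

lemma Sr_eq: "Sr x = (\<Sum>U=1..nat \<lfloor>x\<rfloor>. real (W p q U))"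
  unfolding S_def by simp

definition D :: "real \<Rightarrow> real" where "D x = Sr x - Sr (x / q)"

definition G :: "real \<Rightarrow> real" where "G x = (\<Sum>U=1..nat \<lfloor>x\<rfloor>. real (W0 p q U))"

lemma Sr_less_1: "x < 1 \<Longrightarrow> Sr x = 0"
  unfolding Sr_eq by (simp add: floor_less_iff nat_eq_iff le_less)

lemma D_less_1: assumes "0 \<le> x" "x < 1" shows "D x = 0"
proof -
  have "x / q \<le> x" using assms q_gt_1 by (simp add: divide_le_eq mult_le_cancel_left1)
  then show ?thesis using Sr_less_1[of x] Sr_less_1[of "x / q"] assms by (simp add: D_def)
qed

lemma G_eq:
  assumes "0 \<le> x" shows "G x = D (x / p) + Sr (x / q)"
proof -
  have "G x = Sr (x / p) + Sr (x / q) - Sr (x / p / q)"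
    using sum_W0_mult[of "\<lambda>_. 1" "nat \<lfloor>x\<rfloor>"] nat_floor_divide[OF assms, of p] nat_floor_divide[OF assms, of q]
      nat_floor_divide[OF assms, of "p * q"] unfolding G_def Sr_eq by simp
  then show ?thesis unfolding D_def by simp
qed

text \<open>By \<open>W_Suc\<close> each w(U) counts at U and at U + 1, except that the last one
  counts only once and w(0) = 1 comes in from below.\<close>

lemma Sr_rec:
  assumes "0 \<le> x" shows "Sr x = 2 * D (x / p) + 2 * Sr (x / q) + 1 - real (W0 p q (nat \<lfloor>x\<rfloor>))"
proof -
  have "(\<Sum>U=1..n. real (W p q U)) = 2 * (\<Sum>U=1..n. real (W0 p q U)) + 1 - real (W0 p q n)" for n
  proof (induction n)
    case (Suc n)
    then show ?case using W_Suc[of n] by simp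
  qed (simp add: W0_0)
  from this[of "nat \<lfloor>x\<rfloor>"] show ?thesis
    using G_eq[OF assms] unfolding Sr_eq[of x] G_def by simp
qed

lemma D_rec:
  assumes "0 \<le> x" shows "D x = 2 * D (x / p) + Sr (x / q) + 1 - real (W0 p q (nat \<lfloor>x\<rfloor>))"
  using Sr_rec[OF assms] unfolding D_def by simp

lemma Sr_mono: "x \<le> y \<Longrightarrow> Sr x \<le> Sr y"
  unfolding Sr_eq by (intro sum_mono2) (auto dest!: floor_mono[of x y] nat_mono)

text \<open>\<open>D\<close> is the summatory function of W(U) minus W(U/q), the latter taken as 0
  if q does not divide U; \<open>W0_ge\<close> makes these terms nonnegative.\<close>

lemma D_mono: assumes "0 \<le> x" "x \<le> y" shows "D x \<le> D y"
proof -
  have *: "D z = (\<Sum>U=1..nat \<lfloor>z\<rfloor>. real (W p q U) - (if q dvd U then real (W p q (U div q)) else 0) * 1)"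
    if "0 \<le> z" for z
    unfolding D_def Sr_eq sum_subtractf using sum_multiples[of q "\<lambda>U. real (W p q U)" "\<lambda>_. 1"] q_gt_1
    by (simp add: nat_floor_divide[OF that])
  have nn: "real (W p q U) - (if q dvd U then real (W p q (U div q)) else 0) * 1 \<ge> 0" for U
    using W0_ge[of U] W0_le_W[of p q U] by auto
  show ?thesis unfolding *[OF assms(1)] *[OF order_trans[OF assms]]
    using assms(2) by (intro sum_mono2 nn) (auto dest!: floor_mono[of x y] nat_mono)
qed

lemma W0_eq_G_diff: assumes "1 \<le> x" shows "real (W0 p q (nat \<lfloor>x\<rfloor>)) = G x - G (x - 1)"
proof -
  have "nat \<lfloor>x\<rfloor> = Suc (nat \<lfloor>x - 1\<rfloor>)" using assms by linarith
  then show ?thesis unfolding G_def by simp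
qed

text \<open>Writing w(x) as G(x) - G(x - 1) turns part of the main terms into their values at x - 1,
  and monotonicity moves the rest there. The negative term is thus traded for a shift of the
  argument.\<close>

lemma Sr_ge: assumes "1 \<le> x" shows "2 * D ((x - 1) / p) + 2 * Sr ((x - 1) / q) + 1 \<le> Sr x"
  and D_ge: "2 * D ((x - 1) / p) + Sr ((x - 1) / q) + 1 \<le> D x"
proof -
  have *: "G x = D (x / p) + Sr (x / q)" "G (x - 1) = D ((x - 1) / p) + Sr ((x - 1) / q)"
    using assms by (intro G_eq; simp)+
  have "D ((x - 1) / p) \<le> D (x / p)" "Sr ((x - 1) / q) \<le> Sr (x / q)"
    by (intro D_mono Sr_mono divide_right_mono; use assms in simp)+
  then show "2 * D ((x - 1) / p) + 2 * Sr ((x - 1) / q) + 1 \<le> Sr x"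
      "2 * D ((x - 1) / p) + Sr ((x - 1) / q) + 1 \<le> D x"
    using Sr_rec[of x] D_rec[of x] W0_eq_G_diff[OF assms] * assms by simp_all
qed

end

section \<open>Growth bounds of order x^alpha\<close>

locale chain_exponent = coprime_bases +
  fixes \<alpha> :: real
  assumes exponent: "is_exponent p q \<alpha>"
begin

definition P :: real where "P = real p powr - \<alpha>"
definition Q :: real where "Q = real q powr - \<alpha>"

lemma \<alpha>_pos: "\<alpha> > 0" using exponent unfolding is_exponent_def by simp

lemma PQ_pos: "P > 0" "Q > 0" using p_gt_1 q_gt_1 by (simp_all add: P_def Q_def)

lemma PQ_eq: "2 * P + 2 * Q - 2 * (P * Q) = 1"
  using exponent unfolding is_exponent_def P_def Q_def by (simp add: powr_mult)

text \<open>The exponent equation reads 2P(1-Q) = 1-2Q, and likewise with P and Q exchanged; the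
  left sides are positive.\<close>

lemma PQ_less: "P < 1 / 2" "Q < 1 / 2"
proof -
  have "P < 1" "Q < 1" unfolding P_def Q_def using p_gt_1 q_gt_1 \<alpha>_pos by (simp_all add: powr_less_one)
  moreover have "(1 - P) * (1 - Q) = 1 / 2" using PQ_eq by (simp add: algebra_simps)
  moreover have "2 * P * (1 - Q) = 1 - 2 * Q" "2 * Q * (1 - P) = 1 - 2 * P" using PQ_eq by (simp_all add: algebra_simps)
  ultimately have "0 < 1 - 2 * Q" "0 < 1 - 2 * P" using PQ_pos
    by (metis diff_gt_0_iff_gt mult_pos_pos zero_less_numeral)+
  then show "P < 1 / 2" "Q < 1 / 2" by simp_all
qed

lemma powr_div_p: "0 \<le> x \<Longrightarrow> (x / p) powr \<alpha> = P * x powr \<alpha>"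
  and powr_div_q: "0 \<le> x \<Longrightarrow> (x / q) powr \<alpha> = Q * x powr \<alpha>"
  by (simp_all add: powr_divide P_def Q_def powr_minus_divide)

text \<open>The pair (1-Q)/Q, 1/Q of constants is reproduced by the recursion, so both bounds
  propagate together; S + 1 in place of S absorbs the constant 1. At x = 1/q the second bound equals
  1, the value of S + 1 there, which fixes the scale.\<close>

lemma upper_bound:
  "0 \<le> x \<Longrightarrow> D x \<le> (1 - Q) / Q * x powr \<alpha> \<and> (1 / q \<le> x \<longrightarrow> Sr x + 1 \<le> x powr \<alpha> / Q)"
proof -
  \<comment> \<open>Since x/p and x/q are at most x/2, an integer bound on x serves as induction
    variable.\<close>
  have "x < real (Suc N) \<Longrightarrow> 0 \<le> x \<Longrightarrow> D x \<le> (1 - Q) / Q * x powr \<alpha> \<and> (1 / q \<le> x \<longrightarrow> Sr x + 1 \<le> x powr \<alpha> / Q)" for N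
  proof (induction N arbitrary: x)
    case 0
    have "1 \<le> x powr \<alpha> / Q" if "1 / q \<le> x"
    proof -
      have "(1 / q) powr \<alpha> \<le> x powr \<alpha>" using that \<alpha>_pos q_gt_1 by (intro powr_mono2) auto
      then show ?thesis using powr_div_q[of 1] PQ_pos by (simp add: field_simps)
    qed
    moreover have "0 \<le> (1 - Q) / Q * x powr \<alpha>" using PQ_pos PQ_less by simp
    ultimately show ?case using 0 Sr_less_1[of x] D_less_1[of x] by simp
  next
    case (Suc N)
    show ?case
    proof (cases "x < 1")
      case True
      show ?thesis using Suc.IH[of x] True Suc.prems by simp
    next
      case False
      have "x / p \<le> x / 2" "x / q \<le> x / 2" using p_gt_1 q_gt_1 False by (intro divide_left_mono; simp)+
      moreover have "x / 2 < real (Suc N)" using Suc.prems by simp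
      ultimately have "x / p < real (Suc N)" "x / q < real (Suc N)" by linarith+
      moreover have "1 / q \<le> x / q" using False by (intro divide_right_mono) auto
      ultimately have D: "D (x / p) \<le> (1 - Q) / Q * (P * x powr \<alpha>)" and S: "Sr (x / q) + 1 \<le> (Q * x powr \<alpha>) / Q"
        using Suc.IH[of "x / p"] Suc.IH[of "x / q"] Suc.prems by (auto simp: powr_div_p powr_div_q)
      have key: "2 * ((1 - Q) / Q * (P * x powr \<alpha>)) = (1 - 2 * Q) / Q * x powr \<alpha>"
      proof -
        have "2 * ((1 - Q) * P) = 1 - 2 * Q" using PQ_eq by (simp add: algebra_simps)
        then show ?thesis by (metis (no_types, opaque_lifting) mult.assoc mult.commute times_divide_eq_left times_divide_eq_right)
      qed
      have S': "Sr (x / q) + 1 \<le> x powr \<alpha>" using S PQ_pos by simp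
      have a: "(1 - 2 * Q) / Q * x powr \<alpha> + x powr \<alpha> = (1 - Q) / Q * x powr \<alpha>"
        "(1 - 2 * Q) / Q * x powr \<alpha> + 2 * x powr \<alpha> = x powr \<alpha> / Q"
        using PQ_pos by (simp_all add: field_simps)
      have w: "0 \<le> real (W0 p q (nat \<lfloor>x\<rfloor>))" by simp
      have "D x \<le> (1 - Q) / Q * x powr \<alpha>" using D_rec[of x] D S' key a(1) w Suc.prems by linarith
      moreover have "Sr x + 1 \<le> x powr \<alpha> / Q" using Sr_rec[of x] D S' key a(2) w Suc.prems by linarith
      ultimately show ?thesis by simp
    qed
  qed
  moreover obtain N where "x < real N" using reals_Archimedean2 by blast
  then have "x < real (Suc N)" by simp
  ultimately show "0 \<le> x \<Longrightarrow> ?thesis" by blast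
qed

text \<open>The shift by 1 in \<open>Sr_ge\<close> is absorbed by bounding the functions at x - 1:
  for p at least 2, (x - 2)/p is at least x/p - 1, so the induction closes. The constants for D and
  S again have ratio 1-Q.\<close>

lemma lower_bound:
  obtains m where "m > 0" "\<And>x. x \<ge> 1 \<Longrightarrow> m * x powr \<alpha> \<le> Sr x"
proof -
  \<comment> \<open>Above B both x/p and x/q are at least 2, as the induction hypothesis requires.
    Up to B it suffices that D and S are at least 1, which fixes m.\<close>
  define B where "B = 2 * real (p * q)"
  define m where "m = (1 - Q) * B powr - \<alpha>"
  have B: "B > 2" "real p \<le> B / 2" "real q \<le> B / 2"
    using p_gt_1 q_gt_1 less_1_mult[of "real p" "real q"] by (simp_all add: B_def mult_le_cancel_left1 mult_le_cancel_right1)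
  have m: "m > 0" using PQ_less B by (simp add: m_def)
  have *: "x < real (Suc N) \<Longrightarrow> 2 \<le> x \<Longrightarrow> m * x powr \<alpha> \<le> D (x - 1) \<and> m / (1 - Q) * x powr \<alpha> \<le> Sr (x - 1)" for N x
  proof (induction N arbitrary: x)
    case (Suc N)
    have ge1: "1 \<le> D (x - 1)" "1 \<le> Sr (x - 1)"
    proof -
      have "0 \<le> D ((x - 1 - 1) / p)" using D_mono[of 0 "(x - 1 - 1) / p"] D_less_1[of 0] Suc.prems by simp
      then show "1 \<le> D (x - 1)" "1 \<le> Sr (x - 1)"
        using Sr_ge[of "x - 1"] D_ge[of "x - 1"] Suc.prems
          of_nat_0_le_iff[of "S p q ((x - 1 - 1) / q)", where 'a = real] by linarith+
    qed
    show ?case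
    proof (cases "x \<le> B")
      case True
      have "m / (1 - Q) * x powr \<alpha> \<le> B powr - \<alpha> * B powr \<alpha>"
        using True Suc.prems PQ_less \<alpha>_pos unfolding m_def by (auto intro!: mult_left_mono powr_mono2)
      also have "\<dots> = 1" using B by (simp flip: powr_add)
      finally have 1: "m / (1 - Q) * x powr \<alpha> \<le> 1" .
      have "m * x powr \<alpha> \<le> m / (1 - Q) * x powr \<alpha>"
        using m PQ_less PQ_pos by (intro mult_right_mono) (auto simp: le_divide_eq mult_le_cancel_left1)
      then show ?thesis using 1 ge1 by simp
    next
      case False
      have le2: "x / p \<le> x / 2" "x / q \<le> x / 2" using p_gt_1 q_gt_1 Suc.prems by (intro divide_left_mono; simp)+
      moreover have "x / 2 < real (Suc N)" using Suc.prems by simp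
      ultimately have "x / p < real (Suc N)" "x / q < real (Suc N)" by linarith+
      moreover have "2 \<le> x / p" "2 \<le> x / q" using False B p_gt_1 q_gt_1 by (simp_all add: le_divide_eq)
      ultimately have IH: "m * (P * x powr \<alpha>) \<le> D (x / p - 1)" "m / (1 - Q) * (Q * x powr \<alpha>) \<le> Sr (x / q - 1)"
        using Suc.IH[of "x / p"] Suc.IH[of "x / q"] Suc.prems by (auto simp: powr_div_p powr_div_q)
      have sh: "x / p - 1 \<le> (x - 1 - 1) / p" "x / q - 1 \<le> (x - 1 - 1) / q"
        using p_gt_1 q_gt_1 by (simp_all add: field_simps)
      have "D (x / p - 1) \<le> D ((x - 1 - 1) / p)" "Sr (x / q - 1) \<le> Sr ((x - 1 - 1) / q)"
        using \<open>2 \<le> x / p\<close> by (intro D_mono Sr_mono sh; simp)+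
      with IH have IH': "m * (P * x powr \<alpha>) \<le> D ((x - 1 - 1) / p)" "m / (1 - Q) * (Q * x powr \<alpha>) \<le> Sr ((x - 1 - 1) / q)"
        by linarith+
      define X where "X = m / (1 - Q) * x powr \<alpha>"
      have X: "m * x powr \<alpha> = (1 - Q) * X" using PQ_less by (simp add: X_def)
      have "2 * ((1 - Q) * P) = 1 - 2 * Q" using PQ_eq by (simp add: algebra_simps)
      then have e1: "2 * (m * (P * x powr \<alpha>)) = (1 - 2 * Q) * X"
        using X by (metis (no_types, opaque_lifting) mult.assoc mult.commute)
      have e2: "m / (1 - Q) * (Q * x powr \<alpha>) = Q * X" by (simp add: X_def)
      have "2 * D ((x - 1 - 1) / p) + Sr ((x - 1 - 1) / q) \<ge> (1 - 2 * Q) * X + Q * X"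
        using IH' e1 e2 by linarith
      moreover have "2 * D ((x - 1 - 1) / p) + 2 * Sr ((x - 1 - 1) / q) \<ge> (1 - 2 * Q) * X + 2 * (Q * X)"
        using IH' e1 e2 by linarith
      ultimately show ?thesis using Sr_ge[of "x - 1"] D_ge[of "x - 1"] Suc.prems
        unfolding X X_def[symmetric] by (simp add: algebra_simps)
    qed
  qed simp
  show thesis
  proof (rule that[of "m / (1 - Q)"])
    show "m / (1 - Q) > 0" using m PQ_less by simp
    fix x :: real assume x: "x \<ge> 1"
    obtain N where "x + 1 < real N" using reals_Archimedean2 by blast
    then have "m / (1 - Q) * (x + 1) powr \<alpha> \<le> Sr x" using *[of "x + 1" N] x by simp
    moreover have "m / (1 - Q) * x powr \<alpha> \<le> m / (1 - Q) * (x + 1) powr \<alpha>"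
      using x m PQ_less \<alpha>_pos by (intro mult_left_mono powr_mono2) auto
    ultimately show "m / (1 - Q) * x powr \<alpha> \<le> Sr x" by linarith
  qed
qed

text \<open>As P + Q < 1, continuity gives beta < alpha with p^-beta + q^-beta < 1. A base divides
  at most one of n and n - 1, so W(n) is at most one earlier value for p plus one for q, and
  induction closes.\<close>

lemma W_bound:
  obtains \<beta> where "0 < \<beta>" "\<beta> < \<alpha>" "\<And>n. n \<ge> 1 \<Longrightarrow> real (W p q n) \<le> real n powr \<beta>"
proof -
  have "isCont (\<lambda>t. real p powr - t + real q powr - t) \<alpha>"
    using p_gt_1 q_gt_1 by (auto intro!: continuous_intros)
  moreover have "real p powr - \<alpha> + real q powr - \<alpha> < 1" using PQ_less unfolding P_def Q_def by simp
  ultimately have "eventually (\<lambda>t. real p powr - t + real q powr - t < 1) (at_left \<alpha>)"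
    unfolding isCont_def using order_tendstoD(2) filterlim_at_split by blast
  then have "eventually (\<lambda>t. real p powr - t + real q powr - t < 1 \<and> t \<in> {0<..<\<alpha>}) (at_left \<alpha>)"
    using eventually_at_left_real[OF \<alpha>_pos] eventually_conj by blast
  then obtain \<beta> where \<beta>: "real p powr - \<beta> + real q powr - \<beta> < 1" "0 < \<beta>" "\<beta> < \<alpha>"
    using eventually_happens[of _ "at_left \<alpha>"] by (auto simp: trivial_limit_at_left_real)
  have dvd: "\<not> d dvd n" if "d dvd Suc n" "d > 1" for d n :: nat
    using that by (metis dvd_diffD1 dvd_add_right_iff nat_dvd_1_iff_1 less_irrefl plus_1_eq_Suc add.commute)
  have "real (W p q n) \<le> real n powr \<beta>" if "n \<ge> 1" for n
    using that
  proof (induction n rule: less_induct)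
    case (less n)
    show ?case
    proof (cases "n = 1")
      case True
      have "W0 p q 1 = 0" using W0_rec[of 1] p_gt_1 q_gt_1 by simp
      then show ?thesis using True W_Suc[of 0] by (simp add: W0_0)
    next
      case False
      then obtain k where k: "n = Suc k" "k \<ge> 1" using less.prems by (cases n) auto
      define c where "c = (\<lambda>d U. if d dvd U then real (W p q (U div d)) else 0)"
      have W0: "real (W0 p q U) \<le> c p U + c q U" for U
        using W0_rec[of U] unfolding c_def by (auto split: if_splits)
      have c1: "c d U \<le> real n powr \<beta> * real d powr - \<beta>" if "d dvd U" "1 \<le> U" "U \<le> n" "d > 1" for d U
      proof -
        have "U div d < U" using that by simp
        then have "U div d < n" using that by linarith
        then have "real (W p q (U div d)) \<le> real (U div d) powr \<beta>"
          using less.IH[of "U div d"] that by (auto simp: Suc_le_eq div_greater_zero_iff dvd_imp_le)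
        also have "\<dots> = (real U / real d) powr \<beta>" using that by (simp add: real_of_nat_div)
        also have "\<dots> \<le> (real n / real d) powr \<beta>" using that \<beta> by (intro powr_mono2 divide_right_mono) auto
        also have "\<dots> = real n powr \<beta> * real d powr - \<beta>" by (simp add: powr_divide powr_minus_divide)
        finally show ?thesis using that by (simp add: c_def)
      qed
      have c2: "c d (Suc k) + c d k \<le> real n powr \<beta> * real d powr - \<beta>" if "d > 1" for d
      proof (cases "d dvd Suc k")
        case True
        then have "c d k = 0" using dvd[OF True that] by (simp add: c_def)
        then show ?thesis using c1[OF True] k that by simp
      next
        case False
        then have "c d (Suc k) = 0" by (simp add: c_def)
        then show ?thesis using c1[of d k] k that by (cases "d dvd k") (simp_all add: c_def)
      qed
      have "real (W p q n) = real (W0 p q (Suc k)) + real (W0 p q k)" unfolding k W_Suc by simp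
      also have "\<dots> \<le> (c p (Suc k) + c p k) + (c q (Suc k) + c q k)" using W0[of "Suc k"] W0[of k] by linarith
      also have "\<dots> \<le> real n powr \<beta> * real p powr - \<beta> + real n powr \<beta> * real q powr - \<beta>"
        using p_gt_1 q_gt_1 by (intro add_mono c2)
      also have "\<dots> = real n powr \<beta> * (real p powr - \<beta> + real q powr - \<beta>)" by (simp add: distrib_left)
      also have "\<dots> \<le> real n powr \<beta> * 1" using \<beta> by (intro mult_left_mono) auto
      finally show ?thesis by simp
    qed
  qed
  with \<beta> show thesis using that by blast
qed

end

section \<open>Averaging functional equations\<close>

text \<open>An epsilon form of the limsup, obtained as the infimum of the eventual upper bounds; the
  bound M keeps it real.\<close>

lemma limsup_real_exists:
  fixes t :: "real \<Rightarrow> real"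
  assumes "eventually (\<lambda>x. \<bar>t x\<bar> \<le> M) at_top"
  obtains \<Lambda> where "\<And>\<epsilon>. \<epsilon> > 0 \<Longrightarrow> eventually (\<lambda>x. t x \<le> \<Lambda> + \<epsilon>) at_top"
    "\<And>\<epsilon>. \<epsilon> > 0 \<Longrightarrow> frequently (\<lambda>x. t x \<ge> \<Lambda> - \<epsilon>) at_top"
proof -
  define A where "A = {c. eventually (\<lambda>x. t x \<le> c) at_top}"
  have "M \<in> A" unfolding A_def using assms by (auto elim: eventually_mono)
  have lb: "- M \<le> c" if "c \<in> A" for c
  proof -
    have ev: "eventually (\<lambda>x. t x \<le> c \<and> \<bar>t x\<bar> \<le> M) at_top"
      using that assms unfolding A_def by (auto intro: eventually_conj)
    obtain x where "t x \<le> c" "\<bar>t x\<bar> \<le> M" using eventually_happens[OF ev] by auto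
    then show ?thesis by linarith
  qed
  then have bdd: "bdd_below A" by (rule bdd_belowI)
  show thesis
  proof (rule that[of "Inf A"])
    fix \<epsilon> :: real assume "\<epsilon> > 0"
    then obtain c where "c \<in> A" "c < Inf A + \<epsilon>" using cInf_lessD[of A "Inf A + \<epsilon>"] \<open>M \<in> A\<close> by auto
    then show "eventually (\<lambda>x. t x \<le> Inf A + \<epsilon>) at_top"
      unfolding A_def by (auto elim: eventually_mono)
    show "frequently (\<lambda>x. t x \<ge> Inf A - \<epsilon>) at_top"
    proof (rule ccontr)
      assume "\<not> frequently (\<lambda>x. t x \<ge> Inf A - \<epsilon>) at_top"
      then have "eventually (\<lambda>x. t x \<le> Inf A - \<epsilon>) at_top"
        unfolding frequently_def not_not by (rule eventually_mono) simp
      then have "Inf A - \<epsilon> \<in> A" by (simp add: A_def)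
      then have "Inf A \<le> Inf A - \<epsilon>" by (rule cInf_lower[OF _ bdd])
      then show False using \<open>\<epsilon> > 0\<close> by simp
    qed
  qed
qed

text \<open>Stated for arbitrary t and d so that negating both turns results on the limsup into
  results on the liminf.\<close>

locale two_term_average =
  fixes p q :: nat and t d :: "real \<Rightarrow> real" and a b M :: real
  assumes pq: "p > 1" "q > 1" and ab: "0 < a" "a < 1" "0 < b" "b < 1"
    and t_avg: "((\<lambda>x. t x - (a * d (x / p) + (1 - a) * t (x / q))) \<longlongrightarrow> 0) at_top"
    and d_avg: "((\<lambda>x. d x - (b * d (x / p) + (1 - b) * t (x / q))) \<longlongrightarrow> 0) at_top"
    and t_bdd: "eventually (\<lambda>x. \<bar>t x\<bar> \<le> M) at_top" and d_bdd: "eventually (\<lambda>x. \<bar>d x\<bar> \<le> M) at_top"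
begin

lemma negated: "two_term_average p q (\<lambda>x. - t x) (\<lambda>x. - d x) a b M"
proof
  show "((\<lambda>x. - t x - (a * - d (x / p) + (1 - a) * - t (x / q))) \<longlongrightarrow> 0) at_top"
    using tendsto_minus[OF t_avg] by (simp add: algebra_simps)
  show "((\<lambda>x. - d x - (b * - d (x / p) + (1 - b) * - t (x / q))) \<longlongrightarrow> 0) at_top"
    using tendsto_minus[OF d_avg] by (simp add: algebra_simps)
qed (use pq ab t_bdd d_bdd in auto)

lemma eventually_divide:
  assumes "eventually Pr at_top" "c > 0" shows "eventually (\<lambda>x :: real. Pr (x / c)) at_top"
proof -
  have "filterlim (\<lambda>x :: real. x / c) at_top at_top" using assms(2) by real_asymp
  then show ?thesis using assms(1) by (simp add: filterlim_iff)
qed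

context
  fixes \<Lambda> :: real
  assumes upper: "\<And>\<epsilon>. \<epsilon> > 0 \<Longrightarrow> eventually (\<lambda>x. t x \<le> \<Lambda> + \<epsilon>) at_top"
    and freq: "\<And>\<epsilon>. \<epsilon> > 0 \<Longrightarrow> frequently (\<lambda>x. t x \<ge> \<Lambda> - \<epsilon>) at_top"
begin

lemma error_small:
  assumes "\<epsilon> > 0"
  shows "eventually (\<lambda>x. \<bar>t x - (a * d (x / p) + (1 - a) * t (x / q))\<bar> \<le> \<epsilon> \<and>
     \<bar>d x - (b * d (x / p) + (1 - b) * t (x / q))\<bar> \<le> \<epsilon>) at_top"
  using tendstoD[OF t_avg assms] tendstoD[OF d_avg assms]
  by eventually_elim (auto simp: dist_real_def)

text \<open>By the second average the limsup \<Delta> of d satisfies \<Delta> <= b \<Delta> + (1-b)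
  \<Lambda>, and b < 1.\<close>

lemma d_upper: assumes "\<epsilon> > 0" shows "eventually (\<lambda>x. d x \<le> \<Lambda> + \<epsilon>) at_top"
proof -
  obtain \<Delta> where \<Delta>: "\<And>\<epsilon>. \<epsilon> > 0 \<Longrightarrow> eventually (\<lambda>x. d x \<le> \<Delta> + \<epsilon>) at_top"
    "\<And>\<epsilon>. \<epsilon> > 0 \<Longrightarrow> frequently (\<lambda>x. d x \<ge> \<Delta> - \<epsilon>) at_top"
    by (rule limsup_real_exists[OF d_bdd]) blast
  have "(1 - b) * (\<Delta> - \<Lambda>) \<le> 0 + \<eta>" if "\<eta> > 0" for \<eta>
  proof -
    define \<epsilon> where "\<epsilon> = \<eta> / 3"
    have "\<epsilon> > 0" "\<eta> = 3 * \<epsilon>" using that by (simp_all add: \<epsilon>_def)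
    have ev: "eventually (\<lambda>x. d (x / p) \<le> \<Delta> + \<epsilon> \<and> t (x / q) \<le> \<Lambda> + \<epsilon> \<and>
        \<bar>d x - (b * d (x / p) + (1 - b) * t (x / q))\<bar> \<le> \<epsilon>) at_top"
      using eventually_divide[OF \<Delta>(1)[OF \<open>\<epsilon> > 0\<close>], of p] eventually_divide[OF upper[OF \<open>\<epsilon> > 0\<close>], of q]
        error_small[OF \<open>\<epsilon> > 0\<close>] pq by (simp add: eventually_conj_iff)
    obtain x where x: "d x \<ge> \<Delta> - \<epsilon>" "d (x / p) \<le> \<Delta> + \<epsilon>" "t (x / q) \<le> \<Lambda> + \<epsilon>"
       "\<bar>d x - (b * d (x / p) + (1 - b) * t (x / q))\<bar> \<le> \<epsilon>"
      using frequently_ex[OF frequently_eventually_conj[OF \<Delta>(2)[OF \<open>\<epsilon> > 0\<close>] ev]] by auto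
    have "b * d (x / p) \<le> b * (\<Delta> + \<epsilon>)" "(1 - b) * t (x / q) \<le> (1 - b) * (\<Lambda> + \<epsilon>)"
      using x ab by (auto intro!: mult_left_mono)
    then have "\<Delta> - \<epsilon> \<le> b * (\<Delta> + \<epsilon>) + (1 - b) * (\<Lambda> + \<epsilon>) + \<epsilon>" using x by linarith
    then show ?thesis unfolding \<open>\<eta> = 3 * \<epsilon>\<close> by (simp add: algebra_simps)
  qed
  then have "(1 - b) * (\<Delta> - \<Lambda>) \<le> 0" by (rule field_le_epsilon)
  then have "\<Delta> \<le> \<Lambda>" using ab by (simp add: mult_le_0_iff)
  then show ?thesis using \<Delta>(1)[OF assms] by (auto elim: eventually_mono)
qed

text \<open>If an average of two numbers that are nearly at most the limsup is near the limsup,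
  then so are both of them.\<close>

lemma average_step:
  assumes "\<epsilon> > 0"
  obtains \<delta> where "\<delta> > 0"
    "eventually (\<lambda>x. t x \<ge> \<Lambda> - \<delta> \<longrightarrow> d (x / p) \<ge> \<Lambda> - \<epsilon> \<and> t (x / q) \<ge> \<Lambda> - \<epsilon>) at_top"
    "eventually (\<lambda>x. d x \<ge> \<Lambda> - \<delta> \<longrightarrow> t x \<ge> \<Lambda> - \<epsilon>) at_top"
proof -
  define m where "m = min (min a (1 - a)) (min b (1 - b))"
  have m: "0 < m" "m \<le> a" "m \<le> 1 - a" "m \<le> b" "m \<le> 1 - b" "m < 1" using ab by (auto simp: m_def)
  \<comment> \<open>Each comparison loses 3 \<delta>, divided by a weight that is at least m; the
    second claim loses a further \<delta>. The choice ensures 3 \<delta> / m + \<delta> <=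
    \<epsilon>.\<close>
  define \<delta> where "\<delta> = \<epsilon> * m / 4"
  have \<delta>4: "\<delta> > 0" "\<epsilon> * m = 4 * \<delta>" using assms m by (simp_all add: \<delta>_def)
  moreover have "\<delta> * m \<le> \<delta> * 1" using \<delta>4 m by (intro mult_left_mono) auto
  ultimately have \<delta>: "\<delta> > 0" "3 * \<delta> + \<delta> * m \<le> \<epsilon> * m" and \<delta>\<epsilon>: "3 * \<delta> \<le> \<epsilon> * m" by simp_all
  define G where "G = (\<lambda>x. d (x / p) \<le> \<Lambda> + \<delta> \<and> t (x / q) \<le> \<Lambda> + \<delta> \<and>
      \<bar>t x - (a * d (x / p) + (1 - a) * t (x / q))\<bar> \<le> \<delta> \<and>
      \<bar>d x - (b * d (x / p) + (1 - b) * t (x / q))\<bar> \<le> \<delta>)"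
  have ev: "eventually G at_top" unfolding G_def
    using eventually_divide[OF d_upper[OF \<delta>(1)], of p] eventually_divide[OF upper[OF \<delta>(1)], of q]
      error_small[OF \<delta>(1)] pq by (simp add: eventually_conj_iff)
  have key: "u \<ge> \<Lambda> - 3 * \<delta> / c" if "0 < c" "c < 1" "v \<le> \<Lambda> + \<delta>" "\<Lambda> - 2 * \<delta> \<le> c * u + (1 - c) * v" for c u v
  proof -
    have "(1 - c) * v \<le> (1 - c) * (\<Lambda> + \<delta>)" using that by (intro mult_left_mono) auto
    moreover have "c * \<delta> \<ge> 0" using that \<delta>(1) by simp
    ultimately have "c * \<Lambda> - 3 * \<delta> \<le> c * u" using that by (simp add: algebra_simps)
    then show ?thesis using that(1) by (simp add: field_simps)
  qed
  have le: "3 * \<delta> / c \<le> 3 * \<delta> / m" if "m \<le> c" for c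
    using that m \<delta> by (intro divide_left_mono) auto
  have le2: "3 * \<delta> / m \<le> \<epsilon>" using \<delta>\<epsilon> m by (simp add: divide_le_eq)
  show thesis
  proof (rule that[OF \<delta>(1)])
    show "eventually (\<lambda>x. t x \<ge> \<Lambda> - \<delta> \<longrightarrow> d (x / p) \<ge> \<Lambda> - \<epsilon> \<and> t (x / q) \<ge> \<Lambda> - \<epsilon>) at_top"
      using ev
    proof (eventually_elim, intro impI)
      fix x assume "G x" "t x \<ge> \<Lambda> - \<delta>"
      then have "\<Lambda> - 2 * \<delta> \<le> a * d (x / p) + (1 - a) * t (x / q)"
        "\<Lambda> - 2 * \<delta> \<le> (1 - a) * t (x / q) + (1 - (1 - a)) * d (x / p)"
        and "d (x / p) \<le> \<Lambda> + \<delta>" "t (x / q) \<le> \<Lambda> + \<delta>" unfolding G_def by (simp_all add: abs_le_iff)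
      then show "d (x / p) \<ge> \<Lambda> - \<epsilon> \<and> t (x / q) \<ge> \<Lambda> - \<epsilon>"
        using key[of a "t (x / q)" "d (x / p)"] key[of "1 - a" "d (x / p)" "t (x / q)"] ab le[OF m(2)] le[OF m(3)] le2
        by linarith
    qed
    show "eventually (\<lambda>x. d x \<ge> \<Lambda> - \<delta> \<longrightarrow> t x \<ge> \<Lambda> - \<epsilon>) at_top"
      using ev
    proof (eventually_elim, intro impI)
      fix x assume x: "G x" "d x \<ge> \<Lambda> - \<delta>"
      then have "\<Lambda> - 2 * \<delta> \<le> b * d (x / p) + (1 - b) * t (x / q)"
        "\<Lambda> - 2 * \<delta> \<le> (1 - b) * t (x / q) + (1 - (1 - b)) * d (x / p)"
        and "d (x / p) \<le> \<Lambda> + \<delta>" "t (x / q) \<le> \<Lambda> + \<delta>" unfolding G_def by (simp_all add: abs_le_iff)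
      then have "d (x / p) \<ge> \<Lambda> - 3 * \<delta> / m" "t (x / q) \<ge> \<Lambda> - 3 * \<delta> / m"
        using key[of b "t (x / q)" "d (x / p)"] key[of "1 - b" "d (x / p)" "t (x / q)"] ab le[OF m(4)] le[OF m(5)]
        by linarith+
      then have "a * (\<Lambda> - 3 * \<delta> / m) + (1 - a) * (\<Lambda> - 3 * \<delta> / m) \<le> a * d (x / p) + (1 - a) * t (x / q)"
        using ab by (intro add_mono mult_left_mono) auto
      moreover have "a * (\<Lambda> - 3 * \<delta> / m) + (1 - a) * (\<Lambda> - 3 * \<delta> / m) = \<Lambda> - 3 * \<delta> / m" by algebra
      moreover have "\<bar>t x - (a * d (x / p) + (1 - a) * t (x / q))\<bar> \<le> \<delta>" using x(1) unfolding G_def by blast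
      ultimately have "\<Lambda> - 3 * \<delta> / m - \<delta> \<le> t x" by linarith
      moreover have "3 * \<delta> / m + \<delta> \<le> \<epsilon>" using \<delta>(2) m by (simp add: field_simps)
      ultimately show "t x \<ge> \<Lambda> - \<epsilon>" by linarith
    qed
  qed
qed

text \<open>The descent from x to x/p passes through d: t near \<Lambda> at x forces d near
  \<Lambda> at x/p, which in turn forces t near \<Lambda> at x/p.\<close>

lemma average_step_t:
  assumes "\<epsilon> > 0"
  obtains \<delta> where "\<delta> > 0"
    "eventually (\<lambda>x. t x \<ge> \<Lambda> - \<delta> \<longrightarrow> t (x / p) \<ge> \<Lambda> - \<epsilon> \<and> t (x / q) \<ge> \<Lambda> - \<epsilon>) at_top"
proof -
  obtain \<delta>1 where \<delta>1: "\<delta>1 > 0"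
    "eventually (\<lambda>x. t x \<ge> \<Lambda> - \<delta>1 \<longrightarrow> d (x / p) \<ge> \<Lambda> - \<epsilon> \<and> t (x / q) \<ge> \<Lambda> - \<epsilon>) at_top"
    "eventually (\<lambda>x. d x \<ge> \<Lambda> - \<delta>1 \<longrightarrow> t x \<ge> \<Lambda> - \<epsilon>) at_top"
    by (rule average_step[OF assms])
  have "min \<delta>1 \<epsilon> > 0" using assms \<delta>1(1) by simp
  then obtain \<delta> where \<delta>: "\<delta> > 0"
    "eventually (\<lambda>x. t x \<ge> \<Lambda> - \<delta> \<longrightarrow> d (x / p) \<ge> \<Lambda> - min \<delta>1 \<epsilon> \<and> t (x / q) \<ge> \<Lambda> - min \<delta>1 \<epsilon>) at_top"
    "eventually (\<lambda>x. d x \<ge> \<Lambda> - \<delta> \<longrightarrow> t x \<ge> \<Lambda> - min \<delta>1 \<epsilon>) at_top"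
    by (rule average_step)
  have "eventually (\<lambda>x. t x \<ge> \<Lambda> - \<delta> \<longrightarrow> t (x / p) \<ge> \<Lambda> - \<epsilon> \<and> t (x / q) \<ge> \<Lambda> - \<epsilon>) at_top"
    using \<delta>(2) eventually_divide[OF \<delta>1(3), of p] pq by (auto elim: eventually_elim2)
  with \<delta>(1) show thesis by (rule that)
qed

lemma average_iterate:
  "\<epsilon> > 0 \<Longrightarrow> \<exists>\<delta>>0. eventually (\<lambda>x. t x \<ge> \<Lambda> - \<delta> \<longrightarrow> t (x / (p ^ i * q ^ j)) \<ge> \<Lambda> - \<epsilon>) at_top"
proof (induction "i + j" arbitrary: i j \<epsilon>)
  case 0
  then show ?case by (auto intro!: exI[of _ \<epsilon>])
next
  case (Suc n)
  obtain \<eta> where \<eta>: "\<eta> > 0" "eventually (\<lambda>x. t x \<ge> \<Lambda> - \<eta> \<longrightarrow> t (x / p) \<ge> \<Lambda> - \<epsilon> \<and> t (x / q) \<ge> \<Lambda> - \<epsilon>) at_top"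
    using average_step_t[OF Suc.prems] .
  have step: ?case
    if e: "n = i' + j'" "p ^ i * q ^ j = (p ^ i' * q ^ j') * r" "r = p \<or> r = q" for i' j' r
  proof -
    obtain \<delta> where \<delta>: "\<delta> > 0" "eventually (\<lambda>x. t x \<ge> \<Lambda> - \<delta> \<longrightarrow> t (x / (p ^ i' * q ^ j')) \<ge> \<Lambda> - \<eta>) at_top"
      using Suc.hyps(1)[OF e(1) \<eta>(1)] by blast
    have "real (p ^ i' * q ^ j') > 0" using pq by simp
    from \<delta>(2) eventually_divide[OF \<eta>(2) this]
    have "eventually (\<lambda>x. t x \<ge> \<Lambda> - \<delta> \<longrightarrow> t (x / real (p ^ i' * q ^ j') / r) \<ge> \<Lambda> - \<epsilon>) at_top"
      by eventually_elim (use e(3) in auto)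
    moreover have "x / real (p ^ i * q ^ j) = x / real (p ^ i' * q ^ j') / real r" for x
      unfolding e(2) of_nat_mult[of _ r] by simp
    ultimately show ?thesis using \<delta>(1) by (intro exI[of _ \<delta>]) (simp only: simp_thms)
  qed
  show ?case
  proof (cases i)
    case 0
    then obtain j' where "j = Suc j'" using Suc.hyps(2) by (cases j) auto
    then show ?thesis using step[of i j' q] Suc.hyps(2) by simp
  next
    case (Suc i')
    then show ?thesis using step[of i' j p] Suc.hyps(2) by simp
  qed
qed

text \<open>Only finitely many exponents occur, so the minimum of their tolerances is positive and
  one point x serves them all.\<close>

lemma frequently_near_limsup:
  assumes "\<epsilon> > 0"
  shows "frequently (\<lambda>x. \<forall>i\<le>N. \<forall>j\<le>N. t (x / (p ^ i * q ^ j)) \<ge> \<Lambda> - \<epsilon>) at_top"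
proof -
  have "\<exists>\<delta>. \<forall>i j. \<delta> i j > 0 \<and> eventually (\<lambda>x. t x \<ge> \<Lambda> - \<delta> i j \<longrightarrow> t (x / (p ^ i * q ^ j)) \<ge> \<Lambda> - \<epsilon>) at_top"
    using average_iterate[OF assms] by metis
  then obtain \<delta> where \<delta>: "\<And>i j. \<delta> i j > 0"
    "\<And>i j. eventually (\<lambda>x. t x \<ge> \<Lambda> - \<delta> i j \<longrightarrow> t (x / (p ^ i * q ^ j)) \<ge> \<Lambda> - \<epsilon>) at_top"
    by blast
  define \<eta> where "\<eta> = Min ((\<lambda>(i, j). \<delta> i j) ` ({..N} \<times> {..N}))"
  have \<eta>: "\<eta> > 0" "\<And>i j. i \<le> N \<Longrightarrow> j \<le> N \<Longrightarrow> \<eta> \<le> \<delta> i j"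
    unfolding \<eta>_def using \<delta>(1) by (auto intro: Min_le)
  have "eventually (\<lambda>x. \<forall>i\<in>{..N}. \<forall>j\<in>{..N}. t x \<ge> \<Lambda> - \<delta> i j \<longrightarrow> t (x / (p ^ i * q ^ j)) \<ge> \<Lambda> - \<epsilon>) at_top"
    using \<delta>(2) by (intro eventually_ball_finite ballI) auto
  from frequently_eventually_conj[OF freq[OF \<eta>(1)] this] show ?thesis
  proof (rule frequently_elim1, clarify)
    fix x i j
    assume "\<forall>i\<in>{..N}. \<forall>j\<in>{..N}. t x \<ge> \<Lambda> - \<delta> i j \<longrightarrow> t (x / (p ^ i * q ^ j)) \<ge> \<Lambda> - \<epsilon>"
      and "t x \<ge> \<Lambda> - \<eta>" "i \<le> N" "j \<le> N"
    then show "t (x / (p ^ i * q ^ j)) \<ge> \<Lambda> - \<epsilon>" using \<eta>(2)[of i j] by force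
  qed
qed

end
end

section \<open>Convergence\<close>

context coprime_bases
begin

text \<open>A rational ratio would give p ^ n = q ^ m with n > 0, against coprimality.\<close>

lemma ln_ratio_irrational: "ln (real p) / ln (real q) \<notin> \<rat>"
proof
  assume rat: "ln (real p) / ln (real q) \<in> \<rat>"
  have pos: "ln (real p) > 0" "ln (real q) > 0" using p_gt_1 q_gt_1 by simp_all
  obtain m n where mn: "n \<noteq> 0" "\<bar>ln (real p) / ln (real q)\<bar> = real m / real n"
    using Rats_abs_nat_div_natE[OF rat] by metis
  then have "real n * ln (real p) = real m * ln (real q)" using pos by (simp add: field_simps)
  then have "ln (real (p ^ n)) = ln (real (q ^ m))" using p_gt_1 q_gt_1 by (simp add: ln_realpow)
  then have "real (p ^ n) = real (q ^ m)" using p_gt_1 q_gt_1 by (subst (asm) ln_inj_iff) simp_all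
  then have "p ^ n = q ^ m" by (simp only: of_nat_eq_iff)
  moreover have "coprime (p ^ n) (q ^ m)" using coprime by simp
  ultimately have "p ^ n = 1" by simp
  then show False using mn(1) p_gt_1 by simp
qed

text \<open>Dirichlet approximation makes a ln p - b ln q at most ln q / N in absolute value, which
  is at most ln \<rho> by the choice of N; irrationality makes it nonzero. Its sign is not
  controlled, hence the disjunction.\<close>

lemma ratio_near_1:
  assumes "\<rho> > 1"
  obtains a b where "1 < real (p ^ a) / real (q ^ b) \<and> real (p ^ a) / real (q ^ b) \<le> \<rho> \<or>
    1 < real (q ^ b) / real (p ^ a) \<and> real (q ^ b) / real (p ^ a) \<le> \<rho>"
proof -
  have pos: "ln (real p) > 0" "ln (real q) > 0" using p_gt_1 q_gt_1 by simp_all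
  define \<theta> where "\<theta> = ln (real p) / ln (real q)"
  obtain N where N: "N > 0" "ln (real q) / ln \<rho> < real N"
    using reals_Archimedean2[of "max 1 (ln (real q) / ln \<rho>)"] by (metis max_less_iff_conj of_nat_0_less_iff less_trans zero_less_one)
  obtain h k where hk: "0 < k" "\<bar>of_int k * \<theta> - of_int h\<bar> < 1 / real N"
    using Dirichlet_approx[OF N(1)] by metis
  have "1 / real N \<le> 1" using N by simp
  moreover have "of_int k * \<theta> > 0" using hk(1) pos by (simp add: \<theta>_def)
  ultimately have "h \<ge> 0" using hk(2) by linarith
  define a b where "a = nat k" and "b = nat h"
  have ab: "of_int k = real a" "of_int h = real b" using hk(1) \<open>h \<ge> 0\<close> by (simp_all add: a_def b_def)
  define l where "l = real a * ln (real p) - real b * ln (real q)"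
  have "l = (real a * \<theta> - real b) * ln (real q)" using pos by (simp add: l_def \<theta>_def left_diff_distrib)
  then have "\<bar>l\<bar> = \<bar>real a * \<theta> - real b\<bar> * ln (real q)" using pos by (simp add: abs_mult)
  also have "\<dots> \<le> 1 / real N * ln (real q)"
    using hk(2) pos unfolding ab by (intro mult_right_mono) auto
  also have "\<dots> \<le> ln \<rho>" using N assms by (simp add: field_simps)
  finally have l: "\<bar>l\<bar> \<le> ln \<rho>" .
  have "l \<noteq> 0"
  proof
    assume "l = 0"
    then have "\<theta> = real b / real a" using hk(1) pos by (simp add: l_def \<theta>_def a_def field_simps)
    then show False using ln_ratio_irrational unfolding \<theta>_def by simp
  qed
  have e: "real (p ^ a) / real (q ^ b) = exp l" "real (q ^ b) / real (p ^ a) = exp (- l)"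
    using p_gt_1 q_gt_1 by (simp_all add: l_def exp_diff exp_of_nat_mult)
  have "exp \<bar>l\<bar> \<le> \<rho>" using l assms by (metis exp_ln exp_le_cancel_iff less_trans zero_less_one)
  moreover have "1 < exp \<bar>l\<bar>" using \<open>l \<noteq> 0\<close> by simp
  ultimately show thesis using that[of a b] unfolding e by (cases "l \<ge> 0") auto
qed

text \<open>For 1 < x/y <= \<rho>, the numbers y^(k-i) x^i with i up to k form a geometric
  progression from y^k of ratio at most \<rho>; k is so large that it passes y^k H. Starting at y^k
  instead of 1 keeps all exponents of p and q nonnegative.\<close>

lemma products_dense:
  assumes "\<rho> > 1" "H \<ge> (1::real)"
  obtains R N where "R > 0" "\<And>v. R \<le> v \<Longrightarrow> v \<le> R * H \<Longrightarrow>
    \<exists>i\<le>N. \<exists>j\<le>N. v \<le> real (p ^ i * q ^ j) \<and> real (p ^ i * q ^ j) \<le> \<rho> * v"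
proof -
  note result = that
  have grid: thesis
    if xy: "1 < x / y" "x / y \<le> \<rho>" "y > 0"
      and mem: "\<And>k. \<exists>N. \<forall>i\<le>k. \<exists>i'\<le>N. \<exists>j'\<le>N. y ^ (k - i) * x ^ i = real (p ^ i' * q ^ j')" for x y :: real
  proof -
    define r where "r = x / y"
    obtain k where k: "H < r ^ k" using real_arch_pow[of r H] xy by (auto simp: r_def)
    obtain N where N: "\<And>i. i \<le> k \<Longrightarrow> \<exists>i'\<le>N. \<exists>j'\<le>N. y ^ (k - i) * x ^ i = real (p ^ i' * q ^ j')"
      using mem[of k] by blast
    show thesis
    proof (rule result[of "y ^ k" N])
      show "y ^ k > 0" using xy by simp
      fix v assume v: "y ^ k \<le> v" "v \<le> y ^ k * H"
      \<comment> \<open>The first term at or above v: its predecessor, if any, lies below v, so it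
        exceeds v by a factor of at most r.\<close>
      define i where "i = (LEAST i. v \<le> y ^ k * r ^ i)"
      have "y ^ k * H \<le> y ^ k * r ^ k" using k xy by (intro mult_left_mono) auto
      with v(2) have ex: "v \<le> y ^ k * r ^ k" by linarith
      have i1: "v \<le> y ^ k * r ^ i" unfolding i_def by (rule LeastI[of _ k]) (rule ex)
      have ik: "i \<le> k" unfolding i_def by (rule Least_le) (rule ex)
      have i2: "y ^ k * r ^ i \<le> \<rho> * v"
      proof (cases i)
        case 0
        have "0 < y ^ k" using xy by simp
        then have "1 * v \<le> \<rho> * v" using v(1) assms(1) by (intro mult_right_mono) linarith+
        then show ?thesis using 0 v(1) by simp
      next
        case (Suc i')
        then have "\<not> v \<le> y ^ k * r ^ i'" unfolding i_def by (intro not_less_Least) simp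
        then have "r * (y ^ k * r ^ i') \<le> \<rho> * v" using xy assms(1) by (intro mult_mono) (auto simp: r_def)
        then show ?thesis unfolding Suc by (simp add: mult_ac)
      qed
      have "y ^ k * r ^ i = y ^ (k - i) * x ^ i"
        using ik xy by (simp add: r_def power_divide power_diff field_simps)
      then show "\<exists>i\<le>N. \<exists>j\<le>N. v \<le> real (p ^ i * q ^ j) \<and> real (p ^ i * q ^ j) \<le> \<rho> * v"
        using N[OF ik] i1 i2 by metis
    qed
  qed
  obtain a b where ab: "1 < real (p ^ a) / real (q ^ b) \<and> real (p ^ a) / real (q ^ b) \<le> \<rho> \<or>
    1 < real (q ^ b) / real (p ^ a) \<and> real (q ^ b) / real (p ^ a) \<le> \<rho>"
    by (rule ratio_near_1[OF assms(1)])
  have m1: "\<exists>N. \<forall>i\<le>k. \<exists>i'\<le>N. \<exists>j'\<le>N. real (q ^ b) ^ (k - i) * real (p ^ a) ^ i = real (p ^ i' * q ^ j')" for k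
  proof (rule exI[of _ "a * k + b * k"], intro allI impI)
    fix i assume "i \<le> k"
    then have "a * i \<le> a * k + b * k" "b * (k - i) \<le> a * k + b * k" by (simp_all add: trans_le_add1 trans_le_add2)
    moreover have "real (q ^ b) ^ (k - i) * real (p ^ a) ^ i = real (p ^ (a * i) * q ^ (b * (k - i)))"
      by (simp add: power_mult)
    ultimately show "\<exists>i'\<le>a * k + b * k. \<exists>j'\<le>a * k + b * k.
        real (q ^ b) ^ (k - i) * real (p ^ a) ^ i = real (p ^ i' * q ^ j')" by blast
  qed
  have m2: "\<exists>N. \<forall>i\<le>k. \<exists>i'\<le>N. \<exists>j'\<le>N. real (p ^ a) ^ (k - i) * real (q ^ b) ^ i = real (p ^ i' * q ^ j')" for k
  proof (rule exI[of _ "a * k + b * k"], intro allI impI)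
    fix i assume "i \<le> k"
    then have "a * (k - i) \<le> a * k + b * k" "b * i \<le> a * k + b * k" by (simp_all add: trans_le_add1 trans_le_add2)
    moreover have "real (p ^ a) ^ (k - i) * real (q ^ b) ^ i = real (p ^ (a * (k - i)) * q ^ (b * i))"
      by (simp add: power_mult)
    ultimately show "\<exists>i'\<le>a * k + b * k. \<exists>j'\<le>a * k + b * k.
        real (p ^ a) ^ (k - i) * real (q ^ b) ^ i = real (p ^ i' * q ^ j')" by blast
  qed
  have pos: "real (p ^ a) > 0" "real (q ^ b) > 0" using p_gt_1 q_gt_1 by simp_all
  from ab show thesis
  proof (elim disjE conjE)
    assume "1 < real (p ^ a) / real (q ^ b)" "real (p ^ a) / real (q ^ b) \<le> \<rho>"
    then show thesis by (rule grid[OF _ _ pos(2) m1])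
  next
    assume "1 < real (q ^ b) / real (p ^ a)" "real (q ^ b) / real (p ^ a) \<le> \<rho>"
    then show thesis by (rule grid[OF _ _ pos(1) m2])
  qed
qed

end

section \<open>Normalised counting functions and their limit values\<close>

context chain_exponent
begin

text \<open>If S behaves like L x^alpha, then D behaves like (1-Q) L x^alpha; the factor 1-Q gives t
  and d the same limit.\<close>

definition t :: "real \<Rightarrow> real" where "t x = (1 - Q) * Sr x * x powr - \<alpha>"
definition d :: "real \<Rightarrow> real" where "d x = D x * x powr - \<alpha>"

lemma t_bounds: assumes "x \<ge> 1" shows "0 \<le> t x" "t x \<le> (1 - Q) / Q"
proof -
  have "1 / real q \<le> 1" using q_gt_1 by simp
  then have "Sr x \<le> x powr \<alpha> / Q" using upper_bound[of x] assms by linarith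
  then have "(1 - Q) * Sr x * x powr - \<alpha> \<le> (1 - Q) * (x powr \<alpha> / Q) * x powr - \<alpha>"
    using PQ_less by (intro mult_right_mono mult_left_mono) auto
  also have "\<dots> = (1 - Q) / Q * (x powr \<alpha> * x powr - \<alpha>)" by simp
  also have "\<dots> = (1 - Q) / Q" using assms by (simp flip: powr_add)
  finally show "t x \<le> (1 - Q) / Q" unfolding t_def .
  show "0 \<le> t x" using PQ_less by (simp add: t_def)
qed

lemma d_bounds: assumes "x \<ge> 1" shows "0 \<le> d x" "d x \<le> (1 - Q) / Q"
proof -
  have "D x \<le> (1 - Q) / Q * x powr \<alpha>" using upper_bound[of x] assms by simp
  then have "D x * x powr - \<alpha> \<le> (1 - Q) / Q * x powr \<alpha> * x powr - \<alpha>" by (intro mult_right_mono) auto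
  also have "\<dots> = (1 - Q) / Q" using assms by (simp flip: powr_add)
  finally show "d x \<le> (1 - Q) / Q" unfolding d_def .
  have "D x \<ge> 0" using D_mono[of 0 x] D_less_1[of 0] assms by simp
  then show "0 \<le> d x" by (simp add: d_def)
qed

lemma W0_small: "((\<lambda>x. real (W0 p q (nat \<lfloor>x\<rfloor>)) * x powr - \<alpha>) \<longlongrightarrow> 0) at_top"
proof -
  obtain \<beta> where \<beta>: "0 < \<beta>" "\<beta> < \<alpha>" "\<And>n. n \<ge> 1 \<Longrightarrow> real (W p q n) \<le> real n powr \<beta>" by (rule W_bound) blast
  have lim: "((\<lambda>x. x powr (\<beta> - \<alpha>)) \<longlongrightarrow> 0) at_top" using \<beta> by (intro tendsto_neg_powr) (auto intro: filterlim_ident)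
  show ?thesis
  proof (rule tendsto_sandwich[OF _ _ tendsto_const lim])
    show "eventually (\<lambda>x. real (W0 p q (nat \<lfloor>x\<rfloor>)) * x powr - \<alpha> \<le> x powr (\<beta> - \<alpha>)) at_top"
      using eventually_ge_at_top[of 1]
    proof eventually_elim
      case (elim x)
      have "real (W0 p q (nat \<lfloor>x\<rfloor>)) \<le> real (nat \<lfloor>x\<rfloor>) powr \<beta>"
        using \<beta>(3)[of "nat \<lfloor>x\<rfloor>"] W0_le_W[of p q "nat \<lfloor>x\<rfloor>"] elim by (simp add: le_nat_iff le_floor_iff)
      also have "\<dots> \<le> x powr \<beta>" using elim \<beta> by (intro powr_mono2) auto
      finally have "real (W0 p q (nat \<lfloor>x\<rfloor>)) * x powr - \<alpha> \<le> x powr \<beta> * x powr - \<alpha>" by (intro mult_right_mono) auto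
      then show ?case by (simp flip: powr_add)
    qed
  qed (auto intro: always_eventually)
qed

lemma averages: "two_term_average p q t d (2 * P * (1 - Q)) (2 * P) ((1 - Q) / Q)"
proof
  show "p > 1" "q > 1" by (fact p_gt_1 q_gt_1)+
  \<comment> \<open>Both are forms of the exponent equation; they say that the weights of each
    average sum to 1.\<close>
  have a: "1 - 2 * P * (1 - Q) = 2 * Q" "(1 - 2 * P) * (1 - Q) = Q" using PQ_eq by (simp_all add: algebra_simps)
  show "0 < 2 * P * (1 - Q)" using PQ_pos PQ_less by simp
  show "2 * P * (1 - Q) < 1" using a(1) PQ_pos by linarith
  show "0 < 2 * P" "2 * P < 1" using PQ_pos PQ_less by simp_all
  show "eventually (\<lambda>x. \<bar>t x\<bar> \<le> (1 - Q) / Q) at_top" "eventually (\<lambda>x. \<bar>d x\<bar> \<le> (1 - Q) / Q) at_top"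
    using eventually_ge_at_top[of 1] by (eventually_elim; use t_bounds d_bounds in simp)+
  have dp: "d (x / p) * P = D (x / p) * x powr - \<alpha>" and tq: "t (x / q) * Q = (1 - Q) * Sr (x / q) * x powr - \<alpha>"
    if "x \<ge> 1" for x
    using that p_gt_1 q_gt_1 PQ_pos
    by (simp_all add: d_def t_def powr_divide P_def Q_def powr_minus_divide field_simps)
  have z: "((\<lambda>x. x powr - \<alpha>) \<longlongrightarrow> 0) at_top"
    by (rule tendsto_neg_powr[OF _ filterlim_ident]) (use \<alpha>_pos in simp)
  have w0: "((\<lambda>x. x powr - \<alpha> - real (W0 p q (nat \<lfloor>x\<rfloor>)) * x powr - \<alpha>) \<longlongrightarrow> 0) at_top"
    using tendsto_diff[OF z W0_small] by (simp only: diff_0_right)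
  show "((\<lambda>x. d x - (2 * P * d (x / p) + (1 - 2 * P) * t (x / q))) \<longlongrightarrow> 0) at_top"
  proof (rule Lim_transform_eventually[OF w0])
    show "eventually (\<lambda>x. x powr - \<alpha> - real (W0 p q (nat \<lfloor>x\<rfloor>)) * x powr - \<alpha> =
        d x - (2 * P * d (x / p) + (1 - 2 * P) * t (x / q))) at_top"
      using eventually_ge_at_top[of 1]
    proof eventually_elim
      case (elim x)
      have "(1 - 2 * P) * t (x / q) * (1 - Q) = (1 - Q) * (Sr (x / q) * x powr - \<alpha>)"
      proof -
        have "(1 - 2 * P) * t (x / q) * (1 - Q) = t (x / q) * ((1 - 2 * P) * (1 - Q))" by (simp only: mult_ac)
        also have "\<dots> = (1 - Q) * (Sr (x / q) * x powr - \<alpha>)" unfolding a(2) tq[OF elim] by (simp only: mult_ac)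
        finally show ?thesis .
      qed
      then have "(1 - 2 * P) * t (x / q) = Sr (x / q) * x powr - \<alpha>" using PQ_less by simp
      moreover have "2 * P * d (x / p) = 2 * (D (x / p) * x powr - \<alpha>)"
        using dp[OF elim] by (simp add: mult_ac)
      moreover have "d x = 2 * (D (x / p) * x powr - \<alpha>) + Sr (x / q) * x powr - \<alpha> + x powr - \<alpha>
          - real (W0 p q (nat \<lfloor>x\<rfloor>)) * x powr - \<alpha>"
        unfolding d_def D_rec[OF order_trans[OF zero_le_one elim]] by (simp add: algebra_simps)
      ultimately show ?case by simp
    qed
  qed
  have w1: "((\<lambda>x. (1 - Q) * (x powr - \<alpha> - real (W0 p q (nat \<lfloor>x\<rfloor>)) * x powr - \<alpha>)) \<longlongrightarrow> 0) at_top"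
    using tendsto_mult_right_zero[OF w0, of "1 - Q"] by simp
  show "((\<lambda>x. t x - (2 * P * (1 - Q) * d (x / p) + (1 - 2 * P * (1 - Q)) * t (x / q))) \<longlongrightarrow> 0) at_top"
  proof (rule Lim_transform_eventually[OF w1])
    show "eventually (\<lambda>x. (1 - Q) * (x powr - \<alpha> - real (W0 p q (nat \<lfloor>x\<rfloor>)) * x powr - \<alpha>) =
        t x - (2 * P * (1 - Q) * d (x / p) + (1 - 2 * P * (1 - Q)) * t (x / q))) at_top"
      using eventually_ge_at_top[of 1]
    proof eventually_elim
      case (elim x)
      have "2 * P * (1 - Q) * d (x / p) = 2 * (1 - Q) * (d (x / p) * P)" by simp
      also have "\<dots> = 2 * (1 - Q) * (D (x / p) * x powr - \<alpha>)" unfolding dp[OF elim] ..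
      finally have 1: "2 * P * (1 - Q) * d (x / p) = 2 * (1 - Q) * (D (x / p) * x powr - \<alpha>)" .
      have 2: "(1 - 2 * P * (1 - Q)) * t (x / q) = 2 * ((1 - Q) * Sr (x / q) * x powr - \<alpha>)"
        unfolding a(1) using tq[OF elim] by (simp add: mult_ac)
      show ?case unfolding 1 2 t_def[of x] Sr_rec[OF order_trans[OF zero_le_one elim]] by (simp add: algebra_simps)
    qed
  qed
qed

text \<open>Monotonicity of S makes t slowly decreasing.\<close>

lemma t_slow:
  assumes "\<epsilon> > 0"
  obtains \<rho> where "\<rho> > 1" "\<And>u v. 1 \<le> u \<Longrightarrow> u \<le> v \<Longrightarrow> v \<le> \<rho> * u \<Longrightarrow> t u - \<epsilon> \<le> t v"
proof -
  define M where "M = (1 - Q) / Q"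
  have M: "M > 0" using PQ_less PQ_pos by (simp add: M_def)
  have "((\<lambda>\<rho>. \<rho> powr - \<alpha>) \<longlongrightarrow> 1 powr - \<alpha>) (at_right 1)"
    by (intro tendsto_intros) auto
  \<comment> \<open>As M bounds t, a relative loss of \<epsilon> / M costs at most
    \<epsilon>.\<close>
  from order_tendstoD(1)[OF this] have "eventually (\<lambda>\<rho>. 1 - \<epsilon> / M < \<rho> powr - \<alpha>) (at_right 1)"
    using assms M by simp
  then have ev: "eventually (\<lambda>\<rho>. 1 - \<epsilon> / M < \<rho> powr - \<alpha> \<and> \<rho> > 1) (at_right 1)"
    using eventually_at_right_less by (rule eventually_conj)
  obtain \<rho> where \<rho>: "1 - \<epsilon> / M < \<rho> powr - \<alpha>" "\<rho> > 1"
    using eventually_happens[OF ev] by auto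
  show thesis
  proof (rule that[OF \<rho>(2)])
    fix u v :: real assume uv: "1 \<le> u" "u \<le> v" "v \<le> \<rho> * u"
    have "t u * (1 - \<epsilon> / M) \<le> t u * \<rho> powr - \<alpha>" using \<rho> t_bounds(1)[OF uv(1)] by (intro mult_left_mono) auto
    also have "\<dots> = (1 - Q) * Sr u * (\<rho> * u) powr - \<alpha>" using \<rho> uv by (simp add: t_def powr_mult)
    also have "\<dots> \<le> (1 - Q) * Sr v * v powr - \<alpha>"
      using Sr_mono[OF uv(2)] PQ_less uv \<alpha>_pos
      by (intro mult_mono mult_left_mono powr_mono2') auto
    finally have "t u * (1 - \<epsilon> / M) \<le> t v" by (simp only: t_def)
    then have "t u - \<epsilon> * (t u / M) \<le> t v" by (simp add: algebra_simps)
    moreover have "t u / M \<le> 1" using t_bounds(2)[OF uv(1)] M unfolding M_def[symmetric] by simp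
    then have "\<epsilon> * (t u / M) \<le> \<epsilon> * 1" using assms by (intro mult_left_mono) auto
    ultimately show "t u - \<epsilon> \<le> t v" by linarith
  qed
qed

text \<open>A strong kind of limit point: limsup and liminf both qualify, while evaluating
  \<open>J\<close> on such intervals leaves only one possible value.\<close>

definition long_limit :: "real \<Rightarrow> bool" where
  "long_limit \<Lambda> \<longleftrightarrow> (\<forall>\<epsilon>>0. \<forall>H\<ge>1. \<forall>X. \<exists>y\<ge>X. \<forall>u. y / H \<le> u \<and> u \<le> y \<longrightarrow> \<bar>t u - \<Lambda>\<bar> \<le> \<epsilon>)"

text \<open>Density gives every u in [x/(RH), x/R] a product m of powers with x/m <= u <= \<rho>
  x/m. As t is near \<Lambda> at x/m and slowly decreasing, it is not much smaller at u.\<close>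

lemma long_limit_limsup:
  assumes upper: "\<And>\<epsilon>. \<epsilon> > 0 \<Longrightarrow> eventually (\<lambda>x. t x \<le> \<Lambda> + \<epsilon>) at_top"
    and freq: "\<And>\<epsilon>. \<epsilon> > 0 \<Longrightarrow> frequently (\<lambda>x. t x \<ge> \<Lambda> - \<epsilon>) at_top"
  shows "long_limit \<Lambda>"
  unfolding long_limit_def
proof (intro allI impI)
  fix \<epsilon> H X :: real assume \<epsilon>: "\<epsilon> > 0" and H: "H \<ge> 1"
  obtain \<rho> where \<rho>: "\<rho> > 1" "\<And>u v. 1 \<le> u \<Longrightarrow> u \<le> v \<Longrightarrow> v \<le> \<rho> * u \<Longrightarrow> t u - \<epsilon> / 2 \<le> t v"
    using t_slow[of "\<epsilon> / 2"] \<epsilon> by auto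
  obtain R N where R: "R > 0" "\<And>v. R \<le> v \<Longrightarrow> v \<le> R * H \<Longrightarrow>
      \<exists>i\<le>N. \<exists>j\<le>N. v \<le> real (p ^ i * q ^ j) \<and> real (p ^ i * q ^ j) \<le> \<rho> * v"
    using products_dense[OF \<rho>(1) H] by blast
  obtain Y where Y: "\<And>x. x \<ge> Y \<Longrightarrow> t x \<le> \<Lambda> + \<epsilon>"
    using upper[OF \<epsilon>] unfolding eventually_at_top_linorder by blast
  interpret two_term_average p q t d "2 * P * (1 - Q)" "2 * P" "(1 - Q) / Q" by (rule averages)
  have f: "frequently (\<lambda>x. \<forall>i\<le>N. \<forall>j\<le>N. t (x / (p ^ i * q ^ j)) \<ge> \<Lambda> - \<epsilon> / 2) at_top"
    by (rule frequently_near_limsup[OF upper freq]) (use \<epsilon> in auto)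
  \<comment> \<open>This size puts the interval above Y, X and \<rho>; the last makes x/m at least 1
    where slow decrease is applied.\<close>
  obtain x where x: "x \<ge> R * H * (\<bar>Y\<bar> + \<bar>X\<bar> + \<rho>)" "\<And>i j. i \<le> N \<Longrightarrow> j \<le> N \<Longrightarrow> t (x / (p ^ i * q ^ j)) \<ge> \<Lambda> - \<epsilon> / 2"
    using frequently_ex[OF frequently_eventually_conj[OF f eventually_ge_at_top[of "R * H * (\<bar>Y\<bar> + \<bar>X\<bar> + \<rho>)"]]] by auto
  have y: "x / R / H \<ge> \<bar>Y\<bar> + \<bar>X\<bar> + \<rho>" using x(1) R(1) H by (simp add: field_simps)
  then have "x / R / H \<ge> 0" using \<rho>(1) by linarith
  then have x0: "x / R \<ge> 0" using H zero_le_divide_iff[of "x / R" H] by linarith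
  then have "x / R / H \<le> x / R / 1" using H by (intro divide_left_mono) auto
  then have y': "x / R \<ge> x / R / H" by simp
  show "\<exists>y\<ge>X. \<forall>u. y / H \<le> u \<and> u \<le> y \<longrightarrow> \<bar>t u - \<Lambda>\<bar> \<le> \<epsilon>"
  proof (intro exI[of _ "x / R"] conjI allI impI)
    show "x / R \<ge> X" using y y' \<rho>(1) by linarith
    fix u assume u: "x / R / H \<le> u \<and> u \<le> x / R"
    have u1: "u \<ge> Y" "u \<ge> \<rho>" "u > 0" using u y \<rho>(1) by linarith+
    have "R \<le> x / u" "x / u \<le> R * H" using u u1 R(1) H by (simp_all add: field_simps)
    then obtain i j where ij: "i \<le> N" "j \<le> N" "x / u \<le> real (p ^ i * q ^ j)" "real (p ^ i * q ^ j) \<le> \<rho> * (x / u)"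
      using R(2) by blast
    define m where "m = real (p ^ i * q ^ j)"
    have m: "m > 0" using p_gt_1 q_gt_1 by (simp add: m_def)
    have "x / m \<le> u" "u \<le> \<rho> * (x / m)" using ij(3,4) m u1 unfolding m_def[symmetric] by (simp_all add: field_simps)
    moreover then have "1 \<le> x / m" using u1 \<rho>(1)
      by (smt (verit) mult_le_cancel_left1)
    ultimately have "t (x / m) - \<epsilon> / 2 \<le> t u" by (intro \<rho>(2))
    moreover have "t (x / m) \<ge> \<Lambda> - \<epsilon> / 2" using x(2)[OF ij(1,2)] unfolding m_def .
    ultimately show "\<bar>t u - \<Lambda>\<bar> \<le> \<epsilon>" using Y[OF u1(1)] by linarith
  qed
qed

text \<open>Slow decrease works in one direction only, so smallness of t must be carried down from a
  point x/m slightly above u.\<close>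

lemma long_limit_liminf:
  assumes upper: "\<And>\<epsilon>. \<epsilon> > 0 \<Longrightarrow> eventually (\<lambda>x. - t x \<le> \<Lambda> + \<epsilon>) at_top"
    and freq: "\<And>\<epsilon>. \<epsilon> > 0 \<Longrightarrow> frequently (\<lambda>x. - t x \<ge> \<Lambda> - \<epsilon>) at_top"
  shows "long_limit (- \<Lambda>)"
  unfolding long_limit_def
proof (intro allI impI)
  fix \<epsilon> H X :: real assume \<epsilon>: "\<epsilon> > 0" and H: "H \<ge> 1"
  obtain \<rho> where \<rho>: "\<rho> > 1" "\<And>u v. 1 \<le> u \<Longrightarrow> u \<le> v \<Longrightarrow> v \<le> \<rho> * u \<Longrightarrow> t u - \<epsilon> / 2 \<le> t v"
    using t_slow[of "\<epsilon> / 2"] \<epsilon> by auto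
  obtain R' N where R': "R' > 0" "\<And>v. R' \<le> v \<Longrightarrow> v \<le> R' * H \<Longrightarrow>
      \<exists>i\<le>N. \<exists>j\<le>N. v \<le> real (p ^ i * q ^ j) \<and> real (p ^ i * q ^ j) \<le> \<rho> * v"
    using products_dense[OF \<rho>(1) H] by blast
  \<comment> \<open>The factor \<rho> allows density to be applied to x/(u \<rho>), which gives m <=
    x/u, that is u <= x/m <= \<rho> u.\<close>
  define R where "R = R' * \<rho>"
  have R: "R > 0" using R'(1) \<rho>(1) by (simp add: R_def)
  obtain Y where Y: "\<And>x. x \<ge> Y \<Longrightarrow> - t x \<le> \<Lambda> + \<epsilon>"
    using upper[OF \<epsilon>] unfolding eventually_at_top_linorder by blast
  interpret two_term_average p q "\<lambda>x. - t x" "\<lambda>x. - d x" "2 * P * (1 - Q)" "2 * P" "(1 - Q) / Q"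
    by (rule two_term_average.negated[OF averages])
  have f: "frequently (\<lambda>x. \<forall>i\<le>N. \<forall>j\<le>N. - t (x / (p ^ i * q ^ j)) \<ge> \<Lambda> - \<epsilon> / 2) at_top"
    by (rule frequently_near_limsup[OF upper freq]) (use \<epsilon> in auto)
  obtain x where x: "x \<ge> R * H * (\<bar>Y\<bar> + \<bar>X\<bar> + 1)" "\<And>i j. i \<le> N \<Longrightarrow> j \<le> N \<Longrightarrow> - t (x / (p ^ i * q ^ j)) \<ge> \<Lambda> - \<epsilon> / 2"
    using frequently_ex[OF frequently_eventually_conj[OF f eventually_ge_at_top[of "R * H * (\<bar>Y\<bar> + \<bar>X\<bar> + 1)"]]] by auto
  have y: "x / R / H \<ge> \<bar>Y\<bar> + \<bar>X\<bar> + 1" using x(1) R(1) H by (simp add: field_simps)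
  then have "x / R / H \<ge> 0" by linarith
  then have x0: "x / R \<ge> 0" using H zero_le_divide_iff[of "x / R" H] by linarith
  then have "x / R / H \<le> x / R / 1" using H by (intro divide_left_mono) auto
  then have y': "x / R \<ge> x / R / H" by simp
  show "\<exists>y\<ge>X. \<forall>u. y / H \<le> u \<and> u \<le> y \<longrightarrow> \<bar>t u - - \<Lambda>\<bar> \<le> \<epsilon>"
  proof (intro exI[of _ "x / R"] conjI allI impI)
    show "x / R \<ge> X" using y y' by linarith
    fix u assume u: "x / R / H \<le> u \<and> u \<le> x / R"
    have u1: "u \<ge> Y" "u \<ge> 1" "u > 0" using u y by linarith+
    have R2: "R \<le> x / u" "x / u \<le> R * H" using u u1 R(1) H by (simp_all add: field_simps)
    have \<rho>0: "\<rho> > 0" using \<rho>(1) by simp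
    have "R' \<le> x / u / \<rho>" using R2(1) by (simp only: pos_le_divide_eq[OF \<rho>0] R_def)
    moreover have "x / u / \<rho> \<le> R' * H"
      using R2(2) by (simp only: pos_divide_le_eq[OF \<rho>0] R_def mult_ac)
    ultimately obtain i j where ij: "i \<le> N" "j \<le> N" "x / u / \<rho> \<le> real (p ^ i * q ^ j)" "real (p ^ i * q ^ j) \<le> \<rho> * (x / u / \<rho>)"
      using R'(2) by blast
    define m where "m = real (p ^ i * q ^ j)"
    have m: "m > 0" using p_gt_1 q_gt_1 by (simp add: m_def)
    have "u \<le> x / m" "x / m \<le> \<rho> * u" using ij(3,4) m u1 \<rho>(1) unfolding m_def[symmetric] by (simp_all add: field_simps)
    then have "t u - \<epsilon> / 2 \<le> t (x / m)" by (intro \<rho>(2) u1)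
    moreover have "- t (x / m) \<ge> \<Lambda> - \<epsilon> / 2" using x(2)[OF ij(1,2)] unfolding m_def .
    ultimately show "\<bar>t u - - \<Lambda>\<bar> \<le> \<epsilon>" using Y[OF u1(1)] by linarith
  qed
qed

text \<open>Both the limsup and the liminf of t are approached on long intervals, so t converges as soon
  as only one number has this property.\<close>

lemma t_tendsto:
  assumes "\<And>\<Lambda>. long_limit \<Lambda> \<Longrightarrow> \<Lambda> = L" shows "(t \<longlongrightarrow> L) at_top"
proof -
  interpret two_term_average p q t d "2 * P * (1 - Q)" "2 * P" "(1 - Q) / Q" by (rule averages)
  obtain \<Lambda> where \<Lambda>: "\<And>\<epsilon>. \<epsilon> > 0 \<Longrightarrow> eventually (\<lambda>x. t x \<le> \<Lambda> + \<epsilon>) at_top"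
    "\<And>\<epsilon>. \<epsilon> > 0 \<Longrightarrow> frequently (\<lambda>x. t x \<ge> \<Lambda> - \<epsilon>) at_top"
    by (rule limsup_real_exists[OF t_bdd]) blast
  then have L: "\<Lambda> = L" using assms long_limit_limsup by blast
  have "eventually (\<lambda>x. \<bar>- t x\<bar> \<le> (1 - Q) / Q) at_top" using t_bdd by simp
  from limsup_real_exists[OF this]
  obtain \<Lambda>' where \<Lambda>': "\<And>\<epsilon>. \<epsilon> > 0 \<Longrightarrow> eventually (\<lambda>x. - t x \<le> \<Lambda>' + \<epsilon>) at_top"
    "\<And>\<epsilon>. \<epsilon> > 0 \<Longrightarrow> frequently (\<lambda>x. - t x \<ge> \<Lambda>' - \<epsilon>) at_top" by blast
  then have L': "- \<Lambda>' = L" using assms long_limit_liminf by blast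
  show ?thesis
  proof (rule tendstoI)
    fix e :: real assume "e > 0"
    then have "e / 2 > 0" by simp
    from \<Lambda>(1)[OF this] \<Lambda>'(1)[OF this] show "eventually (\<lambda>x. dist (t x) L < e) at_top"
      by eventually_elim (use L L' \<open>e > 0\<close> in \<open>auto simp: dist_real_def\<close>)
  qed
qed

end

section \<open>The constant\<close>

lemma sum_by_parts:
  fixes g h :: "nat \<Rightarrow> real"
  shows "(\<Sum>U=1..Suc n. (g (U - 1) - g U) * h U) =
    g 0 * h 1 - g (Suc n) * h (Suc n) - (\<Sum>i<n. g (Suc i) * (h (Suc i) - h (Suc (Suc i))))"
  by (induction n) (simp_all add: algebra_simps)

section \<open>Determination of the limit through J\<close>

context chain_exponent
begin

text \<open>alpha times the integral of S(u) / u^(alpha+1) over u up to x.\<close>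

definition \<Phi> :: "real \<Rightarrow> real" where
  "\<Phi> x = (\<Sum>U=1..nat \<lfloor>x\<rfloor>. real (W p q U) * (real U powr - \<alpha> - x powr - \<alpha>))"

text \<open>On [u, v] the monotone S lies between its end values, and the weight alpha s^(-alpha-1)
  integrates to u^-alpha - v^-alpha. In terms of sums, the parts up to u contribute exactly Sr u
  times this difference.\<close>

lemma \<Phi>_diff:
  assumes "0 < u" "u \<le> v"
  shows "Sr u * (u powr - \<alpha> - v powr - \<alpha>) \<le> \<Phi> v - \<Phi> u"
    and "\<Phi> v - \<Phi> u \<le> Sr v * (u powr - \<alpha> - v powr - \<alpha>)"
proof -
  define m n where "m = nat \<lfloor>u\<rfloor>" and "n = nat \<lfloor>v\<rfloor>"
  have mn: "m \<le> n" using assms unfolding m_def n_def by (intro nat_mono floor_mono)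
  have split: "(\<Sum>U=1..n. f U) = (\<Sum>U=1..m. f U) + (\<Sum>U=Suc m..n. f U)" for f :: "nat \<Rightarrow> real"
    using mn by (metis Suc_eq_plus1 le_add1 add.commute sum.ub_add_nat le_add_diff_inverse)
  have S: "Sr u = (\<Sum>U=1..m. real (W p q U))" "Sr v = (\<Sum>U=1..m. real (W p q U)) + (\<Sum>U=Suc m..n. real (W p q U))"
    unfolding Sr_eq m_def[symmetric] n_def[symmetric] split by simp_all
  have "\<Phi> v - \<Phi> u = (\<Sum>U=1..m. real (W p q U) * (u powr - \<alpha> - v powr - \<alpha>))
      + (\<Sum>U=Suc m..n. real (W p q U) * (real U powr - \<alpha> - v powr - \<alpha>))"
    unfolding \<Phi>_def m_def[symmetric] n_def[symmetric] split
    by (simp add: algebra_simps sum.distrib sum_subtractf)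
  then have eq: "\<Phi> v - \<Phi> u = Sr u * (u powr - \<alpha> - v powr - \<alpha>)
      + (\<Sum>U=Suc m..n. real (W p q U) * (real U powr - \<alpha> - v powr - \<alpha>))"
    unfolding S by (simp add: sum_distrib_right)
  have range: "u < real U" "real U \<le> v" if "U \<in> {Suc m..n}" for U
    using that assms unfolding m_def n_def by (auto simp: nat_less_iff floor_less_iff Suc_le_eq le_nat_iff le_floor_iff)
  have "0 \<le> real (W p q U) * (real U powr - \<alpha> - v powr - \<alpha>)" if "U \<in> {Suc m..n}" for U
    using range[OF that] assms \<alpha>_pos powr_mono2'[of "- \<alpha>" "real U" v] by (intro mult_nonneg_nonneg) auto
  then show "Sr u * (u powr - \<alpha> - v powr - \<alpha>) \<le> \<Phi> v - \<Phi> u"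
    unfolding eq using sum_nonneg[of "{Suc m..n}" "\<lambda>U. real (W p q U) * (real U powr - \<alpha> - v powr - \<alpha>)"] by simp
  have "real (W p q U) * (real U powr - \<alpha> - v powr - \<alpha>) \<le> real (W p q U) * (u powr - \<alpha> - v powr - \<alpha>)"
    if "U \<in> {Suc m..n}" for U
    using range[OF that] assms \<alpha>_pos powr_mono2'[of "- \<alpha>" u "real U"] by (intro mult_left_mono) auto
  then have "(\<Sum>U=Suc m..n. real (W p q U) * (real U powr - \<alpha> - v powr - \<alpha>)) \<le>
      (\<Sum>U=Suc m..n. real (W p q U)) * (u powr - \<alpha> - v powr - \<alpha>)"
    unfolding sum_distrib_right by (rule sum_mono)
  then show "\<Phi> v - \<Phi> u \<le> Sr v * (u powr - \<alpha> - v powr - \<alpha>)"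
    unfolding eq S by (simp add: distrib_right)
qed

text \<open>The interval is cut geometrically into k pieces of ratio \<rho> = r^(1/k). Each
  contributes at least c (1 - \<rho>^-alpha) and at most C (\<rho>^alpha - 1); k times these tends
  to c alpha ln r and C alpha ln r.\<close>

lemma \<Phi>_bounds:
  assumes "y > 0" "r > 1" and c: "\<And>u. y / r \<le> u \<Longrightarrow> u \<le> y \<Longrightarrow> c \<le> Sr u * u powr - \<alpha> \<and> Sr u * u powr - \<alpha> \<le> C"
  shows "c * \<alpha> * ln r \<le> \<Phi> y - \<Phi> (y / r)" "\<Phi> y - \<Phi> (y / r) \<le> C * \<alpha> * ln r"
proof -
  have bounds: "real k * (c * (1 - exp (- (\<alpha> * ln r) / real k))) \<le> \<Phi> y - \<Phi> (y / r) \<and>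
      \<Phi> y - \<Phi> (y / r) \<le> real k * (C * (exp (\<alpha> * ln r / real k) - 1))" if "k > 0" for k
  proof -
    define \<rho> where "\<rho> = exp (ln r / real k)"
    have \<rho>: "\<rho> > 1" using assms(2) that by (simp add: \<rho>_def)
    have \<rho>k: "\<rho> ^ k = r" using that assms(2) by (simp add: \<rho>_def flip: exp_of_nat_mult)
    have \<rho>\<alpha>: "\<rho> powr - \<alpha> = exp (- (\<alpha> * ln r) / real k)" "\<rho> powr \<alpha> = exp (\<alpha> * ln r / real k)"
      by (simp_all add: \<rho>_def powr_def)
    have step: "c * (1 - \<rho> powr - \<alpha>) \<le> \<Phi> (u * \<rho>) - \<Phi> u \<and> \<Phi> (u * \<rho>) - \<Phi> u \<le> C * (\<rho> powr \<alpha> - 1)"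
      if u: "y / r \<le> u" "u * \<rho> \<le> y" for u
    proof -
      have "y / r > 0" using assms by simp
      then have u0: "u > 0" using u by linarith
      have le: "u \<le> u * \<rho>" using u0 \<rho> by simp
      have lt1: "\<rho> powr - \<alpha> < 1" "\<rho> powr \<alpha> > 1" using \<rho> \<alpha>_pos by (simp_all add: powr_less_one gr_one_powr)
      have "c * (1 - \<rho> powr - \<alpha>) \<le> (Sr u * u powr - \<alpha>) * (1 - \<rho> powr - \<alpha>)"
        using c[of u] u le lt1 by (intro mult_right_mono) auto
      also have "\<dots> = Sr u * (u powr - \<alpha> - (u * \<rho>) powr - \<alpha>)" using u0 \<rho> by (simp add: powr_mult algebra_simps)
      also have "\<dots> \<le> \<Phi> (u * \<rho>) - \<Phi> u" by (rule \<Phi>_diff(1)[OF u0 le])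
      finally have 1: "c * (1 - \<rho> powr - \<alpha>) \<le> \<Phi> (u * \<rho>) - \<Phi> u" .
      have "\<Phi> (u * \<rho>) - \<Phi> u \<le> Sr (u * \<rho>) * (u powr - \<alpha> - (u * \<rho>) powr - \<alpha>)" by (rule \<Phi>_diff(2)[OF u0 le])
      also have "u powr - \<alpha> = (u * \<rho>) powr - \<alpha> * \<rho> powr \<alpha>"
      proof -
        have "\<rho> powr - \<alpha> * \<rho> powr \<alpha> = 1" using \<rho> by (simp flip: powr_add)
        then show ?thesis using u0 \<rho> by (simp add: powr_mult mult.assoc)
      qed
      also have "Sr (u * \<rho>) * ((u * \<rho>) powr - \<alpha> * \<rho> powr \<alpha> - (u * \<rho>) powr - \<alpha>) =
          (Sr (u * \<rho>) * (u * \<rho>) powr - \<alpha>) * (\<rho> powr \<alpha> - 1)" by (simp add: algebra_simps)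
      also have "\<dots> \<le> C * (\<rho> powr \<alpha> - 1)" using c[of "u * \<rho>"] u le lt1 by (intro mult_right_mono) auto
      finally show ?thesis using 1 by blast
    qed
    have "real j * (c * (1 - \<rho> powr - \<alpha>)) \<le> \<Phi> (y / r * \<rho> ^ j) - \<Phi> (y / r) \<and>
        \<Phi> (y / r * \<rho> ^ j) - \<Phi> (y / r) \<le> real j * (C * (\<rho> powr \<alpha> - 1))" if "j \<le> k" for j
      using that
    proof (induction j)
      case (Suc j)
      have "y / r * \<rho> ^ j * \<rho> = y / r * \<rho> ^ Suc j" by simp
      also have "\<dots> \<le> y / r * \<rho> ^ k" using Suc.prems \<rho> assms by (intro mult_left_mono power_increasing) auto
      also have "\<dots> = y" using \<rho>k assms by simp
      finally have le: "y / r * \<rho> ^ j * \<rho> \<le> y" .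
      have "1 \<le> \<rho> ^ j" using \<rho> by (intro one_le_power) simp
      then have "y / r * 1 \<le> y / r * \<rho> ^ j" using assms by (intro mult_left_mono) auto
      with step[OF _ le] Suc show ?case by (simp add: algebra_simps)
    qed simp
    from this[of k] show ?thesis using \<rho>k assms unfolding \<rho>\<alpha> by simp
  qed
  have l1: "(\<lambda>k. real k * (c * (1 - exp (- s / real k)))) \<longlonglongrightarrow> c * s" for s
    by real_asymp
  have l2: "(\<lambda>k. real k * (C * (exp (s / real k) - 1))) \<longlonglongrightarrow> C * s" for s
    by real_asymp
  have "c * (\<alpha> * ln r) \<le> \<Phi> y - \<Phi> (y / r)"
    by (rule LIMSEQ_le_const2[OF l1]) (use bounds in \<open>auto intro!: exI[of _ 1]\<close>)
  then show "c * \<alpha> * ln r \<le> \<Phi> y - \<Phi> (y / r)" by (simp add: mult.assoc)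
  have "\<Phi> y - \<Phi> (y / r) \<le> C * (\<alpha> * ln r)"
    by (rule LIMSEQ_le_const[OF l2]) (use bounds in \<open>auto intro!: exI[of _ 1]\<close>)
  then show "\<Phi> y - \<Phi> (y / r) \<le> C * \<alpha> * ln r" by (simp add: mult.assoc)
qed

definition J :: "real \<Rightarrow> real" where
  "J x = \<Phi> x - 2 * P * \<Phi> (x / p) - 2 * Q * \<Phi> (x / q) + 2 * (P * Q) * \<Phi> (x / (p * q))"

text \<open>Index i stands for the term V = i + 1 of the series in the constant.\<close>

definition c :: "nat \<Rightarrow> real" where
  "c i = real (W0 p q (Suc i)) * (real (Suc i) powr - \<alpha> - real (Suc (Suc i)) powr - \<alpha>)"

text \<open>At an integer N all values of Phi become sums with the same weight h(U) = U^-alpha -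
  N^-alpha: P Phi(N/p) is the sum of W(V) h(pV), and similarly for q and pq. With W(U) = w(U) +
  w(U-1), J is then the sum of (w(U-1) - w(U)) h(U), and h(N) = 0 removes the boundary term at
  N.\<close>

lemma J_nat: "J (real (Suc n)) = 1 - real (Suc n) powr - \<alpha> - (\<Sum>i<n. c i)"
proof -
  define N where "N = Suc n"
  define h where "h = (\<lambda>U. real U powr - \<alpha> - real N powr - \<alpha>)"
  have scale: "d powr - \<alpha> * \<Phi> (real N / d) = (\<Sum>V=1..N div d. real (W p q V) * h (d * V))" if "d > 0" for d :: nat
    using that nat_floor_divide[of "real N" d] unfolding \<Phi>_def h_def sum_distrib_left
    by (intro sum.cong) (auto simp: powr_mult powr_divide algebra_simps powr_minus_divide)
  have "P * \<Phi> (N / p) + Q * \<Phi> (N / q) - P * Q * \<Phi> (N / (p * q)) = (\<Sum>U=1..N. real (W0 p q U) * h U)"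
    unfolding sum_W0_mult using scale[of p] scale[of q] scale[of "p * q"] p_gt_1 q_gt_1
    by (simp add: P_def Q_def powr_mult)
  moreover have "\<Phi> N = (\<Sum>U=1..N. (real (W0 p q U) + real (W0 p q (U - 1))) * h U)"
  proof -
    have "real (W p q U) = real (W0 p q U) + real (W0 p q (U - 1))" if "U \<in> {1..N}" for U
      using that W_Suc[of "U - 1"] by (cases U) auto
    then show ?thesis unfolding \<Phi>_def h_def by simp
  qed
  moreover have "J N = \<Phi> N - 2 * (P * \<Phi> (N / p) + Q * \<Phi> (N / q) - P * Q * \<Phi> (N / (p * q)))"
    unfolding J_def by (simp add: algebra_simps)
  ultimately have "J N = (\<Sum>U=1..N. (real (W0 p q (U - 1)) - real (W0 p q U)) * h U)"
    by (simp add: sum_distrib_left algebra_simps flip: sum.distrib sum_subtractf)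
  also have "\<dots> = h 1 - real (W0 p q N) * h N - (\<Sum>i<n. real (W0 p q (Suc i)) * (h (Suc i) - h (Suc (Suc i))))"
    unfolding N_def using sum_by_parts[of "\<lambda>U. real (W0 p q U)" h n] by (simp add: W0_0)
  also have "\<dots> = 1 - real N powr - \<alpha> - (\<Sum>i<n. c i)"
    by (simp add: h_def c_def)
  finally show ?thesis unfolding N_def .
qed

lemma c_nonneg: "0 \<le> c i"
  unfolding c_def using \<alpha>_pos by (intro mult_nonneg_nonneg) (auto intro!: powr_mono2')

text \<open>With V = i + 1 and \<gamma> = \<alpha> - \<beta>, alpha V^beta s^(-alpha-1) <= alpha
  s^(-gamma-1) for s >= V. Integration over [V, V+1] bounds c i by a telescoping difference.\<close>

lemma c_sum_bound:
  obtains B \<gamma> where "\<gamma> > 0" "B > 0" "\<And>m n. m \<le> n \<Longrightarrow> (\<Sum>i=m..<n. c i) \<le> B * real (Suc m) powr - \<gamma>"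
proof -
  obtain \<beta> where \<beta>: "0 < \<beta>" "\<beta> < \<alpha>" "\<And>n. n \<ge> 1 \<Longrightarrow> real (W p q n) \<le> real n powr \<beta>" by (rule W_bound) blast
  define \<gamma> where "\<gamma> = \<alpha> - \<beta>"
  have \<gamma>: "\<gamma> > 0" using \<beta> by (simp add: \<gamma>_def)
  have c_step: "c i \<le> \<alpha> / \<gamma> * real (Suc i) powr - \<gamma> - \<alpha> / \<gamma> * real (Suc (Suc i)) powr - \<gamma>" for i
  proof -
    define V where "V = real (Suc i)"
    have V: "V \<ge> 1" by (simp add: V_def)
    \<comment> \<open>That f does not increase from V to V + 1 is this integral comparison in
      differential form.\<close>
    define f where "f = (\<lambda>s. \<alpha> / \<gamma> * s powr - \<gamma> - V powr \<beta> * s powr - \<alpha>)"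
    have "f (V + 1) \<le> f V"
    proof (rule DERIV_nonpos_imp_nonincreasing[of V "V + 1" f])
      fix s assume s: "V \<le> s" "s \<le> V + 1"
      have s0: "s > 0" using s V by linarith
      have "(f has_real_derivative (\<alpha> / \<gamma> * (- \<gamma> * s powr (- \<gamma> - 1)) - V powr \<beta> * (- \<alpha> * s powr (- \<alpha> - 1)))) (at s)"
        unfolding f_def using s0 by (auto intro!: derivative_eq_intros)
      moreover have "\<alpha> / \<gamma> * (- \<gamma> * s powr (- \<gamma> - 1)) - V powr \<beta> * (- \<alpha> * s powr (- \<alpha> - 1)) \<le> 0"
      proof -
        have "- \<gamma> - 1 = \<beta> + (- \<alpha> - 1)" by (simp add: \<gamma>_def)
        then have "s powr (- \<gamma> - 1) = s powr \<beta> * s powr (- \<alpha> - 1)" by (simp only: powr_add)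
        moreover have "V powr \<beta> * s powr (- \<alpha> - 1) \<le> s powr \<beta> * s powr (- \<alpha> - 1)"
          using s V \<beta> by (intro mult_right_mono powr_mono2) auto
        ultimately have "\<alpha> * (V powr \<beta> * s powr (- \<alpha> - 1)) \<le> \<alpha> * s powr (- \<gamma> - 1)"
          using \<alpha>_pos by (intro mult_left_mono) auto
        then show ?thesis using \<gamma> by (simp add: mult_ac)
      qed
      ultimately show "\<exists>y. (f has_real_derivative y) (at s) \<and> y \<le> 0" by blast
    qed simp
    moreover have "c i \<le> V powr \<beta> * (V powr - \<alpha> - (V + 1) powr - \<alpha>)"
    proof -
      have "real (W0 p q (Suc i)) \<le> V powr \<beta>"
        using W0_le_W[of p q "Suc i"] \<beta>(3)[of "Suc i"] unfolding V_def by simp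
      moreover have "(V + 1) powr - \<alpha> \<le> V powr - \<alpha>" using V \<alpha>_pos by (intro powr_mono2') auto
      moreover have "V + 1 = real (Suc (Suc i))" by (simp add: V_def)
      ultimately show ?thesis unfolding c_def V_def[symmetric] by (metis V_def diff_ge_0_iff_ge mult_right_mono)
    qed
    ultimately have "c i \<le> \<alpha> / \<gamma> * V powr - \<gamma> - \<alpha> / \<gamma> * (V + 1) powr - \<gamma>"
      unfolding f_def by (simp add: right_diff_distrib)
    then show ?thesis by (simp add: V_def add.commute)
  qed
  show thesis
  proof (rule that[OF \<gamma>, of "\<alpha> / \<gamma>"])
    show "\<alpha> / \<gamma> > 0" using \<gamma> \<alpha>_pos by simp
    fix m n :: nat assume "m \<le> n"
    then have "(\<Sum>i=m..<n. c i) \<le> \<alpha> / \<gamma> * real (Suc m) powr - \<gamma> - \<alpha> / \<gamma> * real (Suc n) powr - \<gamma>"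
    proof (induction n rule: dec_induct)
      case (step n)
      then show ?case using c_step[of n] by (simp add: sum.atLeastLessThan_Suc)
    qed simp
    moreover have "\<alpha> / \<gamma> * real (Suc n) powr - \<gamma> \<ge> 0" using \<gamma> \<alpha>_pos by simp
    ultimately show "(\<Sum>i=m..<n. c i) \<le> \<alpha> / \<gamma> * real (Suc m) powr - \<gamma>" by linarith
  qed
qed

text \<open>The tail is below 2^-k once n^gamma >= 2^(b+k), where B <= 2^b. As l \<gamma> >= 1 and b
  + k <= (b+1)(k+1), e = l (b+1) works. Its mere existence suffices for computability: an algorithm
  may contain it as a constant.\<close>

lemma c_tail:
  obtains e where "\<And>n k. n \<ge> 2 ^ (e * (k + 1)) \<Longrightarrow> (\<Sum>i. c i) - (\<Sum>i<n. c i) \<le> 1 / 2 ^ k" "summable c"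
proof -
  obtain B \<gamma> where B: "\<gamma> > 0" "B > 0" "\<And>m n. m \<le> n \<Longrightarrow> (\<Sum>i=m..<n. c i) \<le> B * real (Suc m) powr - \<gamma>"
    by (rule c_sum_bound) blast
  have summ: "summable c"
  proof (rule summableI_nonneg_bounded[OF c_nonneg])
    show "(\<Sum>i<n. c i) \<le> B" for n using B(3)[of 0 n] by (simp add: atLeast0LessThan)
  qed
  obtain b :: nat where b: "B \<le> 2 ^ b" using real_arch_pow[of 2 B] by (auto intro: less_imp_le)
  obtain l :: nat where l: "1 / \<gamma> \<le> real l" using real_arch_simple by blast
  show thesis
  proof (rule that[OF _ summ])
    fix n k :: nat assume n: "n \<ge> 2 ^ ((l * (b + 1)) * (k + 1))"
    have tail: "(\<Sum>i. c i) - (\<Sum>i<n. c i) \<le> B * real (Suc n) powr - \<gamma>"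
    proof -
      have "(\<Sum>i<m. c i) \<le> (\<Sum>i<n. c i) + B * real (Suc n) powr - \<gamma>" if "m \<ge> n" for m
        using B(3)[OF that] sum.atLeastLessThan_concat[of 0 n m c] that by (simp add: atLeast0LessThan)
      then have "(\<Sum>i. c i) \<le> (\<Sum>i<n. c i) + B * real (Suc n) powr - \<gamma>"
        using LIMSEQ_le_const2[OF summable_LIMSEQ[OF summ]] by blast
      then show ?thesis by simp
    qed
    have "2 ^ ((l * (b + 1)) * (k + 1)) \<le> Suc n" using n by simp
    then have nS: "real (2 ^ ((l * (b + 1)) * (k + 1))) \<le> real (Suc n)" by (simp only: of_nat_le_iff)
    have l0: "real l * \<gamma> \<ge> 1" using l B(1) by (simp add: field_simps)
    have nn: "real ((b + 1) * (k + 1)) \<ge> real (b + k)" by (simp only: of_nat_le_iff) simp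
    have "real (b + k) * 1 \<le> real ((b + 1) * (k + 1)) * (real l * \<gamma>)"
      using nn l0 by (intro mult_mono) auto
    then have "2 powr real (b + k) \<le> 2 powr (real ((l * (b + 1)) * (k + 1)) * \<gamma>)"
      by (intro powr_mono) (simp_all add: algebra_simps)
    also have "\<dots> = (real (2 ^ ((l * (b + 1)) * (k + 1)))) powr \<gamma>" by (simp add: powr_powr flip: powr_realpow)
    also have "\<dots> \<le> real (Suc n) powr \<gamma>"
      using B(1) nS by (intro powr_mono2) (simp_all only: of_nat_0_le_iff less_imp_le)
    finally have "2 ^ b * 2 ^ k \<le> real (Suc n) powr \<gamma>" by (simp add: powr_realpow power_add flip: of_nat_add)
    moreover have "B * 2 ^ k \<le> 2 ^ b * 2 ^ k" using b by (intro mult_right_mono) auto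
    ultimately have "B * 2 ^ k \<le> real (Suc n) powr \<gamma>" by linarith
    then have "B * real (Suc n) powr - \<gamma> \<le> 1 / 2 ^ k" by (simp add: powr_minus field_simps)
    with tail show "(\<Sum>i. c i) - (\<Sum>i<n. c i) \<le> 1 / 2 ^ k" by linarith
  qed
qed

definition Jinf :: real where "Jinf = 1 - (\<Sum>i. c i)"

lemma J_tendsto: "(\<lambda>n. J (real n)) \<longlonglongrightarrow> Jinf"
proof -
  obtain e where "summable c" by (rule c_tail) blast
  have "(\<lambda>n. real (Suc n) powr - \<alpha>) \<longlonglongrightarrow> 0"
    using \<alpha>_pos by real_asymp
  then have "(\<lambda>n. 1 - real (Suc n) powr - \<alpha> - (\<Sum>i<n. c i)) \<longlonglongrightarrow> 1 - 0 - (\<Sum>i. c i)"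
    by (intro tendsto_intros summable_LIMSEQ \<open>summable c\<close>)
  then have "(\<lambda>n. J (real (Suc n))) \<longlonglongrightarrow> Jinf" unfolding J_nat Jinf_def by simp
  then show ?thesis by (rule LIMSEQ_imp_Suc)
qed

definition K :: real where
  "K = ln (real p powr \<alpha>) / (real p powr \<alpha> - 1) + ln (real q powr \<alpha>) / (real q powr \<alpha> - 1)"

text \<open>Since (1-P)(1-Q) = 1/2, the fraction 1/(p^alpha - 1) = P/(1-P) equals 2P(1-Q), and
  likewise for q. The resulting coefficients of the logarithms match those in
  \<open>J\<close>.\<close>

lemma K_eq: "K = \<alpha> * (2 * P * ln p + 2 * Q * ln q - 2 * (P * Q) * ln (p * q))"
proof -
  have e: "ln (real p powr \<alpha>) = \<alpha> * ln p" "ln (real q powr \<alpha>) = \<alpha> * ln q" "ln (real (p * q)) = ln p + ln q"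
    using p_gt_1 q_gt_1 by (simp_all add: ln_powr ln_mult)
  have PQ: "real p powr \<alpha> = 1 / P" "real q powr \<alpha> = 1 / Q"
    using p_gt_1 q_gt_1 by (simp_all add: P_def Q_def powr_minus_divide)
  have half: "2 * ((1 - P) * (1 - Q)) = 1" using PQ_eq by (simp add: algebra_simps)
  have cancel: "P * (1 / P - 1) = 1 - P" "Q * (1 / Q - 1) = 1 - Q"
    using PQ_pos by (simp_all add: right_diff_distrib)
  have "2 * (1 - Q) * (P * (1 / P - 1)) = 1" "2 * (1 - P) * (Q * (1 / Q - 1)) = 1"
    using half unfolding cancel by (simp_all only: mult_ac)
  then have "2 * P * (1 - Q) * (1 / P - 1) = 1" "2 * Q * (1 - P) * (1 / Q - 1) = 1" by (simp_all only: mult_ac)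
  then have "1 / (real p powr \<alpha> - 1) = 2 * P * (1 - Q)" "1 / (real q powr \<alpha> - 1) = 2 * Q * (1 - P)"
    unfolding PQ by (metis divide_eq_eq mult_zero_right zero_neq_one)+
  then have "K = \<alpha> * ln p * (2 * P * (1 - Q)) + \<alpha> * ln q * (2 * Q * (1 - P))"
    unfolding K_def e by (metis mult.right_neutral times_divide_eq_right)
  then show ?thesis unfolding e(3)[unfolded of_nat_mult] of_nat_mult by (simp add: algebra_simps)
qed

lemma K_pos: "K > 0"
proof -
  have "real p powr \<alpha> > 1" "real q powr \<alpha> > 1" using p_gt_1 q_gt_1 \<alpha>_pos by (simp_all add: gr_one_powr)
  then show ?thesis unfolding K_def by (intro add_pos_pos divide_pos_pos ln_gt_zero) simp_all
qed

text \<open>Where S is near L x^alpha on [n/(pq), n], Phi(n) - Phi(n/r) is near L alpha ln r, so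
  J(n) is near L K. Such n occur arbitrarily far out, and J converges along the integers.\<close>

lemma long_limit_eq:
  assumes "long_limit \<Lambda>" shows "\<Lambda> = (1 - Q) * (Jinf / K)"
proof -
  define L where "L = \<Lambda> / (1 - Q)"
  \<comment> \<open>\<open>K\<close> with all terms taken positive: it bounds the total error per
    unit of \<eta>.\<close>
  define A where "A = \<alpha> * (2 * P * ln p + 2 * Q * ln q + 2 * (P * Q) * ln (p * q))"
  have ln0: "ln (real p) > 0" "ln (real q) > 0" "ln (real (p * q)) > 0" using p_gt_1 q_gt_1
    by (simp_all add: ln_mult add_pos_pos)
  have A: "A > 0" unfolding A_def using ln0 PQ_pos \<alpha>_pos by (intro mult_pos_pos add_pos_pos) auto
  have pq1: "real p > 1" "real q > 1" "real (p * q) > 1" using p_gt_1 q_gt_1 less_1_mult[of "real p" "real q"] by simp_all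
  have near: "\<exists>n\<ge>n0. \<bar>J (real n) - L * K\<bar> \<le> \<epsilon>" if "\<epsilon> > 0" for n0 \<epsilon>
  proof -
    define \<eta> where "\<eta> = \<epsilon> / A"
    have \<eta>: "\<eta> > 0" using that A by (simp add: \<eta>_def)
    have "\<eta> * (1 - Q) > 0" "2 * real (p * q) \<ge> 1" using \<eta> PQ_less pq1 by simp_all
    \<comment> \<open>The factor 2 in the interval ratio pays for rounding y down to the integer
      n.\<close>
    then obtain y where y: "y \<ge> max 1 (real (Suc n0))"
      "\<And>u. y / (2 * real (p * q)) \<le> u \<Longrightarrow> u \<le> y \<Longrightarrow> \<bar>t u - \<Lambda>\<bar> \<le> \<eta> * (1 - Q)"
      using assms unfolding long_limit_def by blast
    define n where "n = nat \<lfloor>y\<rfloor>"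
    have n': "n \<ge> n0" "n \<ge> 1" "real n \<le> y" "y < real n + 1" using y(1) unfolding n_def by linarith+
    then have n: "n \<ge> n0" "n \<ge> 1" "real n \<le> y" "y / 2 \<le> real n" by linarith+
    have near: "L - \<eta> \<le> Sr u * u powr - \<alpha> \<and> Sr u * u powr - \<alpha> \<le> L + \<eta>"
      if "real n / real (p * q) \<le> u" "u \<le> real n" for u
    proof -
      have "y / (2 * real (p * q)) = y / 2 / real (p * q)" by simp
      also have "\<dots> \<le> real n / real (p * q)" using n(4) by (intro divide_right_mono) auto
      finally have "\<bar>t u - \<Lambda>\<bar> \<le> \<eta> * (1 - Q)" using that n by (intro y(2)) linarith+
      moreover have "t u = (1 - Q) * (Sr u * u powr - \<alpha>)" "\<Lambda> = (1 - Q) * L"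
        using PQ_less by (simp_all add: t_def L_def)
      ultimately have "\<bar>Sr u * u powr - \<alpha> - L\<bar> * (1 - Q) \<le> \<eta> * (1 - Q)"
        using PQ_less by (simp add: abs_mult flip: right_diff_distrib)
      then have "\<bar>Sr u * u powr - \<alpha> - L\<bar> \<le> \<eta>" using PQ_less by simp
      then show ?thesis by linarith
    qed
    have \<Phi>: "(L - \<eta>) * \<alpha> * ln r \<le> \<Phi> n - \<Phi> (n / r) \<and> \<Phi> n - \<Phi> (n / r) \<le> (L + \<eta>) * \<alpha> * ln r"
      if "r > 1" "r \<le> real (p * q)" for r
    proof -
      have "real n / real (p * q) \<le> real n / r" using that by (intro divide_left_mono) auto
      then show ?thesis using \<Phi>_bounds[of "real n" r "L - \<eta>" "L + \<eta>"] near n(2) that by force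
    qed
    have le: "real p \<le> real (p * q)" "real q \<le> real (p * q)" using p_gt_1 q_gt_1 by simp_all
    define Z where "Z = (\<lambda>r. \<Phi> n - \<Phi> (n / r) - L * (\<alpha> * ln r))"
    have Z: "\<bar>Z r\<bar> \<le> \<eta> * (\<alpha> * ln r)" if "r > 1" "r \<le> real (p * q)" for r
      using \<Phi>[OF that] unfolding Z_def by (simp add: algebra_simps abs_le_iff)
    \<comment> \<open>The coefficient of Phi(n) vanishes by the exponent equation, which leaves only
      differences of Phi.\<close>
    have "J n - L * K = (1 - (2 * P + 2 * Q - 2 * (P * Q))) * \<Phi> n + 2 * P * Z p + 2 * Q * Z q - 2 * (P * Q) * Z (p * q)"
      unfolding J_def K_eq Z_def by (simp add: algebra_simps)
    then have J: "J n - L * K = 2 * P * Z p + 2 * Q * Z q - 2 * (P * Q) * Z (p * q)" unfolding PQ_eq by simp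
    have "\<bar>J n - L * K\<bar> \<le> 2 * P * \<bar>Z p\<bar> + 2 * Q * \<bar>Z q\<bar> + 2 * (P * Q) * \<bar>Z (p * q)\<bar>"
    proof -
      have "2 * P * \<bar>Z p\<bar> = \<bar>2 * P * Z p\<bar>" "2 * Q * \<bar>Z q\<bar> = \<bar>2 * Q * Z q\<bar>"
        "2 * (P * Q) * \<bar>Z (p * q)\<bar> = \<bar>2 * (P * Q) * Z (p * q)\<bar>"
        using PQ_pos by (simp_all add: abs_mult)
      then show ?thesis unfolding J by linarith
    qed
    also have "\<dots> \<le> 2 * P * (\<eta> * (\<alpha> * ln p)) + 2 * Q * (\<eta> * (\<alpha> * ln q)) + 2 * (P * Q) * (\<eta> * (\<alpha> * ln (p * q)))"
      using Z[of p] Z[of q] Z[of "real (p * q)"] pq1 le PQ_pos by (intro add_mono mult_left_mono) auto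
    also have "\<dots> = \<eta> * A" by (simp add: A_def algebra_simps)
    also have "\<dots> = \<epsilon>" using A by (simp add: \<eta>_def)
    finally show ?thesis using n(1) by blast
  qed
  have "\<bar>Jinf - L * K\<bar> \<le> 0 + \<epsilon>" if eps: "\<epsilon> > 0" for \<epsilon>
  proof -
    have "eventually (\<lambda>n. \<bar>J (real n) - Jinf\<bar> < \<epsilon> / 2) sequentially"
      using tendstoD[OF J_tendsto, of "\<epsilon> / 2"] eps by (simp add: dist_real_def)
    then obtain n0 where "\<And>n. n \<ge> n0 \<Longrightarrow> \<bar>J (real n) - Jinf\<bar> < \<epsilon> / 2"
      unfolding eventually_sequentially by blast
    moreover obtain n where "n \<ge> n0" "\<bar>J (real n) - L * K\<bar> \<le> \<epsilon> / 2" using near[OF half_gt_zero[OF eps], of n0] by blast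
    ultimately show ?thesis by (smt (verit) field_sum_of_halves)
  qed
  then have "\<bar>Jinf - L * K\<bar> \<le> 0" by (rule field_le_epsilon)
  then have "L * K = Jinf" by simp
  then show ?thesis using K_pos PQ_less by (simp add: L_def field_simps)
qed

lemma Sr_tendsto: "((\<lambda>x. Sr x * x powr - \<alpha>) \<longlongrightarrow> Jinf / K) at_top"
proof -
  have "((\<lambda>x. t x / (1 - Q)) \<longlongrightarrow> (1 - Q) * (Jinf / K) / (1 - Q)) at_top"
    by (intro tendsto_divide t_tendsto long_limit_eq tendsto_const) (use PQ_less in auto)
  moreover have "t x / (1 - Q) = Sr x * x powr - \<alpha>" for x using PQ_less by (simp add: t_def)
  ultimately show ?thesis using PQ_less by simp
qed

text \<open>The series does not show the sign; the lower bound of order x^alpha on S does, through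
  the limit Jinf / K.\<close>

lemma Jinf_pos: "Jinf > 0"
proof -
  obtain m where m: "m > 0" "\<And>x. x \<ge> 1 \<Longrightarrow> m * x powr \<alpha> \<le> Sr x" by (rule lower_bound) blast
  have "m \<le> Jinf / K"
  proof (rule tendsto_lowerbound[OF Sr_tendsto])
    show "eventually (\<lambda>x. m \<le> Sr x * x powr - \<alpha>) at_top"
      using eventually_ge_at_top[of 1]
    proof eventually_elim
      case (elim x)
      then have "m * x powr \<alpha> * x powr - \<alpha> \<le> Sr x * x powr - \<alpha>" by (intro mult_right_mono m) auto
      then show ?case using elim by (simp add: mult.assoc flip: powr_add)
    qed
  qed simp
  then have "Jinf / K > 0" using m by linarith
  then show ?thesis using K_pos by (simp add: zero_less_divide_iff)
qed

lemma Jinf_le_1: "Jinf \<le> 1"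
proof -
  obtain e where "summable c" by (rule c_tail) blast
  then show ?thesis unfolding Jinf_def using suminf_nonneg c_nonneg by fastforce
qed

text \<open>As f increases strictly and equals 1/2 at \<alpha>, comparing a rational with \<alpha>
  amounts to comparing the computable value of f there with 1/2.\<close>

lemma computable_\<alpha>: "computable_reals (\<lambda>_. \<alpha>)"
proof (rule computable_reals_cuts)
  define f where "f = (\<lambda>s. (1 - inverse (real p powr s)) * (1 - inverse (real q powr s)))"
  have f\<alpha>: "f \<alpha> = 1 / 2" using PQ_eq unfolding f_def P_def Q_def powr_minus by (simp add: algebra_simps)
  have f_mono: "f s < f s'" if "0 \<le> s" "s < s'" for s s'
  proof -
    have "1 \<le> real p powr s" "1 \<le> real q powr s" "real p powr s < real p powr s'" "real q powr s < real q powr s'"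
      using that p_gt_1 q_gt_1 by (simp_all add: ge_one_powr_ge_zero)
    then show ?thesis unfolding f_def using p_gt_1 q_gt_1
      by (intro mult_strict_mono') (auto intro!: less_imp_inverse_less simp: inverse_le_1_iff)
  qed
  have f_iff: "f s < 1 / 2 \<longleftrightarrow> s < \<alpha>" "1 / 2 < f s \<longleftrightarrow> \<alpha> < s" if "s \<ge> 0" for s
    using f_mono[of s \<alpha>] f_mono[of \<alpha> s] f\<alpha> that \<alpha>_pos by (cases s \<alpha> rule: linorder_cases; simp)+
  have cr: "computable_reals (\<lambda>z. 1 - inverse (real b powr (real (pfst z) / real (Suc (psnd z)))))" if "b > 1" for b :: nat
  proof (rule computable_reals_diff)
    show "computable_reals (\<lambda>z. 1)" using computable_reals_of_nat[OF computable_const[of 1]] by simp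
    show "computable_reals (\<lambda>z. inverse (real b powr (real (pfst z) / real (Suc (psnd z)))))"
      using that by (intro computable_reals_inverse computable_reals_rational_powr) auto
    show "inverse (real b powr (real (pfst z) / real (Suc (psnd z)))) \<le> 1" for z
      using that by (intro inverse_le_1_iff[THEN iffD2] disjI2 ge_one_powr_ge_zero) auto
  qed
  have cf: "computable_reals (\<lambda>z. f (real (pfst z) / real (Suc (psnd z))))"
    unfolding f_def using p_gt_1 q_gt_1 by (intro computable_reals_mult cr)
  have idx: "computable_seq (\<lambda>z. pair (pfst z) (pfst (psnd z) - 1))" by (intro computable_intros)
  \<comment> \<open>The index s - 1 encodes the denominator s; s = 0 is treated apart in both
    cuts.\<close>
  have cf': "computable_reals (\<lambda>z. f (real (pfst z) / real (Suc (pfst (psnd z) - Suc 0))))"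
    using computable_reals_apply[OF cf idx] by (simp only: prod_encode_inverse fst_conv snd_conv One_nat_def)
  have s: "real (Suc (s - Suc 0)) = real s" if "s > 0" for s using that by simp
  have "semidecidable (\<lambda>z. pfst (psnd z) > 0 \<and>
      real (2::nat) * f (real (pfst z) / real (Suc (pfst (psnd z) - Suc 0))) < real (1::nat))"
    by (intro semidecidable_conj semidecidable_less_computable_real(2) cf' semidecidable_if_decidable computable_intros)
  moreover have "s > 0 \<and> real (2::nat) * f (real r / real (Suc (s - Suc 0))) < real (1::nat) \<longleftrightarrow> real r < real s * \<alpha>" for r s :: nat
  proof (cases "s = 0")
    case False
    then have "real (2::nat) * f (real r / real s) < real (1::nat) \<longleftrightarrow> real r / real s < \<alpha>"
      using f_iff(1)[of "real r / real s"] by auto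
    also have "\<dots> \<longleftrightarrow> real r < real s * \<alpha>" using False by (simp add: divide_less_eq mult.commute)
    finally show ?thesis using False s[of s] by simp
  qed simp
  ultimately show "semidecidable (\<lambda>z. real (pfst z) < real (pfst (psnd z)) * \<alpha>)" by simp
  have "semidecidable (\<lambda>z. (pfst (psnd z) = 0 \<and> pfst z > 0) \<or> (pfst (psnd z) > 0 \<and>
      real (1::nat) < real (2::nat) * f (real (pfst z) / real (Suc (pfst (psnd z) - Suc 0)))))"
    by (intro semidecidable_disj_decidable semidecidable_conj semidecidable_less_computable_real(1) cf'
        semidecidable_if_decidable computable_intros)
  moreover have "(s = 0 \<and> r > 0) \<or> (s > 0 \<and> real (1::nat) < real (2::nat) * f (real r / real (Suc (s - Suc 0)))) \<longleftrightarrow>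
      real s * \<alpha> < real r" for r s :: nat
  proof (cases "s = 0")
    case False
    then have "real (1::nat) < real (2::nat) * f (real r / real s) \<longleftrightarrow> \<alpha> < real r / real s"
      using f_iff(2)[of "real r / real s"] by auto
    also have "\<dots> \<longleftrightarrow> real s * \<alpha> < real r" using False by (simp add: less_divide_eq mult.commute)
    finally show ?thesis using False s[of s] by simp
  qed simp
  ultimately show "semidecidable (\<lambda>z. real (pfst (psnd z)) * \<alpha> < real (pfst z))" by simp
qed (use \<alpha>_pos in simp)

lemma computable_one: "computable_reals (\<lambda>_. 1)"
  using computable_reals_of_nat[OF computable_const[of 1]] by simp

lemma computable_Jinf: "computable_reals (\<lambda>_. Jinf)"
proof -
  obtain e where e: "\<And>n k. n \<ge> 2 ^ (e * (k + 1)) \<Longrightarrow> (\<Sum>i. c i) - (\<Sum>i<n. c i) \<le> 1 / 2 ^ k" "summable c"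
    by (rule c_tail) blast
  \<comment> \<open>Negative powers are reached as inverses, since
    \<open>computable_reals_powr\<close> takes a positive exponent.\<close>
  have pw: "computable_reals (\<lambda>i. inverse (real (g i) powr \<alpha>))" if "computable_seq g" "\<And>i. g i > 0" for g
    using that computable_\<alpha> \<alpha>_pos by (intro computable_reals_inverse computable_reals_powr) auto
  have "computable_reals (\<lambda>i. real (W0 p q (Suc i)) * (inverse (real (Suc i) powr \<alpha>) - inverse (real (Suc (Suc i)) powr \<alpha>)))"
    using \<alpha>_pos
    by (intro computable_reals_mult computable_reals_diff pw computable_reals_of_nat
        computable_apply[OF computable_W0] computable_intros le_imp_inverse_le powr_mono2) auto
  then have c: "computable_reals c" by (simp add: c_def[abs_def] powr_minus)
  have "computable_reals (\<lambda>z. \<Sum>i<2 ^ (e * (psnd z + 1)). c i)"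
    by (intro computable_reals_sum computable_reals_apply[OF c] computable_intros)
  then have "computable_reals (\<lambda>_. \<Sum>i. c i)"
  proof (rule computable_reals_limit)
    show "\<bar>(\<Sum>i. c i) - (\<Sum>i<2 ^ (e * (k + 1)). c i)\<bar> \<le> 1 / 2 ^ k" for k
      using e(1)[OF order_refl, of k] sum_le_suminf[OF e(2), of "{..<2 ^ (e * (k + 1))}"] c_nonneg by simp
    show "0 \<le> (\<Sum>i. c i)" by (rule suminf_nonneg[OF e(2) c_nonneg])
  qed
  then show ?thesis unfolding Jinf_def
    using Jinf_pos by (intro computable_reals_diff computable_one) (auto simp: Jinf_def)
qed

lemma computable_K: "computable_reals (\<lambda>_. K)"
proof -
  have gt1: "real b powr \<alpha> > 1" if "b > 1" for b :: nat using that \<alpha>_pos by (simp add: gr_one_powr)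
  have "computable_reals (\<lambda>_. ln (real b powr \<alpha>) / (real b powr \<alpha> - 1))" if "b > 1" for b :: nat
  proof -
    have "computable_reals (\<lambda>_. \<alpha> * ln (real b) * inverse (real b powr \<alpha> - 1))"
      using that gt1[OF that]
      by (intro computable_reals_mult computable_reals_inverse computable_reals_diff computable_\<alpha>
          computable_reals_ln computable_reals_powr computable_one computable_const \<alpha>_pos) auto
    then show ?thesis using that by (simp add: ln_powr divide_inverse)
  qed
  then show ?thesis unfolding K_def using p_gt_1 q_gt_1 by (intro computable_reals_add)
qed

end

text \<open>Factored, the equation becomes f s = 1/2, where f increases strictly for s > 0, vanishes
  at 0 and tends to 1.\<close>

lemma (in coprime_bases) exponent_exists_unique: "\<exists>!\<alpha>. is_exponent p q \<alpha>"
proof -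
  define f where "f = (\<lambda>s. (1 - real p powr - s) * (1 - real q powr - s))"
  have iff: "is_exponent p q s \<longleftrightarrow> s > 0 \<and> f s = 1 / 2" for s
    unfolding is_exponent_def f_def by (auto simp: powr_mult algebra_simps)
  have f_mono: "f s < f s'" if "0 < s" "s < s'" for s s'
  proof -
    have "real p powr - s < 1" "real q powr - s < 1" "real p powr - s' < real p powr - s" "real q powr - s' < real q powr - s"
      using that p_gt_1 q_gt_1 by (simp_all add: powr_less_one)
    then show ?thesis unfolding f_def by (intro mult_strict_mono') auto
  qed
  have "(f \<longlongrightarrow> 1) at_top"
  proof -
    have "((\<lambda>s. real b powr - s) \<longlongrightarrow> 0) at_top" if "b > 1" for b :: nat
      using that by real_asymp
    from tendsto_mult[OF tendsto_diff[OF tendsto_const this] tendsto_diff[OF tendsto_const this], OF p_gt_1 q_gt_1, of 1 1]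
    show ?thesis by (simp add: f_def)
  qed
  then have "eventually (\<lambda>s. 1 / 2 < f s) at_top" by (rule order_tendstoD) simp
  then have ev: "eventually (\<lambda>s. 1 / 2 < f s \<and> 0 < s) at_top"
    using eventually_gt_at_top by (rule eventually_conj)
  obtain b where b: "1 / 2 < f b" "b > 0" using eventually_happens[OF ev] by auto
  have "\<exists>x\<ge>0. x \<le> b \<and> f x = 1 / 2"
  proof (rule IVT')
    show "f 0 \<le> 1 / 2" using p_gt_1 q_gt_1 by (simp add: f_def)
    show "continuous_on {0..b} f" unfolding f_def using p_gt_1 q_gt_1 by (intro continuous_intros) auto
  qed (use b in auto)
  then obtain a where a: "a \<ge> 0" "f a = 1 / 2" by blast
  moreover have "f 0 = 0" using p_gt_1 q_gt_1 by (simp add: f_def)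
  ultimately have "is_exponent p q a" unfolding iff by (cases "a = 0") auto
  moreover have "s = s'" if "is_exponent p q s" "is_exponent p q s'" for s s'
    using that f_mono[of s s'] f_mono[of s' s] unfolding iff by (cases s s' rule: linorder_cases) auto
  ultimately show ?thesis by blast
qed

theorem theorem6p2:
  fixes p q :: nat
  assumes "p > 1" and "q > 1" and "coprime p q"
  shows "(\<exists>!\<alpha>. is_exponent p q \<alpha>) \<and>
    (\<forall>\<alpha>. is_exponent p q \<alpha> \<longrightarrow>
      (\<exists>C::real. computable_real C \<and> C > 0 \<and>
         (\<lambda>x::real. real (S p q x)) \<sim>[at_top] (\<lambda>x. C * x powr \<alpha>) \<and>
         C < 2 * inverse (ln (real p powr \<alpha>) / (real p powr \<alpha> - 1)
                        + ln (real q powr \<alpha>) / (real q powr \<alpha> - 1))))"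
proof (intro conjI allI impI)
  interpret coprime_bases p q by unfold_locales (fact assms)+
  show "\<exists>!\<alpha>. is_exponent p q \<alpha>" by (rule exponent_exists_unique)
  fix \<alpha> assume "is_exponent p q \<alpha>"
  then interpret chain_exponent p q \<alpha> by unfold_locales
  define C where "C = Jinf * inverse K"
  have C_pos: "C > 0" using Jinf_pos K_pos by (simp add: C_def)
  have "computable_real C"
    unfolding C_def using K_pos
    by (intro computable_real_if_computable_reals computable_reals_mult computable_reals_inverse
        computable_Jinf computable_K)
  moreover have "(\<lambda>x. Sr x) \<sim>[at_top] (\<lambda>x. C * x powr \<alpha>)"
  proof (rule asymp_equivI'[OF Lim_transform_eventually])
    show "((\<lambda>x. Sr x * x powr - \<alpha> / C) \<longlongrightarrow> 1) at_top"
      using tendsto_divide[OF Sr_tendsto tendsto_const, of C] C_pos by (simp add: divide_inverse flip: C_def)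
    show "eventually (\<lambda>x. Sr x * x powr - \<alpha> / C = Sr x / (C * x powr \<alpha>)) at_top"
      by (rule always_eventually) (simp add: powr_minus field_simps)
  qed
  moreover have "C < 2 * inverse K"
    unfolding C_def using Jinf_le_1 K_pos by (intro mult_strict_right_mono) auto
  ultimately show "\<exists>C::real. computable_real C \<and> C > 0 \<and>
      (\<lambda>x::real. real (S p q x)) \<sim>[at_top] (\<lambda>x. C * x powr \<alpha>) \<and>
      C < 2 * inverse (ln (real p powr \<alpha>) / (real p powr \<alpha> - 1) + ln (real q powr \<alpha>) / (real q powr \<alpha> - 1))"
    using C_pos unfolding K_def by blast
qed

end
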